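(* Let $X\subseteq\mathbb{C}^n$ be an irreducible algebraic variety invariant under rescaling, and let $r\geq1$ be such that $\sigma_{r+1}(X)$ has the expected dimension. Then $\mathfrak{g}_{\sigma_r(X)}=\mathfrak{g}_X$.
   Context: $X$ is invariant under rescaling if $\lambda q\in X$ for all $q\in X$, $\lambda\in\mathbb{C}$. The $r$-th secant variety is $\sigma_r(X)=\overline{\{q_1+\cdots+q_r\mid q_i\in X\}}\subseteq\mathbb{C}^n$ (Zariski closure). One always has $\dim\sigma_r(X)\le r\dim X$; $\sigma_r(X)$ has the expected dimension if $\dim\sigma_r(X)=r\dim X$. For a variety $Y\subseteq\mathbb{C}^n$, $\mathfrak{g}_Y\subseteq\mathfrak{gl}_n(\mathbb{C})$ is the Lie algebra of the Zariski closed group $G_Y=\{g\in\mathrm{GL}_n(\mathbb{C})\mid gY=Y\}$. *)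

theory Defs
  imports "HOL-Analysis.Analysis" "HOL-Library.Extended_Nat"
begin

text \<open>
  Affine \<open>n\<close>-space over the complex numbers is \<^typ>\<open>complex ^ 'n\<close> with \<open>n = CARD('n)\<close>.
  As the ground field is infinite, polynomials are identified with polynomial functions: the
  algebra of functions generated by a set \<open>C\<close> of coordinate functions.
\<close>

inductive polynomial_in :: "('a \<Rightarrow> complex) set \<Rightarrow> ('a \<Rightarrow> complex) \<Rightarrow> bool"
  for C :: "('a \<Rightarrow> complex) set" where
  const: "polynomial_in C (\<lambda>x. c)"
| coord: "f \<in> C \<Longrightarrow> polynomial_in C f"
| add: "polynomial_in C f \<Longrightarrow> polynomial_in C g \<Longrightarrow> polynomial_in C (\<lambda>x. f x + g x)"
| mult: "polynomial_in C f \<Longrightarrow> polynomial_in C g \<Longrightarrow> polynomial_in C (\<lambda>x. f x * g x)"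

definition vec_polynomial :: "(complex ^ 'n \<Rightarrow> complex) \<Rightarrow> bool" where
  "vec_polynomial = polynomial_in (range (\<lambda>i x. x $ i))"

definition mat_polynomial :: "(complex ^ 'n ^ 'n \<Rightarrow> complex) \<Rightarrow> bool" where
  "mat_polynomial = polynomial_in (range (\<lambda>(i, j) A. A $ i $ j))"

definition zariski_closed :: "(complex ^ 'n) set \<Rightarrow> bool" where
  "zariski_closed Y \<longleftrightarrow> (\<exists>F. (\<forall>f\<in>F. vec_polynomial f) \<and> Y = {x. \<forall>f\<in>F. f x = 0})"

definition zariski_closure :: "(complex ^ 'n) set \<Rightarrow> (complex ^ 'n) set" where
  "zariski_closure S = \<Inter>{Y. zariski_closed Y \<and> S \<subseteq> Y}"

definition irreducible_variety :: "(complex ^ 'n) set \<Rightarrow> bool" where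
  "irreducible_variety Y \<longleftrightarrow> zariski_closed Y \<and> Y \<noteq> {} \<and>
     (\<forall>A B. zariski_closed A \<and> zariski_closed B \<and> Y = A \<union> B \<longrightarrow> Y = A \<or> Y = B)"

text \<open>
  The dimension is the Krull dimension of the Zariski topology: the supremum of the lengths \<open>m\<close>
  of chains \<open>Z 0 \<subset> \<dots> \<subset> Z m\<close> of irreducible closed subsets. It is \<^typ>\<open>enat\<close>-valued so that the
  supremum is meaningful without first knowing that it is finite.
\<close>

definition variety_dim :: "(complex ^ 'n) set \<Rightarrow> enat" where
  "variety_dim Y = Sup {enat m | m. \<exists>Z. (\<forall>i\<le>m. irreducible_variety (Z i) \<and> Z i \<subseteq> Y) \<and>
                                        (\<forall>i<m. Z i \<subset> Z (Suc i))}"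

definition invariant_under_rescaling :: "(complex ^ 'n) set \<Rightarrow> bool" where
  "invariant_under_rescaling X \<longleftrightarrow> (\<forall>q\<in>X. \<forall>c. c *s q \<in> X)"

definition secant_variety :: "nat \<Rightarrow> (complex ^ 'n) set \<Rightarrow> (complex ^ 'n) set" where
  "secant_variety r X = zariski_closure {\<Sum>i<r. q i | q. \<forall>i<r. q i \<in> X}"

definition secant_has_expected_dim :: "nat \<Rightarrow> (complex ^ 'n) set \<Rightarrow> bool" where
  "secant_has_expected_dim r X \<longleftrightarrow>
     variety_dim (secant_variety r X) = of_nat r * variety_dim X"

definition linear_stabilizer :: "(complex ^ 'n) set \<Rightarrow> (complex ^ 'n ^ 'n) set" where
  "linear_stabilizer Y = {g. invertible g \<and> (\<lambda>x. g *v x) ` Y = Y}"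

text \<open>
  The Lie algebra of a Zariski closed subgroup \<open>G\<close> of \<open>GL\<^sub>n\<close> is its Zariski tangent space at the
  identity, as a subset of \<open>gl\<^sub>n\<close>: the matrices \<open>A\<close> along which the differential at the identity of
  every polynomial vanishing on \<open>G\<close> is zero. Allowing powers of the inverse determinant in the
  regular functions on \<open>GL\<^sub>n\<close> gives the same tangent space.
\<close>

definition lie_algebra_of :: "(complex ^ 'n ^ 'n) set \<Rightarrow> (complex ^ 'n ^ 'n) set" where
  "lie_algebra_of G = {A. \<forall>f. mat_polynomial f \<and> (\<forall>g\<in>G. f g = 0) \<longrightarrow>
     ((\<lambda>t. f (\<chi> i j. mat 1 $ i $ j + t * A $ i $ j)) has_field_derivative 0) (at 0)}"

definition stabilizer_lie_algebra :: "(complex ^ 'n) set \<Rightarrow> (complex ^ 'n ^ 'n) set" where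
  "stabilizer_lie_algebra Y = lie_algebra_of (linear_stabilizer Y)"

end

theory Submission
  imports Defs "HOL-Complex_Analysis.Conformal_Mappings" "HOL-Computational_Algebra.Polynomial"
begin

text \<open>
  Write \<open>T\<^sub>x X\<close> for the tangent space of \<open>X\<close> at \<open>x\<close>, the common kernel of the differentials at \<open>x\<close> of
  the polynomials that vanish on \<open>X\<close>. For closed \<open>Y\<close> the Lie algebra of the stabilizer consists of the
  matrices \<open>A\<close> with \<open>A y \<in> T\<^sub>y Y\<close> for all \<open>y \<in> Y\<close>: differentiating \<open>f (g y) = 0\<close> along the stabilizer
  gives one inclusion (\<open>stabilizer_lie_algebra_tangent\<close>), the one-parameter group of \<open>A\<close> the other
  (\<open>stabilizer_lie_algebraI\<close>). A linear map that preserves \<open>X\<close> preserves its secant varieties, so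
  only the inclusion of the Lie algebra of \<open>\<sigma>\<^sub>r(X)\<close> in that of \<open>X\<close> has content.

  Let \<open>A\<close> be in the Lie algebra of \<open>\<sigma>\<^sub>r(X)\<close>, and let \<open>q\<^sub>0, \<dots>, q\<^sub>r\<close> be a generic tuple of points of \<open>X\<close>,
  with tangent spaces \<open>T\<^sub>0, \<dots>, T\<^sub>r\<close>. By Terracini's lemma (\<open>terracini\<close>) the tangent space of \<open>\<sigma>\<^sub>r(X)\<close> at
  the sum of \<open>r\<close> of these points is the sum of the corresponding \<open>T\<^sub>i\<close>, so \<open>A\<close> maps the sum of the
  points into the sum of their tangent spaces. As \<open>X\<close> is a cone, \<open>2 q\<^sub>0\<close> has the same tangent space as
  \<open>q\<^sub>0\<close>; comparing the statements for \<open>q\<^sub>0\<close> and for \<open>2 q\<^sub>0\<close> puts \<open>A q\<^sub>0\<close> itself into the sum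
  (\<open>terracini_first_image\<close>). This applies to each of the \<open>r\<close> subfamilies that contain \<open>q\<^sub>0\<close> and omit one
  \<open>q\<^sub>j\<close>. The expected dimension of \<open>\<sigma>\<^sub>r\<^sub>+\<^sub>1(X)\<close> says that \<open>T\<^sub>0 + \<dots> + T\<^sub>r\<close> is direct
  (\<open>generic_tuple_direct_sum\<close>), hence all components of \<open>A q\<^sub>0\<close> outside \<open>T\<^sub>0\<close> vanish and \<open>A q\<^sub>0 \<in> T\<^sub>0\<close>. This
  is a closed condition on \<open>q\<^sub>0\<close>, so it holds on all of \<open>X\<close>.

  Terracini's lemma and the directness of the sum compare Krull dimensions with tangent spaces. The
  comparison rests on one structure theorem, \<open>generic_local_section\<close>: if \<open>S\<close> is a maximal set of
  coordinates that are algebraically independent on an irreducible set \<open>V\<close>, then at a generic point of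
  \<open>V\<close> a tangent vector is determined by its coordinates in \<open>S\<close>, and the projection to these coordinates
  has a local holomorphic section with values in the closure of \<open>V\<close>. The remaining coordinates are
  adjoined one at a time. Each is a root of a polynomial of minimal degree over the previous ones, a
  simple root because the characteristic is zero, so it extends holomorphically; pseudo-division by the
  minimal polynomial shows that the extended section satisfies all other relations as well. The
  section has three uses. Its derivatives are tangent vectors with arbitrary coordinates in \<open>S\<close>
  (\<open>tangent_vector_prescribed\<close>). The closures of its coordinate slices form a chain of irreducible sets
  of length \<open>card S\<close>, so the Krull dimension is at least \<open>card S\<close> (\<open>alg_dim_le_variety_dim\<close>). Finally, a count
  of tangent vectors on a graph shows that a set of independent coordinates on a proper closed
  subset can be enlarged on \<open>V\<close> (\<open>alg_independent_on_proper_subset\<close>), which bounds the Krull dimension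
  from above.
\<close>

section \<open>Polynomial functions and generic points\<close>

abbreviation coords :: "'i set \<Rightarrow> (('i \<Rightarrow> complex) \<Rightarrow> complex) set" where
  "coords I \<equiv> (\<lambda>i x. x i) ` I"

lemma polynomial_in_subst:
  assumes "polynomial_in C f" "\<And>c. c \<in> C \<Longrightarrow> polynomial_in C' (\<lambda>x. c (\<phi> x))"
  shows "polynomial_in C' (\<lambda>x. f (\<phi> x))"
  using assms(1) by (induction) (auto intro: polynomial_in.intros assms(2))

lemma polynomial_in_mono: "polynomial_in C f \<Longrightarrow> C \<subseteq> C' \<Longrightarrow> polynomial_in C' f"
  using polynomial_in_subst[of C f C' "\<lambda>x. x"] by (auto intro: polynomial_in.coord)

lemma polynomial_in_coords_mono:
  "polynomial_in (coords K) f \<Longrightarrow> K \<subseteq> L \<Longrightarrow> polynomial_in (coords L) f"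
  by (erule polynomial_in_mono) auto

lemma polynomial_in_uminus: "polynomial_in C f \<Longrightarrow> polynomial_in C (\<lambda>x. - f x)"
  using polynomial_in.mult[OF polynomial_in.const[of C "-1"]] by fastforce

lemma polynomial_in_diff:
  "polynomial_in C f \<Longrightarrow> polynomial_in C g \<Longrightarrow> polynomial_in C (\<lambda>x. f x - g x)"
  using polynomial_in.add[OF _ polynomial_in_uminus] by fastforce

lemma polynomial_in_sum:
  assumes "\<And>a. a \<in> A \<Longrightarrow> polynomial_in C (f a)"
  shows "polynomial_in C (\<lambda>x. \<Sum>a\<in>A. f a x)"
  using assms by (induction A rule: infinite_finite_induct) (auto intro: polynomial_in.intros)

lemma polynomial_in_prod:
  assumes "\<And>a. a \<in> A \<Longrightarrow> polynomial_in C (f a)"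
  shows "polynomial_in C (\<lambda>x. \<Prod>a\<in>A. f a x)"
  using assms by (induction A rule: infinite_finite_induct) (auto intro: polynomial_in.intros)

lemma polynomial_in_power: "polynomial_in C f \<Longrightarrow> polynomial_in C (\<lambda>x. f x ^ k)"
  by (induction k) (auto intro: polynomial_in.intros)

lemmas polynomial_in_intros = polynomial_in.const polynomial_in.add polynomial_in.mult
  polynomial_in_uminus polynomial_in_diff polynomial_in_sum polynomial_in_prod polynomial_in_power

lemma polynomial_in_coords_coord: "i \<in> K \<Longrightarrow> polynomial_in (coords K) (\<lambda>x. x i)"
  by (rule polynomial_in.coord) auto

lemma polynomial_in_cong:
  assumes "polynomial_in C f" "\<And>c. c \<in> C \<Longrightarrow> c x = c y"
  shows "f x = f y"
  using assms(1) by (induction) (auto simp: assms(2))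

lemma polynomial_in_coords_cong:
  assumes "polynomial_in (coords K) f" "\<And>i. i \<in> K \<Longrightarrow> x i = y i"
  shows "f x = f y"
  by (rule polynomial_in_cong[OF assms(1)]) (auto simp: assms(2))

lemma polynomial_in_tendsto:
  assumes "polynomial_in C f" "\<And>c. c \<in> C \<Longrightarrow> ((\<lambda>s. c (y s)) \<longlongrightarrow> c v) F"
  shows "((\<lambda>s. f (y s)) \<longlongrightarrow> f v) F"
  using assms(1) by (induction) (auto intro: tendsto_intros assms(2))

text \<open>
  This form of the chain rule is what the definition of tangent vectors calls for: they are tested on
  straight lines but arise as velocities of other curves, with the same coordinates to first order.
\<close>

lemma polynomial_in_same_jet:
  assumes "polynomial_in C f" "\<And>c. c \<in> C \<Longrightarrow> c (y t0) = c (z t1)"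
    and "\<And>c. c \<in> C \<Longrightarrow> \<exists>D. ((\<lambda>t. c (y t)) has_field_derivative D) (at t0) \<and>
                          ((\<lambda>t. c (z t)) has_field_derivative D) (at t1)"
  shows "\<exists>D. ((\<lambda>t. f (y t)) has_field_derivative D) (at t0) \<and>
             ((\<lambda>t. f (z t)) has_field_derivative D) (at t1)"
  using assms(1)
proof (induction)
  case (const c) then show ?case by (auto intro!: exI[of _ 0])
next
  case (coord f) then show ?case using assms(3) by blast
next
  case (add f g)
  then obtain D1 D2 where
    "((\<lambda>t. f (y t)) has_field_derivative D1) (at t0)" "((\<lambda>t. f (z t)) has_field_derivative D1) (at t1)"
    "((\<lambda>t. g (y t)) has_field_derivative D2) (at t0)" "((\<lambda>t. g (z t)) has_field_derivative D2) (at t1)"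
    by blast
  then show ?case
    by (intro exI[of _ "D1 + D2"] conjI DERIV_add)
next
  case (mult f g)
  then obtain D1 D2 where
    "((\<lambda>t. f (y t)) has_field_derivative D1) (at t0)" "((\<lambda>t. f (z t)) has_field_derivative D1) (at t1)"
    "((\<lambda>t. g (y t)) has_field_derivative D2) (at t0)" "((\<lambda>t. g (z t)) has_field_derivative D2) (at t1)"
    by blast
  moreover have "f (y t0) = f (z t1)" "g (y t0) = g (z t1)"
    by (rule polynomial_in_cong[OF mult.hyps(1) assms(2)] polynomial_in_cong[OF mult.hyps(2) assms(2)]; assumption)+
  ultimately show ?case using DERIV_mult[of "\<lambda>t. f (y t)" D1 t0 UNIV "\<lambda>t. g (y t)" D2]
     DERIV_mult[of "\<lambda>t. f (z t)" D1 t1 UNIV "\<lambda>t. g (z t)" D2] by auto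
qed

text \<open>
  Irreducibility in terms of functions: the polynomials that vanish on \<open>V\<close> form a prime ideal. In
  this form the notion applies equally to sets of tuples, graphs and images of parametrizations. A property is generic on \<open>V\<close> if it holds wherever some polynomial that is
  not identically zero on \<open>V\<close> does not vanish.
\<close>

definition irreducible_on :: "('a \<Rightarrow> complex) set \<Rightarrow> 'a set \<Rightarrow> bool" where
  "irreducible_on C V \<longleftrightarrow> V \<noteq> {} \<and>
     (\<forall>f g. polynomial_in C f \<longrightarrow> polynomial_in C g \<longrightarrow> (\<forall>v\<in>V. f v * g v = 0) \<longrightarrow>
        (\<forall>v\<in>V. f v = 0) \<or> (\<forall>v\<in>V. g v = 0))"

lemma irreducible_onD:
  assumes "irreducible_on C V" "polynomial_in C f" "polynomial_in C g" "\<And>v. v \<in> V \<Longrightarrow> f v * g v = 0"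
    "v \<in> V" "f v \<noteq> 0" "w \<in> V"
  shows "g w = 0"
  using assms unfolding irreducible_on_def by blast

lemma irreducible_on_both_nonzero:
  assumes "irreducible_on C V" "polynomial_in C f" "polynomial_in C g"
    "\<exists>v\<in>V. f v \<noteq> 0" "\<exists>v\<in>V. g v \<noteq> 0"
  shows "\<exists>v\<in>V. f v \<noteq> 0 \<and> g v \<noteq> 0"
  using assms irreducible_onD[OF assms(1-3)] by (metis mult_eq_0_iff)

lemma irreducible_on_all_nonzero:
  assumes "irreducible_on C V" "finite A"
    "\<And>a. a \<in> A \<Longrightarrow> polynomial_in C (f a)" "\<And>a. a \<in> A \<Longrightarrow> \<exists>v\<in>V. f a v \<noteq> 0"
  shows "\<exists>v\<in>V. \<forall>a\<in>A. f a v \<noteq> 0"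
proof -
  have "\<exists>v\<in>V. (\<Prod>a\<in>A. f a v) \<noteq> 0"
    using assms(2-4)
  proof (induction A rule: finite_induct)
    case empty
    then show ?case using assms(1) by (auto simp: irreducible_on_def)
  next
    case (insert a A)
    then have "\<exists>v\<in>V. (\<Prod>a\<in>A. f a v) \<noteq> 0" "\<exists>v\<in>V. f a v \<noteq> 0" by auto
    moreover have "polynomial_in C (\<lambda>v. \<Prod>a\<in>A. f a v)" "polynomial_in C (f a)"
      using insert by (auto intro: polynomial_in_prod)
    ultimately have "\<exists>v\<in>V. f a v * (\<Prod>a\<in>A. f a v) \<noteq> 0"
      using assms(1) unfolding irreducible_on_def by blast
    then show ?case using insert by simp
  qed
  then show ?thesis using assms(2) by auto
qed

lemma irreducible_on_image:
  assumes "irreducible_on C V" "\<And>c. c \<in> C' \<Longrightarrow> polynomial_in C (\<lambda>x. c (\<phi> x))"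
  shows "irreducible_on C' (\<phi> ` V)"
proof -
  have *: "polynomial_in C (\<lambda>x. f (\<phi> x))" if "polynomial_in C' f" for f
    using polynomial_in_subst[OF that assms(2)] .
  show ?thesis
    unfolding irreducible_on_def
  proof (intro conjI allI impI)
    show "\<phi> ` V \<noteq> {}" using assms(1) by (auto simp: irreducible_on_def)
    fix f g assume fg: "polynomial_in C' f" "polynomial_in C' g" "\<forall>v\<in>\<phi> ` V. f v * g v = 0"
    have "(\<forall>v\<in>V. f (\<phi> v) = 0) \<or> (\<forall>v\<in>V. g (\<phi> v) = 0)"
      using irreducible_onD[OF assms(1) *[OF fg(1)] *[OF fg(2)]] fg(3) by blast
    then show "(\<forall>v\<in>\<phi> ` V. f v = 0) \<or> (\<forall>v\<in>\<phi> ` V. g v = 0)" by blast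
  qed
qed

section \<open>Polynomials in one distinguished coordinate\<close>

text \<open>
  A polynomial in one variable of degree at most \<open>d\<close> whose coefficients are polynomial functions of the
  coordinates in \<open>K\<close>. The degree may drop below \<open>d\<close> at some points, so the role of the leading coefficient is
  played by the coefficient of index \<open>d\<close>.
\<close>

definition poly_family :: "'i set \<Rightarrow> nat \<Rightarrow> (('i \<Rightarrow> complex) \<Rightarrow> complex poly) \<Rightarrow> bool" where
  "poly_family K d p \<longleftrightarrow> (\<forall>l. polynomial_in (coords K) (\<lambda>x. coeff (p x) l)) \<and> (\<forall>x. degree (p x) \<le> d)"

lemma poly_family_mult:
  "poly_family K d p \<Longrightarrow> poly_family K e q \<Longrightarrow> poly_family K (d + e) (\<lambda>x. p x * q x)"
  unfolding poly_family_def coeff_mult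
  by (auto intro!: polynomial_in_intros order_trans[OF degree_mult_le] add_mono)

lemma poly_family_add:
  "poly_family K d p \<Longrightarrow> poly_family K e q \<Longrightarrow> poly_family K (max d e) (\<lambda>x. p x + q x)"
  unfolding poly_family_def coeff_add
  by (auto intro!: polynomial_in_intros order_trans[OF degree_add_le_max] max.mono)

lemma polynomial_in_insert_coords:
  assumes "polynomial_in (coords (insert k K)) f"
  shows "\<exists>d p. poly_family K d p \<and> (\<forall>x. f x = poly (p x) (x k))"
  using assms
proof (induction)
  case (const c)
  show ?case
    by (rule exI[of _ 0], rule exI[of _ "\<lambda>x. [:c:]"])
       (auto simp: poly_family_def coeff_pCons split: nat.split intro: polynomial_in.const)
next
  case (coord f)
  then consider "f = (\<lambda>x. x k)" | i where "i \<in> K" "f = (\<lambda>x. x i)" by auto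
  then show ?case
  proof cases
    case 1
    show ?thesis
      by (rule exI[of _ 1], rule exI[of _ "\<lambda>x. [:0, 1:]"])
         (auto simp: 1 poly_family_def coeff_pCons split: nat.split intro: polynomial_in.const)
  next
    case 2
    have "polynomial_in (coords K) (\<lambda>x. coeff [:x i:] l)" for l
      using polynomial_in_coords_coord[OF 2(1)]
      by (cases l) (auto simp: coeff_pCons intro: polynomial_in.const)
    then show ?thesis
      by (intro exI[of _ 0] exI[of _ "\<lambda>x. [:x i:]"]) (auto simp: 2 poly_family_def)
  qed
next
  case (add f g)
  then obtain d p e q where "poly_family K d p" "\<forall>x. f x = poly (p x) (x k)"
    "poly_family K e q" "\<forall>x. g x = poly (q x) (x k)" by blast
  then show ?case using poly_family_add[of K d p e q]
    by (intro exI[of _ "max d e"] exI[of _ "\<lambda>x. p x + q x"]) auto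
next
  case (mult f g)
  then obtain d p e q where "poly_family K d p" "\<forall>x. f x = poly (p x) (x k)"
    "poly_family K e q" "\<forall>x. g x = poly (q x) (x k)" by blast
  then show ?case using poly_family_mult[of K d p e q]
    by (intro exI[of _ "d + e"] exI[of _ "\<lambda>x. p x * q x"]) auto
qed

lemma poly_sum_atMost:
  fixes q :: "complex poly"
  assumes "degree q \<le> d"
  shows "poly q u = (\<Sum>l\<le>d. coeff q l * u ^ l)"
proof -
  have "poly q u = poly (\<Sum>l\<le>d. monom (coeff q l) l) u"
    using poly_as_sum_of_monoms'[OF assms] by simp
  then show ?thesis by (simp add: poly_sum poly_monom)
qed

lemma poly_family_eval:
  assumes "poly_family K d p"
  shows "polynomial_in (coords (insert k K)) (\<lambda>x. poly (p x) (x k))"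
proof -
  have "poly (p x) (x k) = (\<Sum>l\<le>d. coeff (p x) l * x k ^ l)" for x
    using assms unfolding poly_family_def by (intro poly_sum_atMost) auto
  moreover have "polynomial_in (coords (insert k K)) (\<lambda>x. coeff (p x) l)" for l
    using assms unfolding poly_family_def by (blast intro: polynomial_in_coords_mono)
  then have "polynomial_in (coords (insert k K)) (\<lambda>x. \<Sum>l\<le>d. coeff (p x) l * x k ^ l)"
    by (intro polynomial_in_intros polynomial_in_coords_coord) auto
  ultimately show ?thesis by simp
qed

lemma poly_family_cong:
  assumes "poly_family K d p" "\<And>i. i \<in> K \<Longrightarrow> x i = y i"
  shows "p x = p y"
  using assms polynomial_in_coords_cong[of K "\<lambda>x. coeff (p x) _" x y]
  unfolding poly_family_def by (intro poly_eqI) auto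

text \<open>
  Multiplying by powers of the leading coefficient avoids division, so that quotient and remainder
  again have polynomial coefficients.
\<close>

lemma poly_family_pseudo_division:
  assumes p: "poly_family K d p" and d: "d > 0"
  assumes "poly_family K e f"
  shows "\<exists>N q r. poly_family K (d - 1) r \<and> 
     (\<forall>x. smult (coeff (p x) d ^ N) (f x) = p x * q x + r x)"
  using assms(3)
proof (induction e arbitrary: f)
  case 0
  then show ?case
    by (intro exI[of _ 0] exI[of _ "\<lambda>x. 0"] exI[of _ f]) (auto simp: poly_family_def)
next
  case (Suc e)
  show ?case
  proof (cases "Suc e < d")
    case True
    then have "Suc e \<le> d - 1" by simp
    then have "poly_family K (d - 1) f" using Suc.prems unfolding poly_family_def
      by (blast intro: order_trans)
    then show ?thesis
      by (intro exI[of _ 0] exI[of _ "\<lambda>x. 0"] exI[of _ f]) auto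
  next
    case False
    define m where "m = (\<lambda>x. monom (coeff (f x) (Suc e)) (Suc e - d))"
    define g where "g = (\<lambda>x. smult (coeff (p x) d) (f x) - p x * m x)"
    have m: "poly_family K (Suc e - d) m"
      unfolding poly_family_def
    proof (intro conjI allI)
      show "polynomial_in (coords K) (\<lambda>x. coeff (m x) l)" for l
        using Suc.prems unfolding m_def poly_family_def
        by (cases "l = Suc e - d") (auto intro: polynomial_in.const)
    qed (simp add: m_def degree_monom_le)
    have pm: "poly_family K (Suc e) (\<lambda>x. p x * m x)"
      using poly_family_mult[OF p m] False by simp
    have "coeff (g x) l = 0" if "l > e" for x l
    proof (cases "l = Suc e")
      case True
      have "coeff (p x * m x) (d + (Suc e - d)) = coeff (p x) d * coeff (m x) (Suc e - d)"
        by (simp add: m_def mult.commute[of "p x"] coeff_monom_mult)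
      then show ?thesis using False by (simp add: g_def True m_def)
    next
      case F: False
      moreover have "degree (f x) \<le> Suc e" "degree (p x * m x) \<le> Suc e"
        using Suc.prems pm unfolding poly_family_def by auto
      ultimately have "l > degree (f x)" "l > degree (p x * m x)" using that by linarith+
      then show ?thesis by (simp add: g_def coeff_eq_0)
    qed
    then have "degree (g x) \<le> e" for x by (auto intro: degree_le)
    moreover have "polynomial_in (coords K) (\<lambda>x. coeff (g x) l)" for l
      using Suc.prems p pm unfolding g_def poly_family_def by (auto intro!: polynomial_in_intros)
    ultimately have "poly_family K e g" by (simp add: poly_family_def)
    from Suc.IH[OF this] obtain N q r where r: "poly_family K (d - 1) r"
      and eq: "\<And>x. smult (coeff (p x) d ^ N) (g x) = p x * q x + r x" by blast
    have "smult (coeff (p x) d ^ Suc N) (f x) = p x * (q x + smult (coeff (p x) d ^ N) (m x)) + r x" for x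
      using eq[of x] by (simp add: g_def smult_diff_right algebra_simps)
    then show ?thesis
      using r by (intro exI[of _ "Suc N"] exI[of _ "\<lambda>x. q x + smult (coeff (p x) d ^ N) (m x)"] exI[of _ r]) blast
  qed
qed

section \<open>Algebraic independence, tangent vectors and local sections\<close>

definition alg_independent_on :: "'i set \<Rightarrow> ('i \<Rightarrow> complex) set \<Rightarrow> bool" where
  "alg_independent_on S V \<longleftrightarrow>
     (\<forall>f. polynomial_in (coords S) f \<longrightarrow> (\<forall>v\<in>V. f v = 0) \<longrightarrow> (\<forall>x. f x = 0))"

definition tangent_vector :: 
    "'i set \<Rightarrow> ('i \<Rightarrow> complex) set \<Rightarrow> ('i \<Rightarrow> complex) \<Rightarrow> ('i \<Rightarrow> complex) \<Rightarrow> bool" where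
  "tangent_vector K V v w \<longleftrightarrow>
     (\<forall>f. polynomial_in (coords K) f \<longrightarrow> (\<forall>x\<in>V. f x = 0) \<longrightarrow>
        ((\<lambda>t. f (\<lambda>i. v i + t * w i)) has_field_derivative 0) (at 0))"

definition polydisc :: "'i set \<Rightarrow> ('i \<Rightarrow> complex) \<Rightarrow> real \<Rightarrow> ('i \<Rightarrow> complex) set" where
  "polydisc S v \<delta> = {s. \<forall>i\<in>S. dist (s i) (v i) < \<delta>}"

text \<open>
  The filter generated by the polydiscs in the coordinates of \<open>S\<close>; the other coordinates are unconstrained,
  as they are not parameters of a local section.
\<close>

definition germ_at :: "'i set \<Rightarrow> ('i \<Rightarrow> complex) \<Rightarrow> ('i \<Rightarrow> complex) filter" where
  "germ_at S v = (INF \<delta>\<in>{0<..}. principal (polydisc S v \<delta>))"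

lemma polydisc_mono: "\<delta> \<le> \<epsilon> \<Longrightarrow> polydisc S v \<delta> \<subseteq> polydisc S v \<epsilon>"
  unfolding polydisc_def by fastforce

lemma eventually_germ_at:
  "eventually P (germ_at S v) \<longleftrightarrow> (\<exists>\<delta>>0. \<forall>s\<in>polydisc S v \<delta>. P s)"
  unfolding germ_at_def
proof (subst eventually_INF_base)
  fix a b :: real assume ab: "a \<in> {0<..}" "b \<in> {0<..}"
  show "\<exists>x\<in>{0<..}. principal (polydisc S v x) \<le> inf (principal (polydisc S v a)) (principal (polydisc S v b))"
    using ab polydisc_mono[of "min a b" a S v] polydisc_mono[of "min a b" b S v]
    by (intro bexI[of _ "min a b"]) auto
qed (auto simp: eventually_principal)

text \<open>
  A section over a polydisc of the projection to the coordinates in \<open>S\<close>, through \<open>v\<close>, whose values satisfy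
  every relation in the coordinates \<open>K\<close> that holds on \<open>V\<close>. Holomorphy is only required along complex
  lines: this suffices for the identity theorem on a polydisc, and for derivatives, and it needs
  calculus in one variable only. Joint continuity is kept at the centre alone, where the implicit
  function theorem uses it.
\<close>

definition local_section :: "'i set \<Rightarrow> 'i set \<Rightarrow> ('i \<Rightarrow> complex) set \<Rightarrow> ('i \<Rightarrow> complex) \<Rightarrow> real \<Rightarrow>
    (('i \<Rightarrow> complex) \<Rightarrow> 'i \<Rightarrow> complex) \<Rightarrow> bool" where
  "local_section S K V v \<epsilon> \<phi> \<longleftrightarrow> \<epsilon> > 0 \<and>
     (\<forall>s\<in>polydisc S v \<epsilon>. (\<forall>i\<in>S. \<phi> s i = s i) \<and>
        (\<forall>f. polynomial_in (coords K) f \<longrightarrow> (\<forall>x\<in>V. f x = 0) \<longrightarrow> f (\<phi> s) = 0)) \<and>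
     (\<forall>i\<in>K. \<phi> v i = v i \<and> ((\<lambda>s. \<phi> s i) \<longlongrightarrow> v i) (germ_at S v)) \<and>
     (\<forall>s e t. (\<lambda>i. s i + t * e i) \<in> polydisc S v \<epsilon> \<longrightarrow>
        (\<forall>i\<in>K. (\<lambda>t. \<phi> (\<lambda>j. s j + t * e j) i) field_differentiable at t))"

lemma polynomial_in_field_differentiable:
  assumes "polynomial_in C f" "\<And>c. c \<in> C \<Longrightarrow> (\<lambda>t. c (y t)) field_differentiable at t"
  shows "(\<lambda>t. f (y t)) field_differentiable at t"
  using polynomial_in_same_jet[OF assms(1), of y t y t] assms(2)
  unfolding field_differentiable_def by blast

text \<open>
  A polynomial of minimal degree among the nontrivial relations satisfied by the coordinate \<open>k\<close> on \<open>V\<close> plays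
  the role of the minimal polynomial over the function field. Minimality forces its leading coefficient
  not to vanish identically on \<open>V\<close>.
\<close>

lemma minimal_relation:
  assumes "V \<noteq> {}" "poly_family K e q" "\<And>v. v \<in> V \<Longrightarrow> poly (q v) (v k) = 0"
    "v0 \<in> V" "coeff (q v0) l0 \<noteq> 0"
  shows "\<exists>d p. d > 0 \<and> poly_family K d p \<and> (\<forall>v\<in>V. poly (p v) (v k) = 0) \<and>
    (\<exists>v\<in>V. coeff (p v) d \<noteq> 0) \<and>
    (\<forall>r. poly_family K (d - 1) r \<longrightarrow> (\<forall>v\<in>V. poly (r v) (v k) = 0) \<longrightarrow> (\<forall>v\<in>V. r v = 0))"
proof -
  define Q where "Q = (\<lambda>d. \<exists>p. poly_family K d p \<and> (\<forall>v\<in>V. poly (p v) (v k) = 0) \<and> (\<exists>v\<in>V. p v \<noteq> 0))"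
  have "q v0 \<noteq> 0" using assms(5) by auto
  then have "Q e" unfolding Q_def using assms by blast
  define d where "d = (LEAST d. Q d)"
  have "Q d" unfolding d_def by (rule LeastI, fact)
  then obtain p v1 where p: "poly_family K d p" "\<And>v. v \<in> V \<Longrightarrow> poly (p v) (v k) = 0" "v1 \<in> V" "p v1 \<noteq> 0"
    unfolding Q_def by blast
  have min: "\<not> Q j" if "j < d" for j using that not_less_Least unfolding d_def by blast
  have "d > 0"
  proof (rule ccontr)
    assume "\<not> d > 0"
    then have "degree (p v1) = 0" using p(1) unfolding poly_family_def by auto
    then obtain c where "p v1 = [:c:]" by (rule degree_eq_zeroE)
    then show False using p(2)[OF p(3)] p(4) by simp
  qed
  then have min': "\<forall>r. poly_family K (d - 1) r \<longrightarrow> (\<forall>v\<in>V. poly (r v) (v k) = 0) \<longrightarrow> (\<forall>v\<in>V. r v = 0)"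
    using min[of "d - 1"] unfolding Q_def by auto
  have "\<exists>v\<in>V. coeff (p v) d \<noteq> 0"
  proof (rule ccontr)
    assume "\<not> ?thesis"
    then have top: "\<And>v. v \<in> V \<Longrightarrow> coeff (p v) d = 0" by auto
    \<comment> \<open>dropping a leading coefficient that vanishes on \<open>V\<close> gives a relation of smaller degree\<close>
    define r where "r = (\<lambda>x. p x - monom (coeff (p x) d) d)"
    have "coeff (r x) l = 0" if "l > d - 1" for x l
    proof (cases "l = d")
      case False
      have "degree (p x) \<le> d" using p(1) unfolding poly_family_def by blast
      then have "degree (p x) < l" using that False by linarith
      then show ?thesis using False by (simp add: r_def coeff_eq_0)
    qed (simp add: r_def)
    then have "degree (r x) \<le> d - 1" for x by (auto intro: degree_le)
    moreover have "polynomial_in (coords K) (\<lambda>x. coeff (r x) l)" for l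
      using p(1) unfolding r_def poly_family_def
      by (cases "l = d") (auto intro: polynomial_in.const)
    ultimately have "poly_family K (d - 1) r" by (simp add: poly_family_def)
    moreover have r: "r v = p v" if "v \<in> V" for v using top[OF that] by (simp add: r_def)
    ultimately show False using min' p(2-4) by force
  qed
  then show ?thesis using \<open>d > 0\<close> p min' by blast
qed

section \<open>Roots depending on parameters\<close>

text \<open>
  The polynomial \<open>(q u - q w) / (u - w)\<close> in \<open>u\<close> and \<open>w\<close>, where \<open>q\<close> is truncated at degree \<open>d\<close>.
\<close>

definition diff_quotient :: "nat \<Rightarrow> complex poly \<Rightarrow> complex \<Rightarrow> complex \<Rightarrow> complex" where
  "diff_quotient d q u w = (\<Sum>l\<le>d. coeff q l * (\<Sum>i<l. w ^ (l - Suc i) * u ^ i))"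

lemma diff_quotient_eq:
  assumes "degree q \<le> d"
  shows "poly q u - poly q w = (u - w) * diff_quotient d q u w"
  unfolding poly_sum_atMost[OF assms] diff_quotient_def sum_subtractf[symmetric] sum_distrib_left
  by (intro sum.cong refl) (simp add: right_diff_distrib[symmetric] power_diff_sumr2 mult_ac sum_distrib_left)

lemma diff_quotient_diagonal:
  assumes "degree q \<le> d"
  shows "diff_quotient d q u u = poly (pderiv q) u"
proof -
  have "isCont (\<lambda>z. diff_quotient d q z u) u"
    unfolding diff_quotient_def by (intro continuous_intros)
  then have "(poly q has_field_derivative diff_quotient d q u u) (at u)"
    unfolding CARAT_DERIV
    by (intro exI[of _ "\<lambda>z. diff_quotient d q z u"]) (simp add: diff_quotient_eq[OF assms])
  then show ?thesis using poly_DERIV DERIV_unique by blast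
qed

lemma tendsto_diff_quotient:
  assumes "\<And>l. ((\<lambda>s. coeff (q s) l) \<longlongrightarrow> coeff q0 l) F" "(u \<longlongrightarrow> u0) F" "(w \<longlongrightarrow> w0) F"
  shows "((\<lambda>s. diff_quotient d (q s) (u s) (w s)) \<longlongrightarrow> diff_quotient d q0 u0 w0) F"
  unfolding diff_quotient_def by (intro tendsto_intros assms)

text \<open>
  Newton's iteration with fixed slope \<open>D\<close> contracts by one half as long as all difference quotients are within
  \<open>|D| / 2\<close> of \<open>D\<close>. The radius \<open>r\<close> may be chosen proportional to \<open>|f u0|\<close>, which later gives continuity of the
  root.
\<close>

lemma contraction_root:
  fixes f :: "complex \<Rightarrow> complex"
  assumes "D \<noteq> 0" "0 \<le> r" "r \<le> \<rho>"
    "\<And>u w. u \<in> cball u0 \<rho> \<Longrightarrow> w \<in> cball u0 \<rho> \<Longrightarrow> f u - f w = (u - w) * q u w"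
    "\<And>u w. u \<in> cball u0 \<rho> \<Longrightarrow> w \<in> cball u0 \<rho> \<Longrightarrow> norm (q u w - D) \<le> norm D / 2"
    "norm (f u0) \<le> norm D * r / 2"
  shows "\<exists>u\<in>cball u0 r. f u = 0"
proof -
  define T where "T = (\<lambda>u. u - f u / D)"
  have lip: "dist (T u) (T w) \<le> 1 / 2 * dist u w" if "u \<in> cball u0 r" "w \<in> cball u0 r" for u w
  proof -
    have in': "u \<in> cball u0 \<rho>" "w \<in> cball u0 \<rho>" using that assms(3) by auto
    have "T u - T w = (u - w) - (f u - f w) / D" by (simp add: T_def diff_divide_distrib)
    also have "\<dots> = (u - w) * (- ((q u w - D) / D))"
      using assms(1) unfolding assms(4)[OF in'] by (simp add: field_simps)
    finally have "norm (T u - T w) = norm (u - w) * (norm (q u w - D) / norm D)"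
      by (simp add: norm_mult norm_divide)
    also have "\<dots> \<le> norm (u - w) * (1 / 2)"
      using assms(1) assms(5)[OF in'] by (intro mult_left_mono) (auto simp: field_simps)
    finally show ?thesis by (simp add: dist_norm)
  qed
  have "T u \<in> cball u0 r" if "u \<in> cball u0 r" for u
  proof -
    have "u0 \<in> cball u0 r" using assms by simp
    from lip[OF that this] have "dist (T u) (T u0) \<le> r / 2" using that by (simp add: dist_commute)
    moreover have "dist (T u0) u0 \<le> r / 2"
      using assms(1,6) by (simp add: T_def dist_norm norm_divide field_simps)
    ultimately show ?thesis using dist_triangle[of "T u" u0 "T u0"] by (simp add: dist_commute)
  qed
  then have "\<exists>!u\<in>cball u0 r. T u = u"
    using assms(2) lip
    by (intro Banach_fix[where c = "1/2"]) (simp_all add: complete_eq_closed image_subset_iff)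
  then obtain u where "u \<in> cball u0 r" "T u = u" by blast
  then show ?thesis using assms(1) by (intro bexI[of _ u]) (simp_all add: T_def)
qed

text \<open>
  Implicit differentiation: \<open>F t (U t) = 0\<close> gives \<open>(U t - U t0) q = - (F t (U t0) - F t0 (U t0))\<close> with a difference
  quotient \<open>q\<close> that is bounded away from zero. This yields continuity of \<open>U\<close>, and then convergence of the
  difference quotients of \<open>U\<close>.
\<close>

lemma implicit_root_differentiable:
  fixes F :: "complex \<Rightarrow> complex \<Rightarrow> complex"
  assumes root: "\<forall>\<^sub>F t in nhds t0. F t (U t) = 0"
    and q: "\<And>t u w. F t u - F t w = (u - w) * q t u w"
    and m: "m > 0" "\<forall>\<^sub>F t in nhds t0. m \<le> norm (q t (U t) (U t0))"
    and diff: "(\<lambda>t. F t (U t0)) field_differentiable at t0"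
    and cont: "(U \<longlongrightarrow> U t0) (at t0) \<Longrightarrow> ((\<lambda>t. q t (U t) (U t0)) \<longlongrightarrow> Q) (at t0)"
  shows "U field_differentiable at t0"
proof -
  obtain G where G: "((\<lambda>t. F t (U t0)) has_field_derivative G) (at t0)"
    using diff by (auto simp: field_differentiable_def)
  have r0: "F t0 (U t0) = 0" using root by (rule eventually_nhds_x_imp_x)
  have ev: "\<forall>\<^sub>F t in at t0. F t (U t) = 0 \<and> m \<le> norm (q t (U t) (U t0))"
    using root m(2) by (auto simp: eventually_at_filter intro: eventually_elim2)
  have eq: "U t - U t0 = - F t (U t0) / q t (U t) (U t0)"
    if "F t (U t) = 0 \<and> m \<le> norm (q t (U t) (U t0))" for t
  proof -
    have "q t (U t) (U t0) \<noteq> 0" using that m(1) by auto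
    moreover have "(U t - U t0) * q t (U t) (U t0) = - F t (U t0)"
      using that q[of t "U t" "U t0"] by simp
    ultimately show ?thesis by (metis nonzero_eq_divide_eq)
  qed
  have F0: "((\<lambda>t. F t (U t0)) \<longlongrightarrow> 0) (at t0)"
    using DERIV_isCont[OF G] r0 by (simp add: isCont_def)
  have "((\<lambda>t. norm (F t (U t0)) / m) \<longlongrightarrow> 0) (at t0)"
    using tendsto_divide[OF tendsto_norm[OF F0] tendsto_const[of m]] m(1) by simp
  then have "((\<lambda>t. U t - U t0) \<longlongrightarrow> 0) (at t0)"
  proof (rule Lim_null_comparison[rotated])
    show "\<forall>\<^sub>F t in at t0. norm (U t - U t0) \<le> norm (F t (U t0)) / m"
      using ev
    proof (eventually_elim)
      case (elim t)
      show ?case unfolding eq[OF elim] norm_divide norm_minus_cancel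
        using elim m(1)
        by (intro divide_left_mono mult_pos_pos order.strict_trans2[OF m(1)]) auto
    qed
  qed
  then have "(U \<longlongrightarrow> U t0) (at t0)" by (simp add: Lim_null[of U])
  note Q = cont[OF this]
  have "m \<le> norm Q"
    using ev by (intro tendsto_lowerbound[OF tendsto_norm[OF Q]]) (auto elim: eventually_mono)
  then have "Q \<noteq> 0" using m(1) by auto
  have "((\<lambda>t. - ((F t (U t0) - F t0 (U t0)) / (t - t0)) / q t (U t) (U t0)) \<longlongrightarrow> - G / Q) (at t0)"
    using G Q \<open>Q \<noteq> 0\<close> unfolding has_field_derivative_iff by (intro tendsto_intros) 
  moreover have "\<forall>\<^sub>F t in at t0. - ((F t (U t0) - F t0 (U t0)) / (t - t0)) / q t (U t) (U t0) = (U t - U t0) / (t - t0)"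
    using ev by eventually_elim (simp add: eq r0)
  ultimately have "(U has_field_derivative - G / Q) (at t0)"
    unfolding has_field_derivative_iff by (rule Lim_transform_eventually)
  then show ?thesis by (auto simp: field_differentiable_def)
qed

section \<open>Local sections at generic points\<close>

lemma tangent_vector_mono: "tangent_vector L V v w \<Longrightarrow> K \<subseteq> L \<Longrightarrow> tangent_vector K V v w"
  unfolding tangent_vector_def by (blast intro: polynomial_in_coords_mono)

text \<open>
  Differentiating the relation \<open>p\<close> of the coordinate \<open>k\<close> along a vector that moves no other coordinate
  leaves only the term \<open>p' (v k) w k\<close>.
\<close>

lemma tangent_vector_insert_zero:
  assumes k: "k \<notin> K" and p: "poly_family K d p" "\<And>x. x \<in> V \<Longrightarrow> poly (p x) (x k) = 0"
    and sep: "poly (pderiv (p v)) (v k) \<noteq> 0"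
    and w: "tangent_vector (insert k K) V v w" "\<And>i. i \<in> K \<Longrightarrow> w i = 0"
  shows "w k = 0"
proof -
  let ?y = "\<lambda>t i. v i + t * w i"
  have "((\<lambda>t. poly (p (?y t)) (?y t k)) has_field_derivative 0) (at 0)"
    using w(1) poly_family_eval[OF p(1), of k] p(2) unfolding tangent_vector_def by blast
  moreover have "p (?y t) = p v" for t
    by (rule poly_family_cong[OF p(1)]) (simp add: w(2))
  ultimately have "((\<lambda>t. poly (p v) (v k + t * w k)) has_field_derivative 0) (at 0)" by simp
  moreover have "((\<lambda>t. poly (p v) (v k + t * w k)) has_field_derivative
      poly (pderiv (p v)) (v k + 0 * w k) * w k) (at 0)"
    by (rule DERIV_chain2[OF poly_DERIV]) (auto intro!: derivative_eq_intros)
  ultimately have "poly (pderiv (p v)) (v k) * w k = 0" using DERIV_unique by fastforce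
  then show ?thesis using sep by simp
qed

lemma eventually_polydisc_line:
  assumes "finite S" "(\<lambda>i. s i + t0 * e i) \<in> polydisc S v \<epsilon>"
  shows "\<forall>\<^sub>F t in nhds t0. (\<lambda>i. s i + t * e i) \<in> polydisc S v \<epsilon>"
proof -
  have "\<forall>\<^sub>F t in nhds t0. dist (s i + t * e i) (v i) < \<epsilon>" if "i \<in> S" for i
  proof -
    have "((\<lambda>t. dist (s i + t * e i) (v i)) \<longlongrightarrow> dist (s i + t0 * e i) (v i)) (nhds t0)"
      by (intro tendsto_intros filterlim_ident)
    then show ?thesis by (rule order_tendstoD) (use assms that in \<open>auto simp: polydisc_def\<close>)
  qed
  then show ?thesis unfolding polydisc_def using assms(1) by (simp add: eventually_ball_finite_distrib)
qed

text \<open>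
  The implicit function theorem extends a local section by the coordinate \<open>k\<close>, at a point where \<open>v k\<close> is a
  simple root of the minimal polynomial \<open>p\<close> and the leading coefficient of \<open>p\<close> does not vanish. Any other
  relation \<open>f\<close> has, modulo \<open>p\<close>, a remainder of smaller degree; by minimality its coefficients vanish on \<open>V\<close>,
  hence along the given section, and so \<open>f\<close> vanishes along the extended one.
\<close>

lemma local_section_insert:
  assumes fin: "finite S" and k: "k \<notin> K" and SK: "S \<subseteq> K"
    and p: "d > 0" "poly_family K d p" "\<And>x. x \<in> V \<Longrightarrow> poly (p x) (x k) = 0"
    and min: "\<And>r. poly_family K (d - 1) r \<Longrightarrow> (\<And>x. x \<in> V \<Longrightarrow> poly (r x) (x k) = 0) \<Longrightarrow> (\<And>x. x \<in> V \<Longrightarrow> r x = 0)"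
    and v: "v \<in> V" "coeff (p v) d \<noteq> 0" "poly (pderiv (p v)) (v k) \<noteq> 0"
    and sec: "local_section S K V v \<epsilon> \<phi>"
  shows "\<exists>\<epsilon>' \<phi>'. local_section S (insert k K) V v \<epsilon>' \<phi>'"
proof -
  have \<epsilon>: "\<epsilon> > 0"
    and \<phi>S: "\<And>s i. s \<in> polydisc S v \<epsilon> \<Longrightarrow> i \<in> S \<Longrightarrow> \<phi> s i = s i"
    and \<phi>V: "\<And>s f. s \<in> polydisc S v \<epsilon> \<Longrightarrow> polynomial_in (coords K) f \<Longrightarrow> (\<And>x. x \<in> V \<Longrightarrow> f x = 0) \<Longrightarrow> f (\<phi> s) = 0"
    and \<phi>v: "\<And>i. i \<in> K \<Longrightarrow> \<phi> v i = v i"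
    and \<phi>lim: "\<And>i. i \<in> K \<Longrightarrow> ((\<lambda>s. \<phi> s i) \<longlongrightarrow> v i) (germ_at S v)"
    and \<phi>diff: "\<And>s e t i. (\<lambda>i. s i + t * e i) \<in> polydisc S v \<epsilon> \<Longrightarrow> i \<in> K \<Longrightarrow>
        (\<lambda>t. \<phi> (\<lambda>j. s j + t * e j) i) field_differentiable at t"
    using sec unfolding local_section_def by blast+
  define D where "D = diff_quotient d (p v) (v k) (v k)"
  have deg: "degree (p x) \<le> d" for x using p(2) unfolding poly_family_def by blast
  have D: "D \<noteq> 0" unfolding D_def diff_quotient_diagonal[OF deg] by (rule v(3))
  have cpoly: "polynomial_in (coords K) (\<lambda>x. coeff (p x) l)" for l
    using p(2) unfolding poly_family_def by blast
  have lim: "((\<lambda>s. coeff (p (\<phi> s)) l) \<longlongrightarrow> coeff (p v) l) (germ_at S v)" for l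
    by (rule polynomial_in_tendsto[OF cpoly]) (auto intro: \<phi>lim)
  \<comment> \<open>near \<open>v\<close>, all difference quotients of \<open>p\<close> close to the root \<open>v k\<close> are close to the derivative \<open>D\<close>\<close>
  have "((\<lambda>z. diff_quotient d (p (\<phi> (fst z))) (fst (snd z)) (snd (snd z))) \<longlongrightarrow> D)
      (germ_at S v \<times>\<^sub>F (nhds (v k) \<times>\<^sub>F nhds (v k)))"
    unfolding D_def
  proof (rule tendsto_diff_quotient)
    show "((\<lambda>z. coeff (p (\<phi> (fst z))) l) \<longlongrightarrow> coeff (p v) l) (germ_at S v \<times>\<^sub>F (nhds (v k) \<times>\<^sub>F nhds (v k)))" for l
      by (rule filterlim_compose[OF lim filterlim_fst])
    show "((\<lambda>z. fst (snd z)) \<longlongrightarrow> v k) (germ_at S v \<times>\<^sub>F (nhds (v k) \<times>\<^sub>F nhds (v k)))"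
      by (rule filterlim_compose[OF filterlim_fst filterlim_snd])
    show "((\<lambda>z. snd (snd z)) \<longlongrightarrow> v k) (germ_at S v \<times>\<^sub>F (nhds (v k) \<times>\<^sub>F nhds (v k)))"
      by (rule filterlim_compose[OF filterlim_snd filterlim_snd])
  qed
  then have "\<forall>\<^sub>F z in germ_at S v \<times>\<^sub>F (nhds (v k) \<times>\<^sub>F nhds (v k)).
      dist (diff_quotient d (p (\<phi> (fst z))) (fst (snd z)) (snd (snd z))) D < norm D / 2"
    by (rule tendstoD) (simp add: D)
  then obtain P Q where PQ: "eventually P (germ_at S v)" "eventually Q (nhds (v k) \<times>\<^sub>F nhds (v k))"
    "\<And>s z. P s \<Longrightarrow> Q z \<Longrightarrow> dist (diff_quotient d (p (\<phi> s)) (fst z) (snd z)) D < norm D / 2"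
    unfolding eventually_prod_filter[of _ "germ_at S v"] fst_conv snd_conv by blast
  obtain \<delta>1 where \<delta>1: "\<delta>1 > 0" "\<And>s. s \<in> polydisc S v \<delta>1 \<Longrightarrow> P s"
    using PQ(1) unfolding eventually_germ_at by blast
  obtain Q1 where Q1: "eventually Q1 (nhds (v k))" "\<And>u w. Q1 u \<Longrightarrow> Q1 w \<Longrightarrow> Q (u, w)"
    using PQ(2) unfolding eventually_prod_same by blast
  obtain \<rho>' where \<rho>': "\<rho>' > 0" "\<And>u. dist u (v k) < \<rho>' \<Longrightarrow> Q1 u"
    using Q1(1) unfolding eventually_nhds_metric by blast
  define \<rho> where "\<rho> = \<rho>' / 2"
  have \<rho>: "\<rho> > 0" using \<rho>' by (simp add: \<rho>_def)
  have close: "norm (diff_quotient d (p (\<phi> s)) u w - D) \<le> norm D / 2"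
    if "s \<in> polydisc S v \<delta>1" "u \<in> cball (v k) \<rho>" "w \<in> cball (v k) \<rho>" for s u w
  proof -
    have "Q1 u" "Q1 w" using that \<rho>' by (auto simp: \<rho>_def dist_commute intro!: \<rho>'(2))
    then show ?thesis using PQ(3)[OF \<delta>1(2)[OF that(1)] Q1(2)] by (force simp: dist_norm)
  qed
  have lower: "norm D / 2 \<le> norm (diff_quotient d (p (\<phi> s)) u w)"
    if "s \<in> polydisc S v \<delta>1" "u \<in> cball (v k) \<rho>" "w \<in> cball (v k) \<rho>" for s u w
    using close[OF that] norm_triangle_ineq2[of D "diff_quotient d (p (\<phi> s)) u w"]
    by (simp add: norm_minus_commute)
  have small: "\<forall>\<^sub>F s in germ_at S v. norm (poly (p (\<phi> s)) (v k)) \<le> norm D * r / 2" if "r > 0" for r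
  proof -
    have "((\<lambda>s. \<Sum>l\<le>d. coeff (p (\<phi> s)) l * v k ^ l) \<longlongrightarrow> (\<Sum>l\<le>d. coeff (p v) l * v k ^ l)) (germ_at S v)"
      by (intro tendsto_intros lim)
    then have "((\<lambda>s. poly (p (\<phi> s)) (v k)) \<longlongrightarrow> 0) (germ_at S v)"
      using p(3)[OF v(1)] by (simp add: poly_sum_atMost[OF deg])
    then have "\<forall>\<^sub>F s in germ_at S v. dist (poly (p (\<phi> s)) (v k)) 0 < norm D * r / 2"
      by (rule tendstoD) (use that D in simp)
    then show ?thesis by eventually_elim simp
  qed
  obtain \<delta>2 where \<delta>2: "\<delta>2 > 0" "\<And>s. s \<in> polydisc S v \<delta>2 \<Longrightarrow> norm (poly (p (\<phi> s)) (v k)) \<le> norm D * \<rho> / 2"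
    using small[OF \<rho>] unfolding eventually_germ_at by blast
  have "\<forall>\<^sub>F s in germ_at S v. coeff (p (\<phi> s)) d \<noteq> 0"
    by (rule tendsto_imp_eventually_ne[OF lim v(2)])
  then obtain \<delta>3 where \<delta>3: "\<delta>3 > 0" "\<And>s. s \<in> polydisc S v \<delta>3 \<Longrightarrow> coeff (p (\<phi> s)) d \<noteq> 0"
    unfolding eventually_germ_at by blast
  define \<epsilon>' where "\<epsilon>' = min (min \<epsilon> \<delta>1) (min \<delta>2 \<delta>3)"
  have \<epsilon>': "\<epsilon>' > 0" using \<epsilon> \<delta>1(1) \<delta>2(1) \<delta>3(1) by (simp add: \<epsilon>'_def)
  have sub: "s \<in> polydisc S v \<epsilon>" "s \<in> polydisc S v \<delta>1" "s \<in> polydisc S v \<delta>2" "s \<in> polydisc S v \<delta>3"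
    if "s \<in> polydisc S v \<epsilon>'" for s
    using that unfolding polydisc_def \<epsilon>'_def by auto
  have root: "\<exists>u\<in>cball (v k) r. poly (p (\<phi> s)) u = 0"
    if "s \<in> polydisc S v \<delta>1" "0 \<le> r" "r \<le> \<rho>" "norm (poly (p (\<phi> s)) (v k)) \<le> norm D * r / 2" for s r
    by (rule contraction_root[where q = "diff_quotient d (p (\<phi> s))" and D = D and \<rho> = \<rho>])
       (use D that(2-4) diff_quotient_eq[OF deg] close[OF that(1)] in auto)
  have unique: "u = w" if "s \<in> polydisc S v \<delta>1" "u \<in> cball (v k) \<rho>" "w \<in> cball (v k) \<rho>"
    "poly (p (\<phi> s)) u = 0" "poly (p (\<phi> s)) w = 0" for s u w
    using lower[OF that(1-3)] diff_quotient_eq[OF deg, of "\<phi> s" u w] that(4,5) D by auto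
  \<comment> \<open>the root in the disc around \<open>v k\<close> of radius \<open>\<rho>\<close>, unique by \<open>unique\<close>\<close>
  define U where "U = (\<lambda>s. SOME u. u \<in> cball (v k) \<rho> \<and> poly (p (\<phi> s)) u = 0)"
  have U: "U s \<in> cball (v k) \<rho> \<and> poly (p (\<phi> s)) (U s) = 0" if "s \<in> polydisc S v \<epsilon>'" for s
  proof -
    have "\<exists>u\<in>cball (v k) \<rho>. poly (p (\<phi> s)) u = 0"
      using root[OF sub(2)[OF that] _ _ \<delta>2(2)[OF sub(3)[OF that]]] \<rho> by simp
    then have "\<exists>u. u \<in> cball (v k) \<rho> \<and> poly (p (\<phi> s)) u = 0" by blast
    then show ?thesis unfolding U_def by (rule someI_ex)
  qed
  have Ulim: "(U \<longlongrightarrow> v k) (germ_at S v)"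
  proof (rule tendstoI)
    fix \<eta> :: real assume \<eta>: "\<eta> > 0"
    define r where "r = min (\<eta> / 2) \<rho>"
    have r: "0 < r" "r \<le> \<rho>" "r < \<eta>" using \<eta> \<rho> by (auto simp: r_def)
    have "\<forall>\<^sub>F s in germ_at S v. s \<in> polydisc S v \<epsilon>'" using \<epsilon>' unfolding eventually_germ_at by blast
    then show "\<forall>\<^sub>F s in germ_at S v. dist (U s) (v k) < \<eta>"
      using small[OF r(1)]
    proof (eventually_elim)
      case (elim s)
      obtain u where u: "u \<in> cball (v k) r" "poly (p (\<phi> s)) u = 0"
        using root[OF sub(2)[OF elim(1)] _ r(2) elim(2)] r(1) by auto
      have "U s = u"
        using unique[OF sub(2)[OF elim(1)], of "U s" u] U[OF elim(1)] u r(2) by auto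
      then show ?case using u(1) r(3) by (simp add: dist_commute)
    qed
  qed
  have vin: "v \<in> polydisc S v \<epsilon>'" using \<epsilon>' by (simp add: polydisc_def)
  have pv: "p (\<phi> v) = p v" by (rule poly_family_cong[OF p(2) \<phi>v])
  have Uv: "U v = v k"
    using unique[OF sub(2)[OF vin], of "U v" "v k"] U[OF vin] p(3)[OF v(1)] \<rho> pv by simp
  define \<phi>' where "\<phi>' = (\<lambda>s. (\<phi> s)(k := U s))"
  have \<phi>'K: "\<phi>' s i = \<phi> s i" if "i \<in> K" for s i using k that by (auto simp: \<phi>'_def)
  have "local_section S (insert k K) V v \<epsilon>' \<phi>'"
    unfolding local_section_def
  proof (intro conjI ballI allI impI)
    show "\<epsilon>' > 0" by fact
  next
    fix s i assume "s \<in> polydisc S v \<epsilon>'" "i \<in> S"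
    then show "\<phi>' s i = s i" using \<phi>S sub(1) \<phi>'K SK by auto
  next
    fix s f assume s: "s \<in> polydisc S v \<epsilon>'" and f: "polynomial_in (coords (insert k K)) f" "\<forall>x\<in>V. f x = 0"
    obtain e g where g: "poly_family K e g" "\<And>x. f x = poly (g x) (x k)"
      using polynomial_in_insert_coords[OF f(1)] by blast
    obtain N q r where r: "poly_family K (d - 1) r"
      and eq: "\<And>x. smult (coeff (p x) d ^ N) (g x) = p x * q x + r x"
      using poly_family_pseudo_division[OF p(2,1) g(1)] by blast
    have "poly (r x) (x k) = 0" if "x \<in> V" for x
      using arg_cong[OF eq[of x], of "\<lambda>h. poly h (x k)"] p(3)[OF that] f(2) g(2)[of x] that by simp
    then have "r x = 0" if "x \<in> V" for x using min[OF r _ that] by blast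
    moreover have "polynomial_in (coords K) (\<lambda>x. coeff (r x) l)" for l
      using r unfolding poly_family_def by blast
    ultimately have "coeff (r (\<phi> s)) l = 0" for l
      using \<phi>V[OF sub(1)[OF s], of "\<lambda>x. coeff (r x) l"] by simp
    then have "r (\<phi> s) = 0" by (simp add: poly_eq_iff)
    then have "coeff (p (\<phi> s)) d ^ N * poly (g (\<phi> s)) (U s) = 0"
      using arg_cong[OF eq[of "\<phi> s"], of "\<lambda>h. poly h (U s)"] U[OF s] by simp
    moreover have "g (\<phi>' s) = g (\<phi> s)" by (rule poly_family_cong[OF g(1) \<phi>'K])
    moreover have "\<phi>' s k = U s" by (simp add: \<phi>'_def)
    ultimately show "f (\<phi>' s) = 0" using \<delta>3(2)[OF sub(4)[OF s]] g(2)[of "\<phi>' s"] by simp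
  next
    fix i assume i: "i \<in> insert k K"
    show "\<phi>' v i = v i" using i Uv \<phi>v by (auto simp: \<phi>'_def)
    show "((\<lambda>s. \<phi>' s i) \<longlongrightarrow> v i) (germ_at S v)"
      using i Ulim \<phi>lim by (cases "i = k") (auto simp: \<phi>'_def)
  next
    fix s e t0 i assume t0: "(\<lambda>i. s i + t0 * e i) \<in> polydisc S v \<epsilon>'" and i: "i \<in> insert k K"
    let ?y = "\<lambda>t i. s i + t * e i"
    have ev: "\<forall>\<^sub>F t in nhds t0. ?y t \<in> polydisc S v \<epsilon>'" by (rule eventually_polydisc_line[OF fin t0])
    have \<phi>d: "(\<lambda>t. \<phi> (?y t) i) field_differentiable at t0" if "i \<in> K" for i
      using \<phi>diff[of s t0 e i] sub(1)[OF t0] that by simp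
    have cd: "(\<lambda>t. coeff (p (\<phi> (?y t))) l) field_differentiable at t0" for l
      by (rule polynomial_in_field_differentiable[OF cpoly]) (auto intro: \<phi>d)
    have "(\<lambda>t. U (?y t)) field_differentiable at t0"
    proof (rule implicit_root_differentiable[where F = "\<lambda>t. poly (p (\<phi> (?y t)))"
          and q = "\<lambda>t. diff_quotient d (p (\<phi> (?y t)))" and m = "norm D / 2"
          and Q = "diff_quotient d (p (\<phi> (?y t0))) (U (?y t0)) (U (?y t0))"])
      show "\<forall>\<^sub>F t in nhds t0. poly (p (\<phi> (?y t))) (U (?y t)) = 0"
        using ev by eventually_elim (simp add: U)
      show "poly (p (\<phi> (?y t))) u - poly (p (\<phi> (?y t))) w = (u - w) * diff_quotient d (p (\<phi> (?y t))) u w" for t u w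
        by (rule diff_quotient_eq[OF deg])
      show "norm D / 2 > 0" using D by simp
      show "\<forall>\<^sub>F t in nhds t0. norm D / 2 \<le> norm (diff_quotient d (p (\<phi> (?y t))) (U (?y t)) (U (?y t0)))"
        using ev by eventually_elim (intro lower sub(2) U[THEN conjunct1] t0; assumption)
      show "(\<lambda>t. poly (p (\<phi> (?y t))) (U (?y t0))) field_differentiable at t0"
        unfolding poly_sum_atMost[OF deg]
        by (intro field_differentiable_sum field_differentiable_mult cd field_differentiable_const)
      assume "((\<lambda>t. U (?y t)) \<longlongrightarrow> U (?y t0)) (at t0)"
      moreover have "((\<lambda>t. coeff (p (\<phi> (?y t))) l) \<longlongrightarrow> coeff (p (\<phi> (?y t0))) l) (at t0)" for l
        using field_differentiable_imp_continuous_at[OF cd] by (simp add: continuous_at)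
      ultimately show "((\<lambda>t. diff_quotient d (p (\<phi> (?y t))) (U (?y t)) (U (?y t0))) \<longlongrightarrow>
          diff_quotient d (p (\<phi> (?y t0))) (U (?y t0)) (U (?y t0))) (at t0)"
        by (intro tendsto_diff_quotient tendsto_const)
    qed
    then show "(\<lambda>t. \<phi>' (?y t) i) field_differentiable at t0"
      using i \<phi>d by (cases "i = k") (auto simp: \<phi>'_def)
  qed
  then show ?thesis by blast
qed

text \<open>
  The coordinates outside \<open>S\<close> are adjoined one at a time. Each of them is algebraic over \<open>S\<close> because \<open>S\<close> is
  maximal, hence has a minimal relation over the coordinates adjoined before. In characteristic zero the
  derivative of that relation is a nonzero polynomial of smaller degree, so by minimality it does not
  vanish identically at the coordinate: generically the root is simple.
\<close>

theorem generic_local_section: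
  assumes irr: "irreducible_on (coords I) V" and fin: "finite I" and SI: "S \<subseteq> I"
    and indep: "alg_independent_on S V"
    and max: "\<And>k. k \<in> I - S \<Longrightarrow> \<not> alg_independent_on (insert k S) V"
  shows "\<exists>h. polynomial_in (coords I) h \<and> (\<exists>v\<in>V. h v \<noteq> 0) \<and> (\<forall>v\<in>V. h v \<noteq> 0 \<longrightarrow>
     (\<forall>w. tangent_vector I V v w \<longrightarrow> (\<forall>i\<in>S. w i = 0) \<longrightarrow> (\<forall>i\<in>I. w i = 0)) \<and>
     (\<exists>\<epsilon> \<phi>. local_section S I V v \<epsilon> \<phi>))"
proof -
  have V: "V \<noteq> {}" using irr by (auto simp: irreducible_on_def)
  have finS: "finite S" using SI fin finite_subset by blast
  have "\<exists>h. polynomial_in (coords I) h \<and> (\<exists>v\<in>V. h v \<noteq> 0) \<and> (\<forall>v\<in>V. h v \<noteq> 0 \<longrightarrow>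
     (\<forall>w. tangent_vector I V v w \<longrightarrow> (\<forall>i\<in>S. w i = 0) \<longrightarrow> (\<forall>i\<in>S \<union> T. w i = 0)) \<and>
     (\<exists>\<epsilon> \<phi>. local_section S (S \<union> T) V v \<epsilon> \<phi>))" if "T \<subseteq> I - S" for T
    using finite_subset[OF that finite_Diff[OF fin]] that
  proof (induction T rule: finite_induct)
    case empty
    have "local_section S S V v 1 (\<lambda>s. s)" if "v \<in> V" for v
      unfolding local_section_def
    proof (intro conjI ballI allI impI)
      fix s f assume "polynomial_in (coords S) f" "\<forall>x\<in>V. f x = 0"
      then show "f s = 0" using indep unfolding alg_independent_on_def by blast
    next
      fix i assume "i \<in> S"
      then show "((\<lambda>s. s i) \<longlongrightarrow> v i) (germ_at S v)"
        by (intro tendstoI) (auto simp: eventually_germ_at polydisc_def)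
    next
      fix s e :: "'a \<Rightarrow> complex" and t i
      show "(\<lambda>t. s i + t * e i) field_differentiable at t"
        by (intro field_differentiable_add field_differentiable_mult field_differentiable_const field_differentiable_ident)
    qed auto
    then show ?case using V by (intro exI[of _ "\<lambda>x. 1"]) (auto intro: polynomial_in.const)
  next
    case (insert k T)
    let ?K = "S \<union> T"
    have kK: "k \<notin> ?K" "k \<in> I - S" "k \<in> I" and KI: "?K \<subseteq> I" using insert SI by auto
    obtain h where h: "polynomial_in (coords I) h" "\<exists>v\<in>V. h v \<noteq> 0"
      and H: "\<forall>v\<in>V. h v \<noteq> 0 \<longrightarrow>
        (\<forall>w. tangent_vector I V v w \<longrightarrow> (\<forall>i\<in>S. w i = 0) \<longrightarrow> (\<forall>i\<in>?K. w i = 0)) \<and>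
        (\<exists>\<epsilon> \<phi>. local_section S ?K V v \<epsilon> \<phi>)"
      using insert.IH insert.prems by blast
    have hT: "\<And>v w i. v \<in> V \<Longrightarrow> h v \<noteq> 0 \<Longrightarrow> tangent_vector I V v w \<Longrightarrow> (\<And>i. i \<in> S \<Longrightarrow> w i = 0) \<Longrightarrow> i \<in> ?K \<Longrightarrow> w i = 0"
      and hS: "\<And>v. v \<in> V \<Longrightarrow> h v \<noteq> 0 \<Longrightarrow> \<exists>\<epsilon> \<phi>. local_section S ?K V v \<epsilon> \<phi>"
      using H by blast+
    obtain f x0 where f: "polynomial_in (coords (insert k S)) f" "\<And>v. v \<in> V \<Longrightarrow> f v = 0" "f x0 \<noteq> 0"
      using max[OF kK(2)] unfolding alg_independent_on_def by blast
    obtain e q where q: "poly_family S e q" "\<And>x. f x = poly (q x) (x k)"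
      using polynomial_in_insert_coords[OF f(1)] by blast
    have "\<exists>l. coeff (q x0) l \<noteq> 0" using f(3) q(2)[of x0] by (metis leading_coeff_0_iff poly_0)
    then obtain l v0 where lv: "v0 \<in> V" "coeff (q v0) l \<noteq> 0"
      using indep q(1) unfolding alg_independent_on_def poly_family_def by blast
    have qK: "poly_family ?K e q"
      using q(1) unfolding poly_family_def by (auto intro: polynomial_in_coords_mono)
    obtain d p where p: "d > 0" "poly_family ?K d p" "\<And>v. v \<in> V \<Longrightarrow> poly (p v) (v k) = 0"
      "\<exists>v\<in>V. coeff (p v) d \<noteq> 0"
      and min: "\<And>r v. poly_family ?K (d - 1) r \<Longrightarrow> (\<And>v. v \<in> V \<Longrightarrow> poly (r v) (v k) = 0) \<Longrightarrow> v \<in> V \<Longrightarrow> r v = 0"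
      using minimal_relation[OF V qK, of k, OF _ lv] f(2) q(2) by (metis (no_types, lifting))
    have pd: "poly_family ?K (d - 1) (\<lambda>x. pderiv (p x))"
      using p(2) unfolding poly_family_def coeff_pderiv
      by (auto intro!: polynomial_in.mult polynomial_in.const simp: degree_pderiv diff_le_mono)
    \<comment> \<open>separability: the coefficient of index \<open>d - 1\<close> of the derivative is \<open>d\<close> times the leading one\<close>
    have sep: "\<exists>v\<in>V. poly (pderiv (p v)) (v k) \<noteq> 0"
    proof (rule ccontr)
      assume "\<not> ?thesis"
      then have "pderiv (p v) = 0" if "v \<in> V" for v using min[OF pd _ that] by blast
      then have "coeff (pderiv (p v)) (d - 1) = 0" if "v \<in> V" for v using that by simp
      then show False using p(1,4) by (auto simp: coeff_pderiv)
    qed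
    have polys: "polynomial_in (coords I) (\<lambda>v. coeff (p v) d)" "polynomial_in (coords I) (\<lambda>v. poly (pderiv (p v)) (v k))"
      using p(2) KI kK(3) polynomial_in_coords_mono[OF poly_family_eval[OF pd, of k], of I]
      unfolding poly_family_def by (blast intro: polynomial_in_coords_mono)+
    define h' where "h' = (\<lambda>v. h v * (coeff (p v) d * poly (pderiv (p v)) (v k)))"
    have "polynomial_in (coords I) h'" unfolding h'_def by (intro polynomial_in.mult h polys)
    moreover have "\<exists>v\<in>V. h' v \<noteq> 0"
      using irreducible_on_all_nonzero[OF irr, of "{0,1,2::nat}"
          "\<lambda>a. if a = 0 then h else if a = 1 then (\<lambda>v. coeff (p v) d) else (\<lambda>v. poly (pderiv (p v)) (v k))"]
        h polys p(4) sep by (auto simp: h'_def)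
    moreover have "(\<forall>w. tangent_vector I V v w \<longrightarrow> (\<forall>i\<in>S. w i = 0) \<longrightarrow> (\<forall>i\<in>S \<union> insert k T. w i = 0)) \<and>
       (\<exists>\<epsilon> \<phi>. local_section S (S \<union> insert k T) V v \<epsilon> \<phi>)" if v: "v \<in> V" "h' v \<noteq> 0" for v
    proof (intro conjI allI impI)
      fix w assume w: "tangent_vector I V v w" "\<forall>i\<in>S. w i = 0"
      have wK: "w i = 0" if "i \<in> ?K" for i using hT[OF v(1) _ w(1) _ that] v(2) w(2) by (simp add: h'_def)
      have tw: "tangent_vector (insert k ?K) V v w"
        by (rule tangent_vector_mono[OF w(1)]) (use KI kK(3) in blast)
      have "w k = 0"
        by (rule tangent_vector_insert_zero[OF kK(1) p(2,3)]) (use tw wK v(2) in \<open>auto simp: h'_def\<close>)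
      then show "\<forall>i\<in>S \<union> insert k T. w i = 0" using wK by auto
    next
      obtain \<epsilon> \<phi> where "local_section S ?K V v \<epsilon> \<phi>" using hS[OF v(1)] v(2) by (auto simp: h'_def)
      then have "\<exists>\<epsilon> \<phi>. local_section S (insert k ?K) V v \<epsilon> \<phi>"
        using v(2) by (intro local_section_insert[OF finS kK(1) Un_upper1 p(1,2) p(3) _ v(1)])
          (auto simp: h'_def intro: min)
      then show "\<exists>\<epsilon> \<phi>. local_section S (S \<union> insert k T) V v \<epsilon> \<phi>" by simp
    qed
    ultimately show ?case by blast
  qed
  from this[of "I - S"] show ?thesis using SI by (simp add: Un_absorb1)
qed

lemma maximal_alg_independent:
  assumes "finite I" "S0 \<subseteq> I" "alg_independent_on S0 V"
  shows "\<exists>S. S0 \<subseteq> S \<and> S \<subseteq> I \<and> alg_independent_on S V \<and> (\<forall>k\<in>I - S. \<not> alg_independent_on (insert k S) V)"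
proof -
  define A where "A = {S. S0 \<subseteq> S \<and> S \<subseteq> I \<and> alg_independent_on S V}"
  have "finite A" unfolding A_def using assms(1) by (auto intro: finite_subset[of _ "Pow I"])
  moreover have "S0 \<in> A" using assms unfolding A_def by auto
  ultimately have "\<exists>S\<in>A. S0 \<subseteq> S \<and> (\<forall>T\<in>A. S \<subseteq> T \<longrightarrow> S = T)" by (rule finite_has_maximal2)
  then obtain S where S: "S \<in> A" "\<And>T. T \<in> A \<Longrightarrow> S \<subseteq> T \<Longrightarrow> S = T" by blast
  have "\<not> alg_independent_on (insert k S) V" if k: "k \<in> I - S" for k
  proof
    assume "alg_independent_on (insert k S) V"
    then have "insert k S \<in> A" using S(1) k unfolding A_def by blast
    from S(2)[OF this] k show False by blast
  qed
  then show ?thesis using S(1) unfolding A_def by blast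
qed

text \<open>
  The derivative at \<open>v\<close> of the local section along the line in direction \<open>a\<close>.
\<close>

lemma tangent_vector_prescribed:
  assumes sec: "local_section S I V v \<epsilon> \<phi>" and SI: "S \<subseteq> I" and fin: "finite S"
  shows "\<exists>w. tangent_vector I V v w \<and> (\<forall>i\<in>S. w i = a i)"
proof -
  let ?l = "\<lambda>t i. v i + t * a i"
  have \<epsilon>: "\<epsilon> > 0" using sec unfolding local_section_def by blast
  have l0: "?l 0 = v" by simp
  have v: "?l 0 \<in> polydisc S v \<epsilon>" using \<epsilon> by (simp add: polydisc_def)
  have near: "\<forall>\<^sub>F t in nhds 0. ?l t \<in> polydisc S v \<epsilon>" by (rule eventually_polydisc_line[OF fin v])
  have "\<forall>i\<in>I. \<exists>D. ((\<lambda>t. \<phi> (?l t) i) has_field_derivative D) (at 0)"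
    using sec v unfolding local_section_def field_differentiable_def by blast
  then obtain w where w: "\<And>i. i \<in> I \<Longrightarrow> ((\<lambda>t. \<phi> (?l t) i) has_field_derivative w i) (at 0)"
    by metis
  have "tangent_vector I V v w"
    unfolding tangent_vector_def
  proof (intro allI impI)
    fix f assume f: "polynomial_in (coords I) f" "\<forall>x\<in>V. f x = 0"
    have "\<exists>D. ((\<lambda>t. f (\<phi> (?l t))) has_field_derivative D) (at 0) \<and>
              ((\<lambda>t. f (\<lambda>i. v i + t * w i)) has_field_derivative D) (at 0)"
    proof (rule polynomial_in_same_jet[OF f(1)])
      fix c assume "c \<in> coords I"
      then obtain i where i: "i \<in> I" "c = (\<lambda>x. x i)" by auto
      show "c (\<phi> (?l 0)) = c (\<lambda>i. v i + 0 * w i)"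
        using sec i unfolding local_section_def l0 by simp
      have "((\<lambda>t. v i + t * w i) has_field_derivative w i) (at 0)"
        by (auto intro!: derivative_eq_intros)
      then show "\<exists>D. ((\<lambda>t. c (\<phi> (?l t))) has_field_derivative D) (at 0) \<and>
          ((\<lambda>t. c (\<lambda>i. v i + t * w i)) has_field_derivative D) (at 0)"
        using w[OF i(1)] unfolding i(2) by blast
    qed
    then obtain D where D: "((\<lambda>t. f (\<phi> (?l t))) has_field_derivative D) (at 0)"
      "((\<lambda>t. f (\<lambda>i. v i + t * w i)) has_field_derivative D) (at 0)" by blast
    have "\<forall>\<^sub>F t in nhds 0. f (\<phi> (?l t)) = 0"
      using near by eventually_elim (use sec f in \<open>auto simp: local_section_def\<close>)
    then have "((\<lambda>t. f (\<phi> (?l t))) has_field_derivative 0) (at 0)"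
      by (subst DERIV_cong_ev[OF refl _ refl, where g = "\<lambda>t. 0"]) auto
    then show "((\<lambda>t. f (\<lambda>i. v i + t * w i)) has_field_derivative 0) (at 0)"
      using D DERIV_unique by blast
  qed
  moreover have "w i = a i" if i: "i \<in> S" for i
  proof -
    have "\<forall>\<^sub>F t in nhds 0. \<phi> (?l t) i = ?l t i"
      using near by eventually_elim (use sec i in \<open>auto simp: local_section_def\<close>)
    moreover have "((\<lambda>t. ?l t i) has_field_derivative a i) (at 0)"
      by (auto intro!: derivative_eq_intros)
    ultimately have "((\<lambda>t. \<phi> (?l t) i) has_field_derivative a i) (at 0)"
      by (subst DERIV_cong_ev[OF refl _ refl]) auto
    then show ?thesis using w i SI DERIV_unique by blast
  qed
  ultimately show ?thesis by blast
qed

section \<open>Independent coordinates on a proper closed subset\<close>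

text \<open>
  The point of the graph of \<open>f\<close> above \<open>v\<close>; the value of \<open>f\<close> becomes the new coordinate \<open>None\<close>.
\<close>

definition with_function :: "(('i \<Rightarrow> complex) \<Rightarrow> complex) \<Rightarrow> ('i \<Rightarrow> complex) \<Rightarrow> 'i option \<Rightarrow> complex" where
  "with_function f v = case_option (f v) v"

lemma with_function_simps [simp]:
  "with_function f v None = f v" "with_function f v (Some i) = v i"
  by (simp_all add: with_function_def)

lemma irreducible_on_with_function:
  assumes "irreducible_on (coords I) V" "polynomial_in (coords I) f"
  shows "irreducible_on (coords (insert None (Some ` I))) (with_function f ` V)"
  by (rule irreducible_on_image[OF assms(1)])
     (auto intro: assms(2) polynomial_in_coords_coord)

text \<open>
  A relation \<open>a\<^sub>0 + a\<^sub>1 f + \<dots> + a\<^sub>e f\<^sup>e = 0\<close> on \<open>V\<close> with coefficients in the coordinates \<open>S\<close> restricts on \<open>Z\<close>,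
  where \<open>f\<close> vanishes, to \<open>a\<^sub>0 = 0\<close>. Independence on \<open>Z\<close> gives \<open>a\<^sub>0 = 0\<close> identically. As \<open>V\<close> is irreducible and
  \<open>f\<close> is not zero on \<open>V\<close>, the factor \<open>f\<close> can be cancelled, and induction on \<open>e\<close> removes all coefficients.
\<close>

lemma alg_independent_on_with_function:
  assumes irr: "irreducible_on (coords I) V" and f: "polynomial_in (coords I) f"
    and "v0 \<in> V" "f v0 \<noteq> 0"
    and Z: "\<And>z. z \<in> Z \<Longrightarrow> f z = 0" and SI: "S \<subseteq> I" and indep: "alg_independent_on S Z"
    and ZV: "Z \<subseteq> V"
  shows "alg_independent_on (insert None (Some ` S)) (with_function f ` V)"
proof -
  let ?E = "with_function f"
  have main: "\<forall>x. p x = 0" if "poly_family (Some ` S) e p" "\<And>v. v \<in> V \<Longrightarrow> poly (p (?E v)) (f v) = 0" for e p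
    using that
  proof (induction e arbitrary: p)
    have const0: "coeff (p x) 0 = 0"
      if p: "poly_family (Some ` S) e p" "\<And>v. v \<in> V \<Longrightarrow> poly (p (?E v)) (f v) = 0" for p e x
    proof -
      define g where "g = (\<lambda>y. coeff (p (case_option 0 y)) 0)"
      have pc: "polynomial_in (coords (Some ` S)) (\<lambda>x. coeff (p x) 0)"
        using p(1) unfolding poly_family_def by blast
      have "polynomial_in (coords S) g"
        unfolding g_def by (rule polynomial_in_subst[OF pc]) (auto intro: polynomial_in_coords_coord)
      moreover have "g z = 0" if z: "z \<in> Z" for z
      proof -
        have "p (case_option 0 z) = p (?E z)" by (rule poly_family_cong[OF p(1)]) auto
        then show ?thesis using p(2)[of z] Z[OF z] ZV z by (auto simp: g_def poly_0_coeff_0)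
      qed
      ultimately have "g (\<lambda>i. x (Some i)) = 0" using indep unfolding alg_independent_on_def by blast
      moreover have "p (case_option 0 (\<lambda>i. x (Some i))) = p x" by (rule poly_family_cong[OF p(1)]) auto
      ultimately show ?thesis by (simp add: g_def)
    qed
    {
      case 0
      have "p x = 0" for x
      proof -
        have "degree (p x) = 0" using 0(1) unfolding poly_family_def by auto
        then obtain c where "p x = [:c:]" by (rule degree_eq_zeroE)
        then show ?thesis using const0[OF 0, of x] by simp
      qed
      then show ?case by blast
    next
      case (Suc e)
      define p1 where "p1 = (\<lambda>x. poly_shift 1 (p x))"
      have p1: "p x = pCons 0 (p1 x)" for x
        using const0[OF Suc.prems, of x]
        by (intro poly_eqI) (auto simp: p1_def coeff_pCons coeff_poly_shift split: nat.split)
      have fam: "poly_family (Some ` S) e p1"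
        unfolding poly_family_def
      proof (intro conjI allI)
        show "polynomial_in (coords (Some ` S)) (\<lambda>x. coeff (p1 x) l)" for l
          using Suc.prems(1) unfolding poly_family_def p1_def coeff_poly_shift by blast
        have "degree (p x) \<le> Suc e" for x using Suc.prems(1) unfolding poly_family_def by blast
        then show "degree (p1 x) \<le> e" for x
          unfolding p1_def
          by (intro degree_le allI impI) (auto simp: coeff_poly_shift intro!: coeff_eq_0 le_less_trans[of _ "Suc e"])
      qed
      have "polynomial_in (coords I) (\<lambda>v. poly (p1 (?E v)) (?E v None))"
        by (rule polynomial_in_subst[OF poly_family_eval[OF fam, of None]])
           (auto intro: f polynomial_in_coords_coord[OF subsetD[OF SI]])
      then have "poly (p1 (?E v)) (f v) = 0" if "v \<in> V" for v
        using irreducible_onD[OF irr f, of "\<lambda>v. poly (p1 (?E v)) (f v)" v0 v] assms(3,4) that Suc.prems(2)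
        by (simp add: p1)
      then show ?case using Suc.IH[OF fam] by (simp add: p1)
    }
  qed
  show ?thesis
    unfolding alg_independent_on_def
  proof (intro allI impI)
    fix Q x assume Q: "polynomial_in (coords (insert None (Some ` S))) Q" "\<forall>v\<in>?E ` V. Q v = 0"
    obtain e p where p: "poly_family (Some ` S) e p" "\<And>x. Q x = poly (p x) (x None)"
      using polynomial_in_insert_coords[OF Q(1)] by blast
    have "\<forall>x. p x = 0" using main[OF p(1)] Q(2) p(2) by auto
    then show "Q x = 0" using p(2) by simp
  qed
qed

text \<open>
  If \<open>S\<close> were maximal on \<open>V\<close>, generic tangent vectors of \<open>V\<close> would be determined by their coordinates in
  \<open>S\<close>. But \<open>S\<close> together with \<open>f\<close> is independent on the graph of \<open>f\<close>, so the graph has a generic tangent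
  vector with coordinate \<open>1\<close> at \<open>f\<close> and \<open>0\<close> at \<open>S\<close>. Its projection to \<open>V\<close> is a tangent vector, hence zero, and
  then the derivative of \<open>f\<close> along it is zero as well, a contradiction.
\<close>

theorem alg_independent_on_proper_subset:
  assumes irr: "irreducible_on (coords I) V" and fin: "finite I"
    and f: "polynomial_in (coords I) f" "v0 \<in> V" "f v0 \<noteq> 0"
    and Z: "\<And>z. z \<in> Z \<Longrightarrow> f z = 0" "Z \<subseteq> V" and SI: "S \<subseteq> I" and indep: "alg_independent_on S Z"
  shows "\<exists>k\<in>I - S. alg_independent_on (insert k S) V"
proof (rule ccontr)
  let ?E = "with_function f" and ?I = "insert None (Some ` I)"
  assume "\<not> ?thesis"
  then have max: "\<And>k. k \<in> I - S \<Longrightarrow> \<not> alg_independent_on (insert k S) V" by blast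
  have "alg_independent_on S V" using indep Z(2) unfolding alg_independent_on_def by blast
  from generic_local_section[OF irr fin SI this max] obtain h1 where
    h1: "polynomial_in (coords I) h1" "\<exists>v\<in>V. h1 v \<noteq> 0"
    "\<And>v w. v \<in> V \<Longrightarrow> h1 v \<noteq> 0 \<Longrightarrow> tangent_vector I V v w \<Longrightarrow> \<forall>i\<in>S. w i = 0 \<Longrightarrow> \<forall>i\<in>I. w i = 0"
    by blast
  have irr': "irreducible_on (coords ?I) (?E ` V)" by (rule irreducible_on_with_function[OF irr f(1)])
  have fin': "finite ?I" using fin by simp
  obtain T where T: "insert None (Some ` S) \<subseteq> T" "T \<subseteq> ?I" "alg_independent_on T (?E ` V)"
    "\<And>k. k \<in> ?I - T \<Longrightarrow> \<not> alg_independent_on (insert k T) (?E ` V)"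
    using maximal_alg_independent[OF fin' _ alg_independent_on_with_function[OF irr f Z(1) SI indep Z(2)]] SI
    by (metis image_mono insert_mono)
  have finT: "finite T" using T(2) fin' finite_subset by blast
  from generic_local_section[OF irr' fin' T(2,3,4)] obtain h2 where
    h2: "polynomial_in (coords ?I) h2" "\<exists>v\<in>?E ` V. h2 v \<noteq> 0"
    "\<And>v. v \<in> ?E ` V \<Longrightarrow> h2 v \<noteq> 0 \<Longrightarrow> \<exists>\<epsilon> \<phi>. local_section T ?I (?E ` V) v \<epsilon> \<phi>"
    by blast
  have h2': "polynomial_in (coords I) (\<lambda>v. h2 (?E v))"
    by (rule polynomial_in_subst[OF h2(1)]) (auto intro: f polynomial_in_coords_coord)
  obtain v where v: "v \<in> V" "h1 v \<noteq> 0" "h2 (?E v) \<noteq> 0"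
    using irreducible_on_both_nonzero[OF irr h1(1) h2' h1(2)] h2(2) by blast
  obtain \<epsilon> \<phi> where "local_section T ?I (?E ` V) (?E v) \<epsilon> \<phi>" using h2(3) v by blast
  from tangent_vector_prescribed[OF this T(2) finT, of "case_option 1 (\<lambda>i. 0)"] obtain w where
    w: "tangent_vector ?I (?E ` V) (?E v) w" "\<forall>b\<in>T. w b = case_option 1 (\<lambda>i. 0) b" by blast
  have w1: "w None = 1" "\<forall>i\<in>S. w (Some i) = 0" using w(2) T(1) by force+
  have lin: "(\<lambda>i. with_function f v (Some i) + t * w (Some i)) = (\<lambda>i. v i + t * w (Some i))" for t by simp
  have sub: "polynomial_in (coords ?I) (\<lambda>x. g (\<lambda>i. x (Some i)))" if "polynomial_in (coords I) g" for g
    by (rule polynomial_in_subst[OF that]) (auto intro!: polynomial_in.coord)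
  have der: "((\<lambda>t. G (\<lambda>b. ?E v b + t * w b)) has_field_derivative 0) (at 0)"
    if "polynomial_in (coords ?I) G" "\<And>x. x \<in> V \<Longrightarrow> G (?E x) = 0" for G
    using w(1) that unfolding tangent_vector_def by blast
  have "tangent_vector I V v (\<lambda>i. w (Some i))"
    unfolding tangent_vector_def
  proof (intro allI impI)
    fix g assume g: "polynomial_in (coords I) g" "\<forall>x\<in>V. g x = 0"
    show "((\<lambda>t. g (\<lambda>i. v i + t * w (Some i))) has_field_derivative 0) (at 0)"
      using der[OF sub[OF g(1)]] g(2) by simp
  qed
  from h1(3)[OF v(1,2) this w1(2)] have w0: "w (Some i) = 0" if "i \<in> I" for i using that by blast
  have "((\<lambda>t. (f v + t * w None) - f (\<lambda>i. v i + t * w (Some i))) has_field_derivative 0) (at 0)"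
    using der[OF polynomial_in_diff[OF polynomial_in_coords_coord[of None] sub[OF f(1)]]] by simp
  moreover have "f (\<lambda>i. v i + t * w (Some i)) = f v" for t
    by (rule polynomial_in_coords_cong[OF f(1)]) (simp add: w0)
  ultimately have "((\<lambda>t. t) has_field_derivative (0::complex)) (at 0)" by (simp add: w1)
  then show False using DERIV_unique[OF _ DERIV_ident] by fastforce
qed

section \<open>Zariski closed sets and irreducibility\<close>

abbreviation entries :: "(complex ^ 'n \<Rightarrow> complex) set" where
  "entries \<equiv> range (\<lambda>i x. x $ i)"

lemma vec_polynomial_as_coords:
  "vec_polynomial f \<Longrightarrow> polynomial_in (coords UNIV) (\<lambda>y. f (\<chi> i. y i))"
  unfolding vec_polynomial_def
  by (erule polynomial_in_subst) (auto intro: polynomial_in.coord)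

lemma coords_as_vec_polynomial:
  "polynomial_in (coords S) g \<Longrightarrow> vec_polynomial (\<lambda>x. g (vec_nth x))"
  unfolding vec_polynomial_def
  by (erule polynomial_in_subst) (auto intro: polynomial_in.coord)

lemma zariski_closed_zeros: "vec_polynomial f \<Longrightarrow> zariski_closed {x. f x = 0}"
  unfolding zariski_closed_def by (intro exI[of _ "{f}"]) auto

lemma zariski_closed_Int:
  assumes "zariski_closed A" "zariski_closed B" shows "zariski_closed (A \<inter> B)"
proof -
  obtain F G where "\<forall>f\<in>F. vec_polynomial f" "A = {x. \<forall>f\<in>F. f x = 0}"
    "\<forall>f\<in>G. vec_polynomial f" "B = {x. \<forall>f\<in>G. f x = 0}"
    using assms unfolding zariski_closed_def by blast
  then show ?thesis unfolding zariski_closed_def by (intro exI[of _ "F \<union> G"]) auto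
qed

lemma zariski_closed_memI:
  assumes "zariski_closed Y" "\<And>f. vec_polynomial f \<Longrightarrow> (\<And>y. y \<in> Y \<Longrightarrow> f y = 0) \<Longrightarrow> f x = 0"
  shows "x \<in> Y"
  using assms unfolding zariski_closed_def by blast

lemma zariski_closure_subset: "S \<subseteq> zariski_closure S"
  unfolding zariski_closure_def by blast

lemma zariski_closure_minimal: "zariski_closed Y \<Longrightarrow> S \<subseteq> Y \<Longrightarrow> zariski_closure S \<subseteq> Y"
  unfolding zariski_closure_def by blast

lemma zariski_closure_vanish:
  assumes "vec_polynomial f" "\<And>x. x \<in> S \<Longrightarrow> f x = 0" "x \<in> zariski_closure S"
  shows "f x = 0"
  using zariski_closure_minimal[OF zariski_closed_zeros[OF assms(1)], of S] assms(2,3) by blast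

lemma zariski_closed_closure: "zariski_closed (zariski_closure S)"
  unfolding zariski_closed_def
proof (intro exI conjI)
  let ?F = "{f. vec_polynomial f \<and> (\<forall>x\<in>S. f x = 0)}"
  show "\<forall>f\<in>?F. vec_polynomial f" by blast
  show "zariski_closure S = {x. \<forall>f\<in>?F. f x = 0}"
  proof (intro subset_antisym subsetI)
    fix x assume "x \<in> zariski_closure S"
    then show "x \<in> {x. \<forall>f\<in>?F. f x = 0}" using zariski_closure_vanish by blast
  next
    fix x assume x: "x \<in> {x. \<forall>f\<in>?F. f x = 0}"
    show "x \<in> zariski_closure S"
      unfolding zariski_closure_def
    proof (intro InterI, elim CollectE conjE)
      fix Y assume "zariski_closed Y" "S \<subseteq> Y"
      then show "x \<in> Y" using x by (intro zariski_closed_memI) auto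
    qed
  qed
qed

lemma zariski_closure_mono: "S \<subseteq> T \<Longrightarrow> zariski_closure S \<subseteq> zariski_closure T"
  by (meson zariski_closed_closure zariski_closure_minimal zariski_closure_subset order_trans)

lemma irreducible_variety_imp_irreducible_on:
  assumes "irreducible_variety X"
  shows "irreducible_on entries X"
  unfolding irreducible_on_def vec_polynomial_def[symmetric]
proof (intro conjI allI impI)
  show "X \<noteq> {}" using assms unfolding irreducible_variety_def by blast
next
  fix f g :: "complex ^ 'a \<Rightarrow> complex"
  assume fg: "vec_polynomial f" "vec_polynomial g" "\<forall>v\<in>X. f v * g v = 0"
  have "X = (X \<inter> {x. f x = 0}) \<union> (X \<inter> {x. g x = 0})" using fg(3) by auto
  moreover have "zariski_closed (X \<inter> {x. f x = 0})" "zariski_closed (X \<inter> {x. g x = 0})"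
    using assms fg(1,2) unfolding irreducible_variety_def
    by (auto intro: zariski_closed_Int zariski_closed_zeros)
  ultimately have "X = X \<inter> {x. f x = 0} \<or> X = X \<inter> {x. g x = 0}"
    using assms unfolding irreducible_variety_def by blast
  then show "(\<forall>v\<in>X. f v = 0) \<or> (\<forall>v\<in>X. g v = 0)" by blast
qed

lemma zariski_closure_irreducible:
  assumes "irreducible_on entries S"
  shows "irreducible_variety (zariski_closure S)"
  unfolding irreducible_variety_def
proof (intro conjI allI impI)
  show "zariski_closed (zariski_closure S)" by (rule zariski_closed_closure)
  show "zariski_closure S \<noteq> {}"
    using assms zariski_closure_subset[of S] by (auto simp: irreducible_on_def)
next
  fix A B assume *: "zariski_closed A \<and> zariski_closed B \<and> zariski_closure S = A \<union> B"
  have outside: "\<exists>f. vec_polynomial f \<and> (\<forall>x\<in>C. f x = 0) \<and> (\<exists>x\<in>S. f x \<noteq> 0)"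
    if C: "zariski_closed C" "C \<subseteq> zariski_closure S" "C \<noteq> zariski_closure S" for C
  proof (rule ccontr)
    assume "\<not> ?thesis"
    then have "x \<in> C" if "x \<in> S" for x
      using that by (intro zariski_closed_memI[OF C(1)]) blast
    then have "S \<subseteq> C" by blast
    then show False using zariski_closure_minimal[OF C(1)] C(2,3) by blast
  qed
  show "zariski_closure S = A \<or> zariski_closure S = B"
  proof (rule ccontr)
    assume "\<not> ?thesis"
    \<comment> \<open>a point of \<open>S\<close> at which both \<open>f\<close> and \<open>g\<close> are nonzero lies neither in \<open>A\<close> nor in \<open>B\<close>\<close>
    then obtain f g where fg: "vec_polynomial f" "\<forall>x\<in>A. f x = 0" "\<exists>x\<in>S. f x \<noteq> 0"
      "vec_polynomial g" "\<forall>x\<in>B. g x = 0" "\<exists>x\<in>S. g x \<noteq> 0"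
      using outside[of A] outside[of B] * by blast
    then obtain x where "x \<in> S" "f x \<noteq> 0" "g x \<noteq> 0"
      using irreducible_on_both_nonzero[OF assms] unfolding vec_polynomial_def by blast
    then show False using fg * zariski_closure_subset[of S] by blast
  qed
qed

lemma irreducible_on_vec_nth:
  assumes "irreducible_on entries X"
  shows "irreducible_on (coords UNIV) (vec_nth ` X)"
  by (rule irreducible_on_image[OF assms]) (auto intro: polynomial_in.coord)

section \<open>Algebraic and Krull dimension\<close>

definition vec_independent :: "'n set \<Rightarrow> (complex ^ 'n) set \<Rightarrow> bool" where
  "vec_independent S X \<longleftrightarrow> alg_independent_on S (vec_nth ` X)"

text \<open>
  The transcendence degree of the function field, for irreducible \<open>X\<close>.
\<close>

definition alg_dim :: "(complex ^ 'n) set \<Rightarrow> nat" where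
  "alg_dim X = Max (card ` {S. vec_independent S X})"

lemma vec_independent_mono: "vec_independent S Z \<Longrightarrow> Z \<subseteq> Y \<Longrightarrow> vec_independent S Y"
  unfolding vec_independent_def alg_independent_on_def by blast

lemma vec_independent_empty:
  assumes "X \<noteq> {}" shows "vec_independent {} X"
  unfolding vec_independent_def alg_independent_on_def
proof (intro allI impI)
  fix f :: "('a \<Rightarrow> complex) \<Rightarrow> complex" and x
  assume f: "polynomial_in (coords {}) f" "\<forall>v\<in>vec_nth ` X. f v = 0"
  obtain v where "v \<in> X" using assms by blast
  then show "f x = 0" using f(2) polynomial_in_coords_cong[OF f(1), of x "vec_nth v"] by simp
qed

lemma card_le_alg_dim: "vec_independent S X \<Longrightarrow> card S \<le> alg_dim X"
  unfolding alg_dim_def by (intro Max_ge) auto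

lemma alg_dim_witness:
  assumes "X \<noteq> {}" obtains S where "vec_independent S X" "card S = alg_dim X"
proof -
  have "alg_dim X \<in> card ` {S. vec_independent S X}"
    unfolding alg_dim_def by (intro Max_in) (use vec_independent_empty[OF assms] in auto)
  then show ?thesis using that by auto
qed

lemma alg_dim_mono: "Z \<subseteq> Y \<Longrightarrow> Z \<noteq> {} \<Longrightarrow> alg_dim Z \<le> alg_dim Y"
  by (metis alg_dim_witness card_le_alg_dim vec_independent_mono)

lemma alg_dim_strict_mono:
  assumes "irreducible_variety Y" "irreducible_variety Z" "Z \<subset> Y"
  shows "alg_dim Z < alg_dim Y"
proof -
  have Z: "zariski_closed Z" "Z \<noteq> {}" using assms(2) unfolding irreducible_variety_def by auto
  obtain S where S: "vec_independent S Z" "card S = alg_dim Z" using alg_dim_witness[OF Z(2)] by blast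
  obtain y0 where y0: "y0 \<in> Y" "y0 \<notin> Z" using assms(3) by blast
  then obtain f where f: "vec_polynomial f" "\<And>z. z \<in> Z \<Longrightarrow> f z = 0" "f y0 \<noteq> 0"
    using zariski_closed_memI[OF Z(1)] by blast
  have "\<exists>k\<in>UNIV - S. alg_independent_on (insert k S) (vec_nth ` Y)"
  proof (rule alg_independent_on_proper_subset)
    show "irreducible_on (coords UNIV) (vec_nth ` Y)"
      by (intro irreducible_on_vec_nth irreducible_variety_imp_irreducible_on assms)
    show "polynomial_in (coords UNIV) (\<lambda>y. f (\<chi> i. y i))" by (rule vec_polynomial_as_coords[OF f(1)])
    show "vec_nth y0 \<in> vec_nth ` Y" using y0 by blast
    show "f (\<chi> i. y0 $ i) \<noteq> 0" using f(3) by simp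
    show "f (\<chi> i. z i) = 0" if "z \<in> vec_nth ` Z" for z using that f(2) by auto
    show "vec_nth ` Z \<subseteq> vec_nth ` Y" using assms(3) by blast
    show "alg_independent_on S (vec_nth ` Z)" using S(1) unfolding vec_independent_def .
  qed auto
  then obtain k where k: "k \<notin> S" "vec_independent (insert k S) Y"
    unfolding vec_independent_def by blast
  then show ?thesis using card_le_alg_dim[OF k(2)] S(2) by simp
qed

text \<open>
  The transcendence degree grows strictly along a chain of irreducible closed sets.
\<close>

lemma variety_dim_le_alg_dim:
  "variety_dim Y \<le> enat (alg_dim Y)"
  unfolding variety_dim_def
proof (intro Sup_least, elim CollectE exE conjE)
  fix x m Z
  assume x: "x = enat m" and Z: "\<forall>i\<le>m. irreducible_variety (Z i) \<and> Z i \<subseteq> Y" "\<forall>i<m. Z i \<subset> Z (Suc i)"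
  have "i \<le> m \<Longrightarrow> i \<le> alg_dim (Z i)" for i
  proof (induction i)
    case (Suc i)
    then have "alg_dim (Z i) < alg_dim (Z (Suc i))"
      using Z by (intro alg_dim_strict_mono) auto
    then show ?case using Suc by simp
  qed simp
  then have "m \<le> alg_dim (Z m)" by simp
  also have "\<dots> \<le> alg_dim Y"
    using Z by (intro alg_dim_mono) (auto simp: irreducible_variety_def)
  finally show "x \<le> enat (alg_dim Y)" by (simp add: x)
qed

definition tangent_space :: "(complex ^ 'n) set \<Rightarrow> complex ^ 'n \<Rightarrow> (complex ^ 'n) set" where
  "tangent_space X x = {w. \<forall>f. vec_polynomial f \<longrightarrow> (\<forall>y\<in>X. f y = 0) \<longrightarrow>
     ((\<lambda>t. f (x + t *s w)) has_field_derivative 0) (at 0)}"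

lemma tangent_vector_of_tangent_space:
  assumes "w \<in> tangent_space X x"
  shows "tangent_vector UNIV (vec_nth ` X) (vec_nth x) (vec_nth w)"
  unfolding tangent_vector_def
proof (intro allI impI)
  fix g assume g: "polynomial_in (coords UNIV) g" "\<forall>y\<in>vec_nth ` X. g y = 0"
  have "((\<lambda>t. g (vec_nth (x + t *s w))) has_field_derivative 0) (at 0)"
    using assms coords_as_vec_polynomial[OF g(1)] g(2) unfolding tangent_space_def by auto
  moreover have "vec_nth (x + t *s w) = (\<lambda>i. x $ i + t * w $ i)" for t by auto
  ultimately show "((\<lambda>t. g (\<lambda>i. x $ i + t * w $ i)) has_field_derivative 0) (at 0)" by simp
qed

lemma vec_generic_section:
  assumes irr: "irreducible_on entries X" and S: "vec_independent S X"
    and max: "\<And>k. k \<notin> S \<Longrightarrow> \<not> vec_independent (insert k S) X"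
  shows "\<exists>h. vec_polynomial h \<and> (\<exists>x\<in>X. h x \<noteq> 0) \<and> (\<forall>x\<in>X. h x \<noteq> 0 \<longrightarrow>
     (\<forall>w\<in>tangent_space X x. (\<forall>i\<in>S. w $ i = 0) \<longrightarrow> w = 0) \<and>
     (\<exists>\<epsilon> \<phi>. local_section S UNIV (vec_nth ` X) (vec_nth x) \<epsilon> \<phi>))"
proof -
  from generic_local_section[OF irreducible_on_vec_nth[OF irr] finite subset_UNIV, of S]
  obtain h where h: "polynomial_in (coords UNIV) h" "\<exists>v\<in>vec_nth ` X. h v \<noteq> 0"
    "\<forall>v\<in>vec_nth ` X. h v \<noteq> 0 \<longrightarrow>
     (\<forall>w. tangent_vector UNIV (vec_nth ` X) v w \<longrightarrow> (\<forall>i\<in>S. w i = 0) \<longrightarrow> (\<forall>i\<in>UNIV. w i = 0)) \<and>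
     (\<exists>\<epsilon> \<phi>. local_section S UNIV (vec_nth ` X) v \<epsilon> \<phi>)"
    using S max unfolding vec_independent_def by blast
  show ?thesis
  proof (intro exI[of _ "\<lambda>x. h (vec_nth x)"] conjI ballI impI)
    show "vec_polynomial (\<lambda>x. h (vec_nth x))" by (rule coords_as_vec_polynomial[OF h(1)])
    show "\<exists>x\<in>X. h (vec_nth x) \<noteq> 0" using h(2) by blast
  next
    fix x w assume "x \<in> X" "h (vec_nth x) \<noteq> 0" "w \<in> tangent_space X x" "\<forall>i\<in>S. w $ i = 0"
    then have "w $ i = 0" for i using h(3) tangent_vector_of_tangent_space by blast
    then show "w = 0" by (simp add: vec_eq_iff)
  next
    fix x assume "x \<in> X" "h (vec_nth x) \<noteq> 0"
    then show "\<exists>\<epsilon> \<phi>. local_section S UNIV (vec_nth ` X) (vec_nth x) \<epsilon> \<phi>" using h(3) by blast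
  qed
qed

lemma maximal_vec_independent:
  assumes "vec_independent S X" "card S = alg_dim X" "k \<notin> S"
  shows "\<not> vec_independent (insert k S) X"
proof
  assume "vec_independent (insert k S) X"
  from card_le_alg_dim[OF this] show False using assms by simp
qed

lemma connected_polydisc_line:
  assumes "finite S"
  shows "open {t. (\<lambda>i. s i + t * e i) \<in> polydisc S v \<epsilon>}" "connected {t. (\<lambda>i. s i + t * e i) \<in> polydisc S v \<epsilon>}"
proof -
  show "open {t. (\<lambda>i. s i + t * e i) \<in> polydisc S v \<epsilon>}"
  proof (subst open_subopen, intro ballI)
    fix t0 assume "t0 \<in> {t. (\<lambda>i. s i + t * e i) \<in> polydisc S v \<epsilon>}"
    then have "\<forall>\<^sub>F t in nhds t0. (\<lambda>i. s i + t * e i) \<in> polydisc S v \<epsilon>"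
      by (intro eventually_polydisc_line[OF assms]) simp
    then obtain T where "open T" "t0 \<in> T" "\<forall>t\<in>T. (\<lambda>i. s i + t * e i) \<in> polydisc S v \<epsilon>"
      unfolding eventually_nhds by blast
    then show "\<exists>T. open T \<and> t0 \<in> T \<and> T \<subseteq> {t. (\<lambda>i. s i + t * e i) \<in> polydisc S v \<epsilon>}"
      by (intro exI[of _ T]) auto
  qed
  have "convex {t. (\<lambda>i. s i + t * e i) \<in> polydisc S v \<epsilon>}"
    unfolding convex_def
  proof (intro ballI allI impI)
    fix a b :: complex and p q :: real
    assume ab: "a \<in> {t. (\<lambda>i. s i + t * e i) \<in> polydisc S v \<epsilon>}" "b \<in> {t. (\<lambda>i. s i + t * e i) \<in> polydisc S v \<epsilon>}"
      and pq: "0 \<le> p" "0 \<le> q" "p + q = 1"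
    have "dist (s i + (p *\<^sub>R a + q *\<^sub>R b) * e i) (v i) < \<epsilon>" if "i \<in> S" for i
    proof -
      have "s i + a * e i \<in> ball (v i) \<epsilon>" "s i + b * e i \<in> ball (v i) \<epsilon>"
        using ab that by (auto simp: polydisc_def dist_commute)
      then have "p *\<^sub>R (s i + a * e i) + q *\<^sub>R (s i + b * e i) \<in> ball (v i) \<epsilon>"
        using convex_ball[of "v i" \<epsilon>] pq unfolding convex_def by blast
      moreover have "p *\<^sub>R (s i + a * e i) + q *\<^sub>R (s i + b * e i) = s i + (p *\<^sub>R a + q *\<^sub>R b) * e i"
      proof -
        have "s i = (p + q) *\<^sub>R s i" using pq by simp
        then show ?thesis by (simp add: algebra_simps scaleR_conv_of_real)
      qed
      ultimately show ?thesis by (simp add: dist_commute)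
    qed
    then show "p *\<^sub>R a + q *\<^sub>R b \<in> {t. (\<lambda>i. s i + t * e i) \<in> polydisc S v \<epsilon>}"
      by (simp add: polydisc_def)
  qed
  then show "connected {t. (\<lambda>i. s i + t * e i) \<in> polydisc S v \<epsilon>}" by (rule convex_connected)
qed

lemma holomorphic_zero_product:
  assumes "open T" "connected T" "F holomorphic_on T" "G holomorphic_on T"
    "\<And>t. t \<in> T \<Longrightarrow> F t * G t = 0" "a \<in> T" "F a \<noteq> 0" "b \<in> T"
  shows "G b = 0"
proof -
  have "continuous_on T F" by (rule holomorphic_on_imp_continuous_on[OF assms(3)])
  then have "open (T \<inter> F -` (- {0}))" using assms(1) by (intro continuous_open_preimage) auto
  then show ?thesis
  proof (rule analytic_continuation_open[where f = G and g = "\<lambda>_. 0" and s' = T])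
    show "T \<inter> F -` (- {0}) \<noteq> {}" using assms(6,7) by blast
    show "G z = 0" if "z \<in> T \<inter> F -` (- {0})" for z using that assms(5)[of z] by simp
  qed (use assms in simp_all)
qed

text \<open>
  Letting \<open>B\<close> grow from the empty set to \<open>S\<close> produces the chain of subsets that bounds the Krull dimension
  from below.
\<close>

definition section_slice :: "'n set \<Rightarrow> (complex ^ 'n) \<Rightarrow> real \<Rightarrow> (('n \<Rightarrow> complex) \<Rightarrow> 'n \<Rightarrow> complex) \<Rightarrow>
    'n set \<Rightarrow> (complex ^ 'n) set" where
  "section_slice S x \<epsilon> \<phi> B = (\<lambda>s. \<chi> i. \<phi> s i) ` {s \<in> polydisc S (vec_nth x) \<epsilon>. \<forall>i\<in>S - B. s i = x $ i}"

text \<open>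
  Two points of a slice lie on a complex line within the slice. If polynomials \<open>f\<close> and \<open>g\<close> are nonzero at
  the first and at the second point respectively, then both are nonzero holomorphic functions on the
  connected part of that line in the polydisc, so their product is not zero.
\<close>

lemma irreducible_on_section_slice:
  assumes sec: "local_section S UNIV (vec_nth ` X) (vec_nth x) \<epsilon> \<phi>"
  shows "irreducible_on entries (section_slice S x \<epsilon> \<phi> B)"
  unfolding irreducible_on_def vec_polynomial_def[symmetric]
proof (intro conjI allI impI)
  have "\<epsilon> > 0" using sec unfolding local_section_def by blast
  then have "vec_nth x \<in> {s \<in> polydisc S (vec_nth x) \<epsilon>. \<forall>i\<in>S - B. s i = x $ i}" by (simp add: polydisc_def)
  then show "section_slice S x \<epsilon> \<phi> B \<noteq> {}" unfolding section_slice_def by blast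
next
  fix f g :: "complex ^ 'a \<Rightarrow> complex"
  assume fg: "vec_polynomial f" "vec_polynomial g" "\<forall>v\<in>section_slice S x \<epsilon> \<phi> B. f v * g v = 0"
  let ?\<Phi> = "\<lambda>s. \<chi> i. \<phi> s i"
  let ?D = "{s \<in> polydisc S (vec_nth x) \<epsilon>. \<forall>i\<in>S - B. s i = x $ i}"
  show "(\<forall>v\<in>section_slice S x \<epsilon> \<phi> B. f v = 0) \<or> (\<forall>v\<in>section_slice S x \<epsilon> \<phi> B. g v = 0)"
  proof (rule ccontr)
    assume "\<not> ?thesis"
    then obtain s1 s2 where s: "s1 \<in> ?D" "s2 \<in> ?D" "f (?\<Phi> s1) \<noteq> 0" "g (?\<Phi> s2) \<noteq> 0"
      unfolding section_slice_def by blast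
    define e where "e = (\<lambda>i. s2 i - s1 i)"
    let ?y = "\<lambda>t i. s1 i + t * e i"
    let ?T = "{t. ?y t \<in> polydisc S (vec_nth x) \<epsilon>}"
    have hol: "(\<lambda>t. p (?\<Phi> (?y t))) holomorphic_on ?T" if "vec_polynomial p" for p
      unfolding holomorphic_on_def
    proof
      fix t assume t: "t \<in> ?T"
      have "(\<lambda>t. p (\<chi> i. \<phi> (?y t) i)) field_differentiable at t"
        by (rule polynomial_in_field_differentiable[OF vec_polynomial_as_coords[OF that], of "\<lambda>t. \<phi> (?y t)"])
           (use sec t in \<open>auto simp: local_section_def\<close>)
      then show "(\<lambda>t. p (?\<Phi> (?y t))) field_differentiable (at t within ?T)"
        by (rule field_differentiable_at_within)
    qed
    have y01: "?y 0 = s1" "?y 1 = s2" by (auto simp: e_def)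
    have "g (?\<Phi> (?y 1)) = 0"
    proof (rule holomorphic_zero_product[of ?T "\<lambda>t. f (?\<Phi> (?y t))" "\<lambda>t. g (?\<Phi> (?y t))" 0 1])
      show "open ?T" "connected ?T" by (rule connected_polydisc_line; simp)+
      show "f (?\<Phi> (?y t)) * g (?\<Phi> (?y t)) = 0" if t: "t \<in> ?T" for t
      proof -
        have "?y t \<in> ?D" using t s(1,2) by (auto simp: e_def)
        then show ?thesis using fg(3) unfolding section_slice_def by blast
      qed
    qed (use s y01 hol fg in auto)
    then show False using s(4) y01 by simp
  qed
qed

text \<open>
  Enumerate \<open>S\<close> and free its elements one after another: the closures of the corresponding slices of a local
  section are irreducible, and each is contained in a hyperplane \<open>x\<^sub>j = const\<close> that does not contain the next
  one.
\<close>

lemma alg_dim_le_variety_dim: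
  assumes X: "irreducible_variety X"
  shows "enat (alg_dim X) \<le> variety_dim X"
proof -
  have irr: "irreducible_on entries X" by (rule irreducible_variety_imp_irreducible_on[OF X])
  have closed: "zariski_closed X" "X \<noteq> {}" using X unfolding irreducible_variety_def by auto
  obtain S where S: "vec_independent S X" "card S = alg_dim X" using alg_dim_witness[OF closed(2)] by blast
  obtain x \<epsilon> \<phi> where x: "x \<in> X" and sec: "local_section S UNIV (vec_nth ` X) (vec_nth x) \<epsilon> \<phi>"
    using vec_generic_section[OF irr S(1) maximal_vec_independent[OF S]] by blast
  have \<epsilon>: "\<epsilon> > 0" using sec unfolding local_section_def by blast
  obtain b where b: "bij_betw b {0..<card S} S" using ex_bij_betw_nat_finite[of S] by auto
  define Z where "Z = (\<lambda>m. zariski_closure (section_slice S x \<epsilon> \<phi> (b ` {0..<m})))"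
  have "section_slice S x \<epsilon> \<phi> B \<subseteq> X" for B
  proof
    fix y assume "y \<in> section_slice S x \<epsilon> \<phi> B"
    then obtain s where s: "s \<in> polydisc S (vec_nth x) \<epsilon>" "y = (\<chi> i. \<phi> s i)"
      unfolding section_slice_def by blast
    show "y \<in> X"
    proof (rule zariski_closed_memI[OF closed(1)])
      fix f assume f: "vec_polynomial f" "\<And>y. y \<in> X \<Longrightarrow> f y = 0"
      have "\<forall>g. polynomial_in (coords UNIV) g \<longrightarrow> (\<forall>x\<in>vec_nth ` X. g x = 0) \<longrightarrow> g (\<phi> s) = 0"
        using sec s(1) unfolding local_section_def by blast
      moreover have "\<forall>x\<in>vec_nth ` X. f (\<chi> i. x i) = 0" using f(2) by auto
      ultimately show "f y = 0" using vec_polynomial_as_coords[OF f(1)] s(2) by blast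
    qed
  qed
  then have ZX: "Z i \<subseteq> X" for i unfolding Z_def by (intro zariski_closure_minimal closed)
  have Zirr: "irreducible_variety (Z i)" for i
    unfolding Z_def by (intro zariski_closure_irreducible irreducible_on_section_slice[OF sec])
  have Zstrict: "Z i \<subset> Z (Suc i)" if i: "i < card S" for i
  proof
    show "Z i \<subseteq> Z (Suc i)"
      unfolding Z_def section_slice_def by (intro zariski_closure_mono image_mono) auto
    have inj: "inj_on b {0..<card S}" and "b ` {0..<card S} = S" using b by (auto simp: bij_betw_def)
    then have bi: "b i \<in> S" "b i \<notin> b ` {0..<i}"
      using i inj_on_image_mem_iff[OF inj, of i "{0..<i}"] by auto
    let ?f = "\<lambda>y. y $ b i - x $ b i"
    have "vec_polynomial ?f"
      unfolding vec_polynomial_def by (intro polynomial_in_diff polynomial_in.const polynomial_in.coord rangeI)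
    moreover have "?f y = 0" if "y \<in> section_slice S x \<epsilon> \<phi> (b ` {0..<i})" for y
      using that bi sec unfolding section_slice_def local_section_def by auto
    ultimately have van: "?f y = 0" if "y \<in> Z i" for y
      using zariski_closure_vanish that unfolding Z_def by blast
    define s where "s = (vec_nth x)(b i := x $ b i + of_real (\<epsilon> / 2))"
    have s: "s \<in> polydisc S (vec_nth x) \<epsilon>" using \<epsilon> by (auto simp: s_def polydisc_def dist_norm)
    moreover have "\<forall>j\<in>S - b ` {0..<Suc i}. s j = x $ j" by (auto simp: s_def)
    ultimately have "(\<chi> j. \<phi> s j) \<in> Z (Suc i)"
      unfolding Z_def section_slice_def by (intro subsetD[OF zariski_closure_subset]) blast
    moreover have "\<phi> s (b i) = s (b i)" using sec s bi unfolding local_section_def by blast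
    then have "?f (\<chi> j. \<phi> s j) \<noteq> 0" using \<epsilon> by (simp add: s_def)
    ultimately show "Z i \<noteq> Z (Suc i)" using van by blast
  qed
  show ?thesis
    unfolding variety_dim_def S(2)[symmetric]
    by (intro Sup_upper CollectI exI[of _ "card S"] conjI refl exI[of _ Z] allI impI) (auto simp: ZX Zirr Zstrict)
qed

section \<open>Tangent spaces are linear\<close>

lemma vec_polynomial_differential:
  assumes "vec_polynomial f"
  shows "\<exists>L. \<forall>w. ((\<lambda>t. f (x + t *s w)) has_field_derivative (\<Sum>i\<in>UNIV. L i * w $ i)) (at 0)"
  using assms unfolding vec_polynomial_def
proof (induction)
  case (const c)
  show ?case by (rule exI[of _ "\<lambda>_. 0"]) simp
next
  case (coord f)
  then obtain j where "f = (\<lambda>x. x $ j)" by blast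
  then show ?case
    by (intro exI[of _ "\<lambda>i. if i = j then 1 else 0"])
       (auto intro!: derivative_eq_intros simp: if_distrib[of "\<lambda>c. c * _"] cong: if_cong)
next
  case (add f g)
  then obtain L M where "\<And>w. ((\<lambda>t. f (x + t *s w)) has_field_derivative (\<Sum>i\<in>UNIV. L i * w $ i)) (at 0)"
    "\<And>w. ((\<lambda>t. g (x + t *s w)) has_field_derivative (\<Sum>i\<in>UNIV. M i * w $ i)) (at 0)" by blast
  then have "((\<lambda>t. f (x + t *s w) + g (x + t *s w)) has_field_derivative (\<Sum>i\<in>UNIV. (L i + M i) * w $ i)) (at 0)" for w
    unfolding distrib_right sum.distrib by (rule DERIV_add)
  then show ?case by (intro exI[of _ "\<lambda>i. L i + M i"]) blast
next
  case (mult f g)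
  then obtain L M where LM: "\<And>w. ((\<lambda>t. f (x + t *s w)) has_field_derivative (\<Sum>i\<in>UNIV. L i * w $ i)) (at 0)"
    "\<And>w. ((\<lambda>t. g (x + t *s w)) has_field_derivative (\<Sum>i\<in>UNIV. M i * w $ i)) (at 0)" by blast
  have "((\<lambda>t. f (x + t *s w) * g (x + t *s w)) has_field_derivative (\<Sum>i\<in>UNIV. (L i * g x + M i * f x) * w $ i)) (at 0)" for w
  proof -
    have "(\<Sum>i\<in>UNIV. (L i * g x + M i * f x) * w $ i) = (\<Sum>i\<in>UNIV. L i * w $ i) * g (x + 0 *s w) + (\<Sum>i\<in>UNIV. M i * w $ i) * f (x + 0 *s w)"
      unfolding sum_distrib_right sum.distrib[symmetric] by (intro sum.cong refl) (simp add: algebra_simps)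
    then show ?thesis using DERIV_mult[OF LM(1)[of w] LM(2)[of w]] by simp
  qed
  then show ?case by (intro exI[of _ "\<lambda>i. L i * g x + M i * f x"]) blast
qed

lemma tangent_space_iff_differential:
  assumes "vec_polynomial f" "\<And>w. ((\<lambda>t. f (x + t *s w)) has_field_derivative (\<Sum>i\<in>UNIV. L i * w $ i)) (at 0)"
  shows "((\<lambda>t. f (x + t *s w)) has_field_derivative 0) (at 0) \<longleftrightarrow> (\<Sum>i\<in>UNIV. L i * w $ i) = 0"
  using assms(2)[of w] DERIV_unique by fastforce

lemma subspace_tangent_space: "vec.subspace (tangent_space X x)"
  unfolding vec.subspace_def
proof (intro conjI ballI allI)
  show "0 \<in> tangent_space X x" unfolding tangent_space_def by auto
next
  fix u w assume uw: "u \<in> tangent_space X x" "w \<in> tangent_space X x"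
  show "u + w \<in> tangent_space X x"
    unfolding tangent_space_def
  proof (intro CollectI allI impI)
    fix f assume f: "vec_polynomial f" "\<forall>y\<in>X. f y = 0"
    obtain L where L: "\<And>w. ((\<lambda>t. f (x + t *s w)) has_field_derivative (\<Sum>i\<in>UNIV. L i * w $ i)) (at 0)"
      using vec_polynomial_differential[OF f(1), of x] by blast
    note iff = tangent_space_iff_differential[OF f(1) L]
    have "(\<Sum>i\<in>UNIV. L i * u $ i) = 0" "(\<Sum>i\<in>UNIV. L i * w $ i) = 0"
      using uw f unfolding tangent_space_def iff[symmetric] by blast+
    then show "((\<lambda>t. f (x + t *s (u + w))) has_field_derivative 0) (at 0)"
      unfolding iff by (simp add: distrib_left sum.distrib)
  qed
next
  fix c w assume w: "w \<in> tangent_space X x"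
  show "c *s w \<in> tangent_space X x"
    unfolding tangent_space_def
  proof (intro CollectI allI impI)
    fix f assume f: "vec_polynomial f" "\<forall>y\<in>X. f y = 0"
    obtain L where L: "\<And>w. ((\<lambda>t. f (x + t *s w)) has_field_derivative (\<Sum>i\<in>UNIV. L i * w $ i)) (at 0)"
      using vec_polynomial_differential[OF f(1), of x] by blast
    note iff = tangent_space_iff_differential[OF f(1) L]
    have "(\<Sum>i\<in>UNIV. L i * w $ i) = 0"
      using w f unfolding tangent_space_def iff[symmetric] by blast
    then show "((\<lambda>t. f (x + t *s (c *s w))) has_field_derivative 0) (at 0)"
      unfolding iff by (simp add: mult.left_commute[of _ c] sum_distrib_left[symmetric])
  qed
qed

section \<open>Tuples of points\<close>

definition tuples :: "nat \<Rightarrow> 'a set \<Rightarrow> (nat \<Rightarrow> 'a) set" where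
  "tuples m X = {q. \<forall>k<m. q k \<in> X}"

definition tuple_entries :: "nat \<Rightarrow> ((nat \<Rightarrow> complex ^ 'n) \<Rightarrow> complex) set" where
  "tuple_entries m = {\<lambda>q. q k $ i |k i. k < m}"

definition sums_of :: "nat \<Rightarrow> (complex ^ 'n) set \<Rightarrow> (complex ^ 'n) set" where
  "sums_of m X = (\<lambda>q. \<Sum>k<m. q k) ` tuples m X"

lemma tuple_entries_coord: "k < m \<Longrightarrow> polynomial_in (tuple_entries m) (\<lambda>q. q k $ i)"
  by (rule polynomial_in.coord) (auto simp: tuple_entries_def)

lemma secant_variety_eq: "secant_variety r X = zariski_closure (sums_of r X)"
  unfolding secant_variety_def sums_of_def tuples_def
  by (rule arg_cong[where f = zariski_closure]) blast

text \<open>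
  If \<open>f\<close> is nonzero at \<open>q1\<close> and \<open>g\<close> at \<open>q2\<close>, freeze the last
  entry at that of \<open>q1\<close> in \<open>f\<close> and at that of \<open>q2\<close> in \<open>g\<close>. By induction some choice \<open>p\<close> of the first \<open>m\<close>
  entries keeps both nonzero; with the first entries fixed to \<open>p\<close>, irreducibility of \<open>X\<close> provides a common last
  entry.
\<close>

lemma irreducible_on_tuples:
  assumes irr: "irreducible_on entries X"
  shows "irreducible_on (tuple_entries m) (tuples m X)"
proof (induction m)
  case 0
  have const: "f x = f y" if "polynomial_in (tuple_entries 0) f" for f :: "(nat \<Rightarrow> complex ^ 'a) \<Rightarrow> complex" and x y
    by (rule polynomial_in_cong[OF that]) (auto simp: tuple_entries_def)
  have univ: "tuples 0 X = UNIV" by (simp add: tuples_def)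
  show ?case
    unfolding irreducible_on_def univ
  proof (intro conjI allI impI)
    fix f g :: "(nat \<Rightarrow> complex ^ 'a) \<Rightarrow> complex"
    assume fg: "polynomial_in (tuple_entries 0) f" "polynomial_in (tuple_entries 0) g" "\<forall>v\<in>UNIV. f v * g v = 0"
    have "f undefined = 0 \<or> g undefined = 0" using fg(3) by (simp only: mult_eq_0_iff ball_UNIV)
    then show "(\<forall>v\<in>UNIV. f v = 0) \<or> (\<forall>v\<in>UNIV. g v = 0)"
      using const[OF fg(1)] const[OF fg(2)] by metis
  qed simp
next
  case (Suc m)
  show ?case
    unfolding irreducible_on_def
  proof (intro conjI allI impI)
    show "tuples (Suc m) X \<noteq> {}"
      using irr unfolding irreducible_on_def tuples_def by fastforce
    fix f g :: "(nat \<Rightarrow> complex ^ 'a) \<Rightarrow> complex"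
    assume fg: "polynomial_in (tuple_entries (Suc m)) f" "polynomial_in (tuple_entries (Suc m)) g"
      "\<forall>q\<in>tuples (Suc m) X. f q * g q = 0"
    have first: "polynomial_in (tuple_entries m) (\<lambda>q. h (q(m := x)))"
      if "polynomial_in (tuple_entries (Suc m)) h" for h and x :: "complex ^ 'a"
    proof (rule polynomial_in_subst[OF that])
      fix c :: "(nat \<Rightarrow> complex ^ 'a) \<Rightarrow> complex" assume "c \<in> tuple_entries (Suc m)"
      then obtain k i where "k < Suc m" "c = (\<lambda>q. q k $ i)" unfolding tuple_entries_def by blast
      then show "polynomial_in (tuple_entries m) (\<lambda>q. c (q(m := x)))"
        by (cases "k = m") (auto intro: polynomial_in.const tuple_entries_coord)
    qed
    have last: "polynomial_in entries (\<lambda>x. h (q(m := x)))"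
      if "polynomial_in (tuple_entries (Suc m)) h" for h and q :: "nat \<Rightarrow> complex ^ 'a"
      by (rule polynomial_in_subst[OF that])
         (auto simp: tuple_entries_def less_Suc_eq intro: polynomial_in.const polynomial_in.coord)
    show "(\<forall>q\<in>tuples (Suc m) X. f q = 0) \<or> (\<forall>q\<in>tuples (Suc m) X. g q = 0)"
    proof (rule ccontr)
      assume "\<not> ?thesis"
      then obtain q1 q2 where q: "q1 \<in> tuples (Suc m) X" "f q1 \<noteq> 0" "q2 \<in> tuples (Suc m) X" "g q2 \<noteq> 0" by blast
      have sub: "q1 \<in> tuples m X" "q2 \<in> tuples m X" "q1 m \<in> X" "q2 m \<in> X"
        using q(1,3) by (auto simp: tuples_def)
      have "\<exists>q\<in>tuples m X. f (q(m := q1 m)) \<noteq> 0 \<and> g (q(m := q2 m)) \<noteq> 0"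
        using q(2,4) sub by (intro irreducible_on_both_nonzero[OF Suc.IH first[OF fg(1)] first[OF fg(2)]]) force+
      then obtain p where p: "p \<in> tuples m X" "f (p(m := q1 m)) \<noteq> 0" "g (p(m := q2 m)) \<noteq> 0" by blast
      have "\<exists>x\<in>X. f (p(m := x)) \<noteq> 0 \<and> g (p(m := x)) \<noteq> 0"
        using p(2,3) sub by (intro irreducible_on_both_nonzero[OF irr last[OF fg(1)] last[OF fg(2)]]) blast+
      then obtain x where x: "x \<in> X" "f (p(m := x)) \<noteq> 0" "g (p(m := x)) \<noteq> 0" by blast
      have "p(m := x) \<in> tuples (Suc m) X" using p(1) x(1) by (auto simp: tuples_def less_Suc_eq)
      then show False using fg(3) x by auto
    qed
  qed
qed

lemma polynomial_in_tuple_sum: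
  assumes "vec_polynomial f"
  shows "polynomial_in (tuple_entries m) (\<lambda>q. f (\<Sum>k<m. q k))"
  using assms unfolding vec_polynomial_def
  by (rule polynomial_in_subst) (auto simp: sum_component intro!: polynomial_in_sum tuple_entries_coord)

lemma irreducible_on_sums_of:
  assumes "irreducible_on entries X"
  shows "irreducible_on entries (sums_of m X)"
  unfolding sums_of_def
  by (rule irreducible_on_image[OF irreducible_on_tuples[OF assms]])
     (auto simp: sum_component intro!: polynomial_in_sum tuple_entries_coord)

text \<open>
  The coordinates of a tuple together with those of its sum, in block \<open>m\<close> (later blocks repeat the sum).
  In this way coordinates of the sum become honest coordinates on the set of tuples, and can be part of a maximal independent set.
\<close>

definition tuple_with_sum :: "nat \<Rightarrow> (nat \<Rightarrow> complex ^ 'n) \<Rightarrow> nat \<times> 'n \<Rightarrow> complex" where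
  "tuple_with_sum m q = (\<lambda>(k, i). (if k < m then q k else \<Sum>l<m. q l) $ i)"

lemma alg_independent_on_tuple_with_sum:
  assumes "vec_independent S (sums_of m X)"
  shows "alg_independent_on ({m} \<times> S) (tuple_with_sum m ` tuples m X)"
  unfolding alg_independent_on_def
proof (intro allI impI)
  fix Q x assume Q: "polynomial_in (coords ({m} \<times> S)) Q" "\<forall>v\<in>tuple_with_sum m ` tuples m X. Q v = 0"
  define g where "g = (\<lambda>y. Q (\<lambda>(k, i). y i))"
  have cong: "Q y = Q z" if "\<And>i. i \<in> S \<Longrightarrow> y (m, i) = z (m, i)" for y z
    by (rule polynomial_in_coords_cong[OF Q(1)]) (use that in auto)
  have "polynomial_in (coords S) g"
    unfolding g_def by (rule polynomial_in_subst[OF Q(1)]) (auto intro: polynomial_in_coords_coord)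
  moreover have "g y = 0" if y: "y \<in> vec_nth ` sums_of m X" for y
  proof -
    obtain q where q: "q \<in> tuples m X" "y = vec_nth (\<Sum>k<m. q k)" using y unfolding sums_of_def by blast
    have "g y = Q (tuple_with_sum m q)"
      unfolding g_def by (rule cong) (simp add: tuple_with_sum_def q(2))
    also have "\<dots> = 0" using Q(2) q(1) by blast
    finally show ?thesis .
  qed
  ultimately have "g (\<lambda>i. x (m, i)) = 0"
    using assms unfolding vec_independent_def alg_independent_on_def by blast
  then show "Q x = 0" unfolding g_def using cong[of x "\<lambda>(k, i). x (m, i)"] by simp
qed

text \<open>
  Coordinates that are independent on the sums are independent on the set of tuples enlarged by their sums, so
  generic tangent vectors there have arbitrary values at them. The blocks of such a tangent vector are
  tangent vectors of \<open>X\<close> at the entries of the tuple, and the block of the sum is their sum. This is where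
  generic smoothness of the addition map enters.
\<close>

theorem tangent_sum_prescribed:
  assumes irr: "irreducible_on entries X" and S: "vec_independent S (sums_of m X)"
  shows "\<exists>H. polynomial_in (tuple_entries m) H \<and> (\<exists>q\<in>tuples m X. H q \<noteq> 0) \<and>
    (\<forall>q\<in>tuples m X. H q \<noteq> 0 \<longrightarrow> (\<forall>a. \<exists>w. (\<forall>k<m. w k \<in> tangent_space X (q k)) \<and>
       (\<forall>i\<in>S. (\<Sum>k<m. w k) $ i = a i)))"
proof -
  let ?P = "tuple_with_sum m" and ?I = "{..m} \<times> (UNIV :: 'a set)"
  let ?V = "?P ` tuples m X"
  have pull: "polynomial_in (tuple_entries m) (\<lambda>q. c (?P q))" if "c \<in> coords ?I" for c
  proof -
    obtain k i where ki: "k \<le> m" "c = (\<lambda>x. x (k, i))" using \<open>c \<in> coords ?I\<close> by auto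
    then show ?thesis
      by (cases "k < m") (auto simp: tuple_with_sum_def sum_component intro!: polynomial_in_sum tuple_entries_coord)
  qed
  have irrV: "irreducible_on (coords ?I) ?V"
    by (rule irreducible_on_image[OF irreducible_on_tuples[OF irr] pull])
  have fin: "finite ?I" by simp
  have "{m} \<times> S \<subseteq> ?I" by auto
  from maximal_alg_independent[OF fin this alg_independent_on_tuple_with_sum[OF S]]
  obtain T where T: "{m} \<times> S \<subseteq> T" "T \<subseteq> ?I" "alg_independent_on T ?V"
    "\<And>k. k \<in> ?I - T \<Longrightarrow> \<not> alg_independent_on (insert k T) ?V"
    by blast
  have finT: "finite T" using T(2) fin finite_subset by blast
  from generic_local_section[OF irrV fin T(2,3,4)] obtain h where
    h: "polynomial_in (coords ?I) h" "\<exists>v\<in>?V. h v \<noteq> 0"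
    "\<And>v. v \<in> ?V \<Longrightarrow> h v \<noteq> 0 \<Longrightarrow> \<exists>\<epsilon> \<phi>. local_section T ?I ?V v \<epsilon> \<phi>" by blast
  have "\<exists>w. (\<forall>k<m. w k \<in> tangent_space X (q k)) \<and> (\<forall>i\<in>S. (\<Sum>k<m. w k) $ i = a i)"
    if q: "q \<in> tuples m X" "h (?P q) \<noteq> 0" for q a
  proof -
    obtain \<epsilon> \<phi> where "local_section T ?I ?V (?P q) \<epsilon> \<phi>" using h(3) q by blast
    from tangent_vector_prescribed[OF this T(2) finT, of "\<lambda>(k, i). a i"] obtain w where
      w: "tangent_vector ?I ?V (?P q) w" "\<forall>b\<in>T. w b = (\<lambda>(k, i). a i) b" by blast
    have der: "((\<lambda>t. G (\<lambda>b. ?P q b + t * w b)) has_field_derivative 0) (at 0)"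
      if "polynomial_in (coords ?I) G" "\<And>p. p \<in> tuples m X \<Longrightarrow> G (?P p) = 0" for G
      using w(1) that unfolding tangent_vector_def by blast
    define u where "u = (\<lambda>k. \<chi> i. w (k, i))"
    have "u k \<in> tangent_space X (q k)" if k: "k < m" for k
      unfolding tangent_space_def
    proof (intro CollectI allI impI)
      fix f assume f: "vec_polynomial f" "\<forall>y\<in>X. f y = 0"
      have "polynomial_in (coords ?I) (\<lambda>x. f (\<chi> i. x (k, i)))"
        using f(1) unfolding vec_polynomial_def
        by (rule polynomial_in_subst) (use k in \<open>auto intro!: polynomial_in.coord\<close>)
      moreover have "f (\<chi> i. ?P p (k, i)) = 0" if "p \<in> tuples m X" for p
        using f(2) k that by (simp add: tuple_with_sum_def tuples_def)
      ultimately have "((\<lambda>t. f (\<chi> i. ?P q (k, i) + t * w (k, i))) has_field_derivative 0) (at 0)"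
        using der by blast
      moreover have "(\<chi> i. ?P q (k, i) + t * w (k, i)) = q k + t *s u k" for t
        using k by (simp add: vec_eq_iff u_def tuple_with_sum_def)
      ultimately show "((\<lambda>t. f (q k + t *s u k)) has_field_derivative 0) (at 0)" by simp
    qed
    moreover have "(\<Sum>k<m. u k) $ i = a i" if i: "i \<in> S" for i
    proof -
      let ?G = "\<lambda>x. x (m, i) - (\<Sum>k<m. x (k, i))"
      have "polynomial_in (coords ?I) ?G"
        by (intro polynomial_in_diff polynomial_in_sum polynomial_in_coords_coord) auto
      moreover have "?G (?P p) = 0" for p by (simp add: tuple_with_sum_def sum_component)
      ultimately have "((\<lambda>t. ?G (\<lambda>b. ?P q b + t * w b)) has_field_derivative 0) (at 0)"
        using der by blast
      moreover have "?G (\<lambda>b. ?P q b + t * w b) = t * (w (m, i) - (\<Sum>k<m. w (k, i)))" for t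
        by (simp add: tuple_with_sum_def sum_component sum.distrib sum_distrib_left[symmetric] algebra_simps)
      moreover have "((\<lambda>t. t * (w (m, i) - (\<Sum>k<m. w (k, i)))) has_field_derivative (w (m, i) - (\<Sum>k<m. w (k, i)))) (at 0)"
        by (auto intro!: derivative_eq_intros)
      ultimately have "w (m, i) - (\<Sum>k<m. w (k, i)) = 0" using DERIV_unique by fastforce
      moreover have "w (m, i) = a i" using w(2) T(1) i by force
      ultimately show ?thesis by (simp add: u_def sum_component)
    qed
    ultimately show ?thesis by blast
  qed
  moreover have "polynomial_in (tuple_entries m) (\<lambda>q. h (?P q))" by (rule polynomial_in_subst[OF h(1) pull])
  moreover have "\<exists>q\<in>tuples m X. h (?P q) \<noteq> 0" using h(2) by blast
  ultimately show ?thesis by blast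
qed

text \<open>
  Moving one summand within \<open>X\<close> stays within the sums, so each \<open>T\<^bsub>q k\<^esub> X\<close> lies in the tangent space at the
  sum, and the latter is a linear space.
\<close>

lemma tangent_space_sum_subset:
  assumes q: "q \<in> tuples m X" and w: "\<And>k. k < m \<Longrightarrow> w k \<in> tangent_space X (q k)"
  shows "(\<Sum>k<m. w k) \<in> tangent_space (sums_of m X) (\<Sum>k<m. q k)"
proof (rule vec.subspace_sum[OF subspace_tangent_space])
  fix k assume "k \<in> {..<m}"
  then have k: "k < m" by simp
  show "w k \<in> tangent_space (sums_of m X) (\<Sum>k<m. q k)"
    unfolding tangent_space_def
  proof (intro CollectI allI impI)
    fix f assume f: "vec_polynomial f" "\<forall>y\<in>sums_of m X. f y = 0"
    define c where "c = (\<Sum>l\<in>{..<m} - {k}. q l)"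
    have split: "(\<Sum>l<m. p l) = p k + (\<Sum>l\<in>{..<m} - {k}. p l)" for p :: "nat \<Rightarrow> complex ^ 'a"
      using k by (simp add: sum.remove)
    have "vec_polynomial (\<lambda>x. f (x + c))"
      using f(1) unfolding vec_polynomial_def
      by (rule polynomial_in_subst)
        (auto intro!: polynomial_in.add polynomial_in.const intro: polynomial_in.coord[OF rangeI])
    moreover have "f (y + c) = 0" if y: "y \<in> X" for y
    proof -
      have "(\<Sum>l<m. (q(k := y)) l) = y + c"
        unfolding split[of "q(k := y)"] c_def by simp
      moreover have "q(k := y) \<in> tuples m X" using q y by (auto simp: tuples_def)
      ultimately have "y + c \<in> sums_of m X" unfolding sums_of_def by (metis imageI)
      then show ?thesis using f(2) by blast
    qed
    ultimately have "((\<lambda>t. f (q k + t *s w k + c)) has_field_derivative 0) (at 0)"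
      using w[OF k] unfolding tangent_space_def by blast
    moreover have "q k + t *s w k + c = (\<Sum>l<m. q l) + t *s w k" for t
      unfolding split[of q] c_def by (simp add: algebra_simps)
    ultimately show "((\<lambda>t. f ((\<Sum>k<m. q k) + t *s w k)) has_field_derivative 0) (at 0)" by simp
  qed
qed

text \<open>
  With \<open>S\<close> a maximal set of coordinates independent on the sums, a tangent vector \<open>u\<close> at a generic sum is
  determined by its coordinates in \<open>S\<close>. By \<open>tangent_sum_prescribed\<close> some element of the sum of the tangent
  spaces has the same coordinates, and it is tangent at the sum as well, so it equals \<open>u\<close>.
\<close>

theorem terracini:
  assumes irr: "irreducible_on entries X"
  shows "\<exists>H. polynomial_in (tuple_entries m) H \<and> (\<exists>q\<in>tuples m X. H q \<noteq> 0) \<and>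
    (\<forall>q\<in>tuples m X. H q \<noteq> 0 \<longrightarrow> (\<forall>u\<in>tangent_space (sums_of m X) (\<Sum>k<m. q k).
       \<exists>w. (\<forall>k<m. w k \<in> tangent_space X (q k)) \<and> u = (\<Sum>k<m. w k)))"
proof -
  have irrY: "irreducible_on entries (sums_of m X)" by (rule irreducible_on_sums_of[OF irr])
  have "sums_of m X \<noteq> {}" using irrY by (auto simp: irreducible_on_def)
  then obtain S where S: "vec_independent S (sums_of m X)" "card S = alg_dim (sums_of m X)"
    using alg_dim_witness by blast
  obtain h where h: "vec_polynomial h" "\<exists>y\<in>sums_of m X. h y \<noteq> 0"
    "\<And>y w. y \<in> sums_of m X \<Longrightarrow> h y \<noteq> 0 \<Longrightarrow> w \<in> tangent_space (sums_of m X) y \<Longrightarrow> \<forall>i\<in>S. w $ i = 0 \<Longrightarrow> w = 0"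
    using vec_generic_section[OF irrY S(1) maximal_vec_independent[OF S]] by blast
  obtain H where H: "polynomial_in (tuple_entries m) H" "\<exists>q\<in>tuples m X. H q \<noteq> 0"
    "\<And>q a. q \<in> tuples m X \<Longrightarrow> H q \<noteq> 0 \<Longrightarrow> \<exists>w. (\<forall>k<m. w k \<in> tangent_space X (q k)) \<and>
       (\<forall>i\<in>S. (\<Sum>k<m. w k) $ i = a i)"
    using tangent_sum_prescribed[OF irr S(1)] by blast
  show ?thesis
  proof (intro exI[of _ "\<lambda>q. h (\<Sum>k<m. q k) * H q"] conjI ballI impI)
    show "polynomial_in (tuple_entries m) (\<lambda>q. h (\<Sum>k<m. q k) * H q)"
      by (intro polynomial_in.mult polynomial_in_tuple_sum h H)
    have "\<exists>q\<in>tuples m X. h (\<Sum>k<m. q k) \<noteq> 0" using h(2) unfolding sums_of_def by blast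
    from irreducible_on_both_nonzero[OF irreducible_on_tuples[OF irr] polynomial_in_tuple_sum[OF h(1)] H(1) this H(2)]
    show "\<exists>q\<in>tuples m X. h (\<Sum>k<m. q k) * H q \<noteq> 0" by auto
  next
    fix q u assume q: "q \<in> tuples m X" "h (\<Sum>k<m. q k) * H q \<noteq> 0"
      and u: "u \<in> tangent_space (sums_of m X) (\<Sum>k<m. q k)"
    obtain w where w: "\<And>k. k < m \<Longrightarrow> w k \<in> tangent_space X (q k)" "\<forall>i\<in>S. (\<Sum>k<m. w k) $ i = u $ i"
      using H(3)[OF q(1), of "vec_nth u"] q(2) by auto
    have "u - (\<Sum>k<m. w k) = 0"
    proof (rule h(3))
      show "(\<Sum>k<m. q k) \<in> sums_of m X" using q(1) unfolding sums_of_def by blast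
      show "u - (\<Sum>k<m. w k) \<in> tangent_space (sums_of m X) (\<Sum>k<m. q k)"
        by (intro vec.subspace_diff subspace_tangent_space u tangent_space_sum_subset q w)
    qed (use q w in auto)
    then show "\<exists>w. (\<forall>k<m. w k \<in> tangent_space X (q k)) \<and> u = (\<Sum>k<m. w k)" using w(1) by auto
  qed
qed

section \<open>Dimensions of sums of subspaces\<close>

definition sum_of_subspaces :: "nat set \<Rightarrow> (nat \<Rightarrow> (complex ^ 'n) set) \<Rightarrow> (complex ^ 'n) set" where
  "sum_of_subspaces A T = {\<Sum>k\<in>A. w k |w. \<forall>k\<in>A. w k \<in> T k}"

definition coordinate_projection :: "'n set \<Rightarrow> complex ^ 'n ^ 'n" where
  "coordinate_projection S = (\<chi> i j. if i = j \<and> i \<in> S then 1 else 0)"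

lemma coordinate_projection_nth: "(coordinate_projection S *v w) $ i = (if i \<in> S then w $ i else 0)"
  unfolding coordinate_projection_def matrix_vector_mult_def
  by (simp add: if_distrib[of "\<lambda>c. c * _"] if_bool_eq_conj cong: if_cong)

lemma dim_le_card_of_injective:
  fixes T :: "(complex ^ 'n) set"
  assumes T: "vec.subspace T" and inj: "\<And>w. w \<in> T \<Longrightarrow> \<forall>i\<in>S. w $ i = 0 \<Longrightarrow> w = 0"
  shows "vec.dim T \<le> card S"
proof -
  let ?f = "\<lambda>w. coordinate_projection S *v w"
  have "inj_on ?f (vec.span T)"
    unfolding vec.span_eq_iff[THEN iffD2, OF T]
  proof (rule inj_onI)
    fix u w assume uw: "u \<in> T" "w \<in> T" "?f u = ?f w"
    have "(u - w) $ i = 0" if "i \<in> S" for i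
      using arg_cong[OF uw(3), of "\<lambda>y. y $ i"] that by (simp add: coordinate_projection_nth)
    then have "u - w = 0" using inj[of "u - w"] vec.subspace_diff[OF T uw(1,2)] by blast
    then show "u = w" by simp
  qed
  then have "vec.dim T = vec.dim (?f ` T)"
    by (intro vec.dim_image_eq[symmetric] matrix_vector_mul_linear_gen)
  also have "\<dots> \<le> card ((\<lambda>i. axis i (1::complex)) ` S)"
  proof (rule vec.dim_le_card)
    show "?f ` T \<subseteq> vec.span ((\<lambda>i. axis i 1) ` S)"
    proof clarify
      fix w
      have "?f w = (\<Sum>i\<in>S. w $ i *s axis i 1)"
        by (simp add: vec_eq_iff coordinate_projection_nth sum_component axis_def if_distrib[of "\<lambda>c. _ * c"] cong: if_cong)
      moreover have "\<dots> \<in> vec.span ((\<lambda>i. axis i 1) ` S)"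
        by (intro vec.span_sum vec.span_scale vec.span_base) auto
      ultimately show "?f w \<in> vec.span ((\<lambda>i. axis i 1) ` S)" by simp
    qed
  qed simp
  also have "\<dots> \<le> card S" by (simp add: card_image_le)
  finally show ?thesis .
qed

lemma card_le_dim_of_surjective:
  fixes T :: "(complex ^ 'n) set"
  assumes surj: "\<And>a. \<exists>w\<in>T. \<forall>i\<in>S. w $ i = a i"
  shows "card S \<le> vec.dim T"
proof -
  let ?f = "\<lambda>w. coordinate_projection S *v w" and ?E = "(\<lambda>i. axis i (1::complex)) ` S"
  have "?E \<subseteq> ?f ` T"
  proof clarify
    fix j assume j: "j \<in> S"
    obtain w where w: "w \<in> T" "\<forall>i\<in>S. w $ i = (if i = j then 1 else 0)"
      using surj[of "\<lambda>i. if i = j then 1 else 0"] by blast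
    then have "axis j 1 = ?f w" using j by (auto simp: vec_eq_iff coordinate_projection_nth axis_def)
    then show "axis j 1 \<in> ?f ` T" using w(1) by blast
  qed
  moreover have "vec.independent ?E"
    by (rule vec.independent_mono[OF vec.independent_Basis]) (auto simp: cart_basis_def)
  ultimately have "card ?E \<le> vec.dim (?f ` T)" by (rule vec.independent_card_le_dim)
  also have "\<dots> \<le> vec.dim T" by (intro vec.dim_image_le matrix_vector_mul_linear_gen)
  moreover have "card ?E = card S" by (rule card_image) (auto simp: inj_on_def axis_eq_axis)
  ultimately show ?thesis by simp
qed

lemma sum_of_subspaces_insert:
  assumes "finite A" "k \<notin> A"
  shows "sum_of_subspaces (insert k A) T = {x + y |x y. x \<in> T k \<and> y \<in> sum_of_subspaces A T}"
proof (intro subset_antisym subsetI)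
  fix z assume "z \<in> sum_of_subspaces (insert k A) T"
  then obtain w where "\<forall>l\<in>insert k A. w l \<in> T l" "z = (\<Sum>l\<in>insert k A. w l)"
    unfolding sum_of_subspaces_def by blast
  then show "z \<in> {x + y |x y. x \<in> T k \<and> y \<in> sum_of_subspaces A T}"
    using assms unfolding sum_of_subspaces_def by auto
next
  fix z assume "z \<in> {x + y |x y. x \<in> T k \<and> y \<in> sum_of_subspaces A T}"
  then obtain x w where xw: "x \<in> T k" "\<forall>l\<in>A. w l \<in> T l" "z = x + (\<Sum>l\<in>A. w l)"
    unfolding sum_of_subspaces_def by blast
  have "(\<Sum>l\<in>insert k A. (w(k := x)) l) = z"
  proof -
    have "(\<Sum>l\<in>A. (w(k := x)) l) = (\<Sum>l\<in>A. w l)" by (rule sum.cong) (use assms(2) in auto)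
    then show ?thesis using assms xw(3) by simp
  qed
  moreover have "\<forall>l\<in>insert k A. (w(k := x)) l \<in> T l" using xw(1,2) by simp
  ultimately show "z \<in> sum_of_subspaces (insert k A) T" unfolding sum_of_subspaces_def by blast
qed

lemma subspace_sum_of_subspaces:
  assumes "finite A" "\<And>k. k \<in> A \<Longrightarrow> vec.subspace (T k)"
  shows "vec.subspace (sum_of_subspaces A T)"
  using assms
proof (induction A rule: finite_induct)
  case empty
  show ?case unfolding sum_of_subspaces_def by (simp add: vec.subspace_single_0)
next
  case (insert k A)
  then show ?case unfolding sum_of_subspaces_insert[OF insert(1,2)] by (intro vec.subspace_sums) auto
qed

lemma dim_sum_of_subspaces_le:
  assumes "finite A" "\<And>k. k \<in> A \<Longrightarrow> vec.subspace (T k)" "\<And>k. k \<in> A \<Longrightarrow> vec.dim (T k) \<le> D"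
  shows "vec.dim (sum_of_subspaces A T) \<le> card A * D"
  using assms
proof (induction A rule: finite_induct)
  case empty
  show ?case unfolding sum_of_subspaces_def by simp
next
  case (insert k A)
  have "vec.dim (sum_of_subspaces (insert k A) T) \<le> vec.dim (T k) + vec.dim (sum_of_subspaces A T)"
    unfolding sum_of_subspaces_insert[OF insert(1,2)]
    using vec.dim_sums_Int[of "T k" "sum_of_subspaces A T"] subspace_sum_of_subspaces[of A T] insert by simp
  then show ?case using insert by fastforce
qed

lemma direct_sum_of_dim:
  assumes sub: "\<And>k. k < m \<Longrightarrow> vec.subspace (T k)" and dim: "\<And>k. k < m \<Longrightarrow> vec.dim (T k) \<le> D"
    and big: "m * D \<le> vec.dim (sum_of_subspaces {..<m} T)"
    and w: "\<And>k. k < m \<Longrightarrow> w k \<in> T k" "(\<Sum>k<m. w k) = 0" and j: "j < m"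
  shows "w j = 0"
proof (rule ccontr)
  assume nz: "w j \<noteq> 0"
  let ?A = "{..<m} - {j}"
  have ins: "insert j ?A = {..<m}" using j by auto
  have subA: "vec.subspace (sum_of_subspaces ?A T)" by (rule subspace_sum_of_subspaces) (auto intro: sub)
  have "w j + (\<Sum>k\<in>?A. w k) = 0" using w(2) j by (simp add: sum.remove)
  then have "w j = - (\<Sum>k\<in>?A. w k)" by (simp add: eq_neg_iff_add_eq_0)
  moreover have "(\<Sum>k\<in>?A. w k) \<in> sum_of_subspaces ?A T"
    unfolding sum_of_subspaces_def using w(1) by blast
  ultimately have "w j \<in> sum_of_subspaces ?A T" using vec.subspace_neg[OF subA] by simp
  then have "w j \<in> T j \<inter> sum_of_subspaces ?A T" using w(1)[OF j] by blast
  then have "\<not> T j \<inter> sum_of_subspaces ?A T \<subseteq> {0}" using nz by blast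
  then have "vec.dim (T j \<inter> sum_of_subspaces ?A T) > 0"
    unfolding vec.dim_eq_0[symmetric] by (simp only: neq0_conv)
  moreover have "vec.dim (sum_of_subspaces {..<m} T) + vec.dim (T j \<inter> sum_of_subspaces ?A T) =
      vec.dim (T j) + vec.dim (sum_of_subspaces ?A T)"
    using vec.dim_sums_Int[OF sub[OF j] subA] sum_of_subspaces_insert[of ?A j T] ins by simp
  moreover have "vec.dim (sum_of_subspaces ?A T) \<le> card ?A * D"
    by (rule dim_sum_of_subspaces_le) (auto intro: sub dim)
  moreover have "m * D = D + card ?A * D" using j by (cases m) auto
  ultimately show False using big dim[OF j] by linarith
qed

section \<open>Stabilizers and tangent vector fields\<close>

abbreviation mat_entries :: "(complex ^ 'n ^ 'n \<Rightarrow> complex) set" where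
  "mat_entries \<equiv> range (\<lambda>(i, j) A. A $ i $ j)"

lemma mat_entries_coord: "polynomial_in mat_entries (\<lambda>g :: complex ^ 'n ^ 'n. g $ i $ j)"
  by (rule polynomial_in.coord) (auto intro: image_eqI[of _ _ "(i, j)"])

lemma tangent_space_zariski_closure: "tangent_space (zariski_closure S) x = tangent_space S x"
  unfolding tangent_space_def using zariski_closure_vanish zariski_closure_subset by blast

text \<open>
  If \<open>f\<close> vanishes on \<open>Y\<close> and \<open>y \<in> Y\<close>, then \<open>g \<mapsto> f (g y)\<close> is a polynomial that vanishes on the stabilizer, and
  its derivative at the identity along \<open>A\<close> is that of \<open>f\<close> at \<open>y\<close> along \<open>A y\<close>.
\<close>

lemma stabilizer_lie_algebra_tangent:
  assumes A: "A \<in> stabilizer_lie_algebra Y" and y: "y \<in> Y"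
  shows "A *v y \<in> tangent_space Y y"
  unfolding tangent_space_def
proof (intro CollectI allI impI)
  fix f assume f: "vec_polynomial f" "\<forall>y\<in>Y. f y = 0"
  have "mat_polynomial (\<lambda>g. f (g *v y))"
    using f(1) unfolding vec_polynomial_def mat_polynomial_def
  proof (rule polynomial_in_subst)
    fix c :: "complex ^ 'a \<Rightarrow> complex" assume "c \<in> entries"
    then obtain i where "c = (\<lambda>x. x $ i)" by blast
    then show "polynomial_in mat_entries (\<lambda>g. c (g *v y))"
      by (auto simp: matrix_vector_mult_def
          intro!: polynomial_in_sum polynomial_in.mult polynomial_in.const mat_entries_coord)
  qed
  moreover have "f (g *v y) = 0" if "g \<in> linear_stabilizer Y" for g
    using that f(2) y unfolding linear_stabilizer_def by blast
  ultimately have "((\<lambda>t. f ((\<chi> i j. mat 1 $ i $ j + t * A $ i $ j) *v y)) has_field_derivative 0) (at 0)"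
    using A unfolding stabilizer_lie_algebra_def lie_algebra_of_def by blast
  moreover have "(\<chi> i j. mat 1 $ i $ j + t * A $ i $ j) *v y = y + t *s (A *v y)" for t
  proof -
    have "(\<chi> i j. mat 1 $ i $ j + t * A $ i $ j) *v y = mat 1 *v y + t *s (A *v y)"
      by (simp add: vec_eq_iff matrix_vector_mult_def distrib_right sum.distrib sum_distrib_left mult.assoc)
    then show ?thesis by simp
  qed
  ultimately show "((\<lambda>t. f (y + t *s (A *v y))) has_field_derivative 0) (at 0)" by simp
qed

text \<open>
  The derivation of the polynomial ring that belongs to \<open>A\<close>. Tangency of \<open>A\<close> to a set means that this
  derivation preserves the ideal of the set.
\<close>

lemma derivative_along_linear_field:
  assumes "vec_polynomial f"
  shows "\<exists>g. vec_polynomial g \<and> (\<forall>x. ((\<lambda>t. f (x + t *s (A *v x))) has_field_derivative g x) (at 0))"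
  using assms unfolding vec_polynomial_def
proof (induction)
  case (const c)
  show ?case by (rule exI[of _ "\<lambda>x. 0"]) (auto intro: polynomial_in.const)
next
  case (coord f)
  then obtain i where i: "f = (\<lambda>x. x $ i)" by blast
  have "polynomial_in entries (\<lambda>x. (A *v x) $ i)"
    by (auto simp: matrix_vector_mult_def intro!: polynomial_in_sum polynomial_in.mult polynomial_in.const
        intro: polynomial_in.coord[OF rangeI])
  then show ?case
    by (intro exI[of _ "\<lambda>x. (A *v x) $ i"]) (auto simp: i intro!: derivative_eq_intros)
next
  case (add f g)
  then obtain f' g' where "polynomial_in entries f'" "polynomial_in entries g'"
    "\<And>x. ((\<lambda>t. f (x + t *s (A *v x))) has_field_derivative f' x) (at 0)"
    "\<And>x. ((\<lambda>t. g (x + t *s (A *v x))) has_field_derivative g' x) (at 0)" by blast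
  then show ?case by (intro exI[of _ "\<lambda>x. f' x + g' x"] conjI allI polynomial_in.add DERIV_add)
next
  case (mult f g)
  then obtain f' g' where *: "polynomial_in entries f'" "polynomial_in entries g'"
    "\<And>x. ((\<lambda>t. f (x + t *s (A *v x))) has_field_derivative f' x) (at 0)"
    "\<And>x. ((\<lambda>t. g (x + t *s (A *v x))) has_field_derivative g' x) (at 0)" by blast
  have "((\<lambda>t. f (x + t *s (A *v x)) * g (x + t *s (A *v x))) has_field_derivative f' x * g x + g' x * f x) (at 0)" for x
    using DERIV_mult[OF *(3)[of x] *(4)[of x]] by simp
  moreover have "polynomial_in entries (\<lambda>x. f' x * g x + g' x * f x)"
    using mult.hyps *(1,2) by (intro polynomial_in.add polynomial_in.mult)
  ultimately show ?case by blast
qed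

section \<open>The matrix exponential\<close>

definition mat_pow :: "complex ^ 'n ^ 'n \<Rightarrow> nat \<Rightarrow> complex ^ 'n ^ 'n" where
  "mat_pow A k = ((**) A ^^ k) (mat 1)"

text \<open>
  The exponential of \<open>t A\<close>, as entrywise power series in \<open>t\<close>: convergence and differentiation become statements
  about complex power series in one variable.
\<close>

definition mat_exp :: "complex ^ 'n ^ 'n \<Rightarrow> complex \<Rightarrow> complex ^ 'n ^ 'n" where
  "mat_exp A t = (\<chi> i j. \<Sum>k. mat_pow A k $ i $ j / fact k * t ^ k)"

lemma mat_pow_simps: "mat_pow A 0 = mat 1" "mat_pow A (Suc k) = A ** mat_pow A k"
  by (simp_all add: mat_pow_def)

lemma mat_pow_Suc_right: "mat_pow A (Suc k) = mat_pow A k ** A"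
  by (induction k) (simp_all add: mat_pow_simps matrix_mul_assoc)

lemma mat_pow_bound: "norm (mat_pow A k $ i $ j) \<le> (\<Sum>i\<in>UNIV. \<Sum>j\<in>UNIV. norm (A $ i $ j)) ^ k"
proof (induction k arbitrary: i)
  case 0
  show ?case by (simp add: mat_pow_simps mat_def)
next
  case (Suc k)
  let ?B = "\<Sum>i\<in>UNIV. \<Sum>j\<in>UNIV. norm (A $ i $ j)"
  have B: "?B \<ge> 0" by (intro sum_nonneg) auto
  have "norm (mat_pow A (Suc k) $ i $ j) \<le> (\<Sum>l\<in>UNIV. norm (A $ i $ l) * norm (mat_pow A k $ l $ j))"
    by (simp add: mat_pow_simps matrix_matrix_mult_def norm_mult[symmetric] norm_sum)
  also have "\<dots> \<le> (\<Sum>l\<in>UNIV. norm (A $ i $ l) * ?B ^ k)"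
    by (intro sum_mono mult_left_mono Suc.IH) auto
  also have "\<dots> = (\<Sum>l\<in>UNIV. norm (A $ i $ l)) * ?B ^ k" by (simp add: sum_distrib_right)
  also have "\<dots> \<le> ?B * ?B ^ k"
    by (intro mult_right_mono member_le_sum[of i UNIV "\<lambda>i. \<Sum>j\<in>UNIV. norm (A $ i $ j)"] sum_nonneg zero_le_power B) auto
  finally show ?case by simp
qed

lemma summable_mat_exp: "summable (\<lambda>k. mat_pow A k $ i $ j / fact k * t ^ k)"
proof -
  let ?B = "\<Sum>i\<in>UNIV. \<Sum>j\<in>UNIV. norm (A $ i $ j)"
  have "norm (mat_pow A k $ i $ j / fact k * t ^ k) \<le> inverse (fact k) * (?B * norm t) ^ k" for k
  proof -
    have "norm (mat_pow A k $ i $ j / fact k * t ^ k) = norm (mat_pow A k $ i $ j) * norm t ^ k / fact k"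
      by (simp add: norm_mult norm_divide norm_power)
    also have "\<dots> \<le> ?B ^ k * norm t ^ k / fact k"
      by (intro divide_right_mono mult_right_mono mat_pow_bound) auto
    finally show ?thesis by (simp add: power_mult_distrib field_simps)
  qed
  then show ?thesis by (intro summable_comparison_test'[OF summable_exp[of "?B * norm t"], of 0]) auto
qed

lemma mat_exp_series_Suc:
  "(\<Sum>k. mat_pow A (Suc k) $ i $ j / fact k * t ^ k) = (A ** mat_exp A t) $ i $ j"
  "(\<Sum>k. mat_pow A (Suc k) $ i $ j / fact k * t ^ k) = (mat_exp A t ** A) $ i $ j"
proof -
  have sm: "summable (\<lambda>k. c * (mat_pow A k $ i $ j / fact k * t ^ k))" for c i j
    by (intro summable_mult summable_mat_exp)
  have "(\<Sum>k. mat_pow A (Suc k) $ i $ j / fact k * t ^ k) =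
      (\<Sum>k. \<Sum>l\<in>UNIV. A $ i $ l * (mat_pow A k $ l $ j / fact k * t ^ k))"
    by (simp add: mat_pow_simps matrix_matrix_mult_def sum_divide_distrib sum_distrib_right mult.assoc)
  also have "\<dots> = (\<Sum>l\<in>UNIV. \<Sum>k. A $ i $ l * (mat_pow A k $ l $ j / fact k * t ^ k))"
    by (rule suminf_sum) (rule sm)
  also have "\<dots> = (A ** mat_exp A t) $ i $ j"
    unfolding suminf_mult[OF summable_mat_exp] by (simp add: matrix_matrix_mult_def mat_exp_def)
  finally show "(\<Sum>k. mat_pow A (Suc k) $ i $ j / fact k * t ^ k) = (A ** mat_exp A t) $ i $ j" .
  have "(\<Sum>k. mat_pow A (Suc k) $ i $ j / fact k * t ^ k) =
      (\<Sum>k. \<Sum>l\<in>UNIV. A $ l $ j * (mat_pow A k $ i $ l / fact k * t ^ k))"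
    by (simp add: mat_pow_Suc_right matrix_matrix_mult_def sum_divide_distrib sum_distrib_right
        sum_distrib_left mult_ac)
  also have "\<dots> = (\<Sum>l\<in>UNIV. \<Sum>k. A $ l $ j * (mat_pow A k $ i $ l / fact k * t ^ k))"
    by (rule suminf_sum) (rule sm)
  also have "\<dots> = (mat_exp A t ** A) $ i $ j"
    unfolding suminf_mult[OF summable_mat_exp] by (simp add: matrix_matrix_mult_def mat_exp_def mult.commute)
  finally show "(\<Sum>k. mat_pow A (Suc k) $ i $ j / fact k * t ^ k) = (mat_exp A t ** A) $ i $ j" .
qed

lemma mat_exp_commute: "mat_exp A t ** A = A ** mat_exp A t"
  using mat_exp_series_Suc[of A] by (simp add: vec_eq_iff)

lemma mat_exp_derivative:
  "((\<lambda>t. mat_exp A t $ i $ j) has_field_derivative (A ** mat_exp A t) $ i $ j) (at t)"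
proof -
  have "diffs (\<lambda>k. mat_pow A k $ i $ j / fact k) k = mat_pow A (Suc k) $ i $ j / fact k" for k
    by (simp add: diffs_def del: of_nat_Suc)
  then have "(\<Sum>k. diffs (\<lambda>k. mat_pow A k $ i $ j / fact k) k * t ^ k) = (A ** mat_exp A t) $ i $ j"
    by (simp only: mat_exp_series_Suc(1))
  then show ?thesis
    using termdiffs_strong_converges_everywhere[of "\<lambda>k. mat_pow A k $ i $ j / fact k" t, OF summable_mat_exp]
    by (simp add: mat_exp_def)
qed

lemma mat_exp_0: "mat_exp A 0 = mat 1"
proof -
  have "mat_exp A 0 $ i $ j = mat 1 $ i $ j" for i j
    using powser_zero[of "\<lambda>k. mat_pow A k $ i $ j / fact k"] by (simp add: mat_exp_def mat_pow_simps)
  then show ?thesis by (simp add: vec_eq_iff)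
qed

lemma mat_exp_minus: "mat_exp A t ** mat_exp A (- t) = mat 1"
proof -
  have "(mat_exp A t ** mat_exp A (- t)) $ i $ j = mat 1 $ i $ j" for i j
  proof -
    \<comment> \<open>the derivative of \<open>exp(tA) exp(-tA)\<close> is zero, as \<open>A\<close> commutes with \<open>exp(tA)\<close>\<close>
    let ?h = "\<lambda>t. (mat_exp A t ** mat_exp A (- t)) $ i $ j"
    have "(?h has_field_derivative 0) (at t within UNIV)" for t
    proof -
      have neg: "((\<lambda>t. mat_exp A (- t) $ l $ j) has_field_derivative - (A ** mat_exp A (- t)) $ l $ j) (at t)" for l
      proof -
        have "(uminus has_field_derivative - 1) (at t)"
          using DERIV_minus[OF DERIV_ident, of t] by simp
        from DERIV_chain2[where f = "\<lambda>t. mat_exp A t $ l $ j", OF mat_exp_derivative this]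
        show ?thesis by simp
      qed
      have "((\<lambda>t. \<Sum>l\<in>UNIV. mat_exp A t $ i $ l * mat_exp A (- t) $ l $ j) has_field_derivative
        (\<Sum>l\<in>UNIV. (A ** mat_exp A t) $ i $ l * mat_exp A (- t) $ l $ j
            + - (A ** mat_exp A (- t)) $ l $ j * mat_exp A t $ i $ l)) (at t)"
        by (intro DERIV_sum DERIV_mult mat_exp_derivative neg)
      moreover have "(\<Sum>l\<in>UNIV. (A ** mat_exp A t) $ i $ l * mat_exp A (- t) $ l $ j
            + - (A ** mat_exp A (- t)) $ l $ j * mat_exp A t $ i $ l) =
          ((A ** mat_exp A t) ** mat_exp A (- t)) $ i $ j - (mat_exp A t ** (A ** mat_exp A (- t))) $ i $ j"
        unfolding matrix_matrix_mult_def[of "A ** mat_exp A t"] matrix_matrix_mult_def[of "mat_exp A t"]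
        by (simp add: sum_subtractf mult.commute)
      moreover have "(A ** mat_exp A t) ** mat_exp A (- t) = mat_exp A t ** (A ** mat_exp A (- t))"
        unfolding mat_exp_commute[of A t, symmetric] by (rule matrix_mul_assoc[symmetric])
      ultimately show ?thesis by (simp add: matrix_matrix_mult_def[of "mat_exp A _" "mat_exp A _"])
    qed
    then obtain c where c: "\<And>t. ?h t = c"
      using has_field_derivative_zero_constant[of UNIV ?h] by auto
    have "?h t = ?h 0" unfolding c ..
    then show ?thesis by (simp add: mat_exp_0)
  qed
  then show ?thesis by (simp add: vec_eq_iff)
qed

section \<open>The Lie algebra of the stabilizer\<close>

text \<open>
  If the vector field \<open>A\<close> is tangent to \<open>Y\<close>, then the derivation along it maps the ideal of \<open>Y\<close> to itself. So
  for \<open>f\<close> in the ideal and \<open>y \<in> Y\<close> all derivatives of the entire function \<open>t \<mapsto> f (exp(tA) y)\<close> at \<open>0\<close> vanish, and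
  the function is zero.
\<close>

lemma mat_exp_preserves:
  assumes Y: "zariski_closed Y" and A: "\<And>y. y \<in> Y \<Longrightarrow> A *v y \<in> tangent_space Y y" and y: "y \<in> Y"
  shows "mat_exp A t *v y \<in> Y"
proof (rule zariski_closed_memI[OF Y])
  let ?y = "\<lambda>t. mat_exp A t *v y"
  have step: "\<exists>g. vec_polynomial g \<and> (\<forall>z\<in>Y. g z = 0) \<and>
      (\<forall>t. ((\<lambda>t. f (?y t)) has_field_derivative g (?y t)) (at t))"
    if f: "vec_polynomial f" "\<forall>z\<in>Y. f z = 0" for f
  proof -
    obtain g where g: "vec_polynomial g"
      "\<And>x. ((\<lambda>t. f (x + t *s (A *v x))) has_field_derivative g x) (at 0)"
      using derivative_along_linear_field[OF f(1)] by blast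
    have "g z = 0" if "z \<in> Y" for z
      using A[OF that] f g(2)[of z] DERIV_unique unfolding tangent_space_def by blast
    moreover have "((\<lambda>t. f (?y t)) has_field_derivative g (?y t0)) (at t0)" for t0
    proof -
      have "\<exists>D. ((\<lambda>t. f (?y t)) has_field_derivative D) (at t0) \<and>
          ((\<lambda>t. f (?y t0 + t *s (A *v ?y t0))) has_field_derivative D) (at 0)"
        using f(1) unfolding vec_polynomial_def
      proof (rule polynomial_in_same_jet)
        fix c :: "complex ^ 'a \<Rightarrow> complex" assume "c \<in> entries"
        then obtain i where i: "c = (\<lambda>x. x $ i)" by blast
        have "((\<lambda>t. \<Sum>j\<in>UNIV. mat_exp A t $ i $ j * y $ j) has_field_derivative
            (\<Sum>j\<in>UNIV. (A ** mat_exp A t0) $ i $ j * y $ j)) (at t0)"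
          by (intro DERIV_sum DERIV_cmult_right mat_exp_derivative)
        then have "((\<lambda>t. c (?y t)) has_field_derivative ((A ** mat_exp A t0) *v y) $ i) (at t0)"
          by (simp add: i matrix_vector_mult_def)
        moreover have "((\<lambda>t. c (?y t0 + t *s (A *v ?y t0))) has_field_derivative (A *v ?y t0) $ i) (at 0)"
          unfolding i by (auto intro!: derivative_eq_intros)
        ultimately show "\<exists>D. ((\<lambda>t. c (?y t)) has_field_derivative D) (at t0) \<and>
            ((\<lambda>t. c (?y t0 + t *s (A *v ?y t0))) has_field_derivative D) (at 0)"
          unfolding matrix_vector_mul_assoc by blast
      qed simp
      then show ?thesis using g(2)[of "?y t0"] DERIV_unique by blast
    qed
    ultimately show ?thesis using g(1) by blast
  qed
  have derivs: "(deriv ^^ n) (\<lambda>t. f (?y t)) 0 = 0" if "vec_polynomial f" "\<forall>z\<in>Y. f z = 0" for n f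
    using that
  proof (induction n arbitrary: f)
    case 0
    then show ?case using y by (simp add: mat_exp_0)
  next
    case (Suc n)
    obtain g where g: "vec_polynomial g" "\<forall>z\<in>Y. g z = 0"
      "\<And>t. ((\<lambda>t. f (?y t)) has_field_derivative g (?y t)) (at t)"
      using step[OF Suc.prems] by blast
    have "deriv (\<lambda>t. f (?y t)) = (\<lambda>t. g (?y t))" using g(3) DERIV_imp_deriv by blast
    then show ?case using Suc.IH[OF g(1,2)] by (simp add: funpow_Suc_right del: funpow.simps)
  qed
  fix f assume f: "vec_polynomial f" "\<And>z. z \<in> Y \<Longrightarrow> f z = 0"
  have "(\<lambda>t. f (?y t)) holomorphic_on UNIV"
    using step[of f] f unfolding holomorphic_on_def field_differentiable_def by blast
  then show "f (?y t) = 0"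
    by (rule holomorphic_fun_eq_0_on_connected[of _ _ 0]) (use derivs f in auto)
qed

text \<open>
  By the previous lemma, for \<open>t\<close> and \<open>-t\<close>, the curve \<open>t \<mapsto> exp(tA)\<close> stays in the stabilizer; its velocity at
  \<open>0\<close> is \<open>A\<close>.
\<close>

lemma stabilizer_lie_algebraI:
  assumes Y: "zariski_closed Y" and A: "\<And>y. y \<in> Y \<Longrightarrow> A *v y \<in> tangent_space Y y"
  shows "A \<in> stabilizer_lie_algebra Y"
proof -
  have stab: "mat_exp A t \<in> linear_stabilizer Y" for t
    unfolding linear_stabilizer_def
  proof (intro CollectI conjI)
    show "invertible (mat_exp A t)"
      unfolding invertible_def using mat_exp_minus[of A t] mat_exp_minus[of A "- t"] by auto
    have "y \<in> (*v) (mat_exp A t) ` Y" if "y \<in> Y" for y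
    proof (rule image_eqI)
      show "y = mat_exp A t *v (mat_exp A (- t) *v y)"
        by (simp add: matrix_vector_mul_assoc mat_exp_minus)
      show "mat_exp A (- t) *v y \<in> Y" by (rule mat_exp_preserves[OF Y A that])
    qed
    then show "(*v) (mat_exp A t) ` Y = Y" using mat_exp_preserves[OF Y A] by blast
  qed
  show ?thesis
    unfolding stabilizer_lie_algebra_def lie_algebra_of_def
  proof (intro CollectI allI impI, elim conjE)
    fix F assume F: "mat_polynomial F" "\<forall>g\<in>linear_stabilizer Y. F g = 0"
    let ?l = "\<lambda>t. \<chi> i j. mat 1 $ i $ j + t * A $ i $ j"
    have "\<exists>D. ((\<lambda>t. F (mat_exp A t)) has_field_derivative D) (at 0) \<and>
        ((\<lambda>t. F (?l t)) has_field_derivative D) (at 0)"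
      using F(1) unfolding mat_polynomial_def
    proof (rule polynomial_in_same_jet)
      fix c :: "complex ^ 'a ^ 'a \<Rightarrow> complex" assume "c \<in> mat_entries"
      then obtain i j where c: "c = (\<lambda>A. A $ i $ j)" by auto
      show "c (mat_exp A 0) = c (?l 0)" by (simp add: c mat_exp_0)
      have "((\<lambda>t. c (?l t)) has_field_derivative A $ i $ j) (at 0)"
        unfolding c by (auto intro!: derivative_eq_intros)
      then show "\<exists>D. ((\<lambda>t. c (mat_exp A t)) has_field_derivative D) (at 0) \<and>
          ((\<lambda>t. c (?l t)) has_field_derivative D) (at 0)"
        using mat_exp_derivative[of A i j 0] unfolding c by (auto simp: mat_exp_0)
    qed
    moreover have "F (mat_exp A t) = 0" for t using F(2) stab by blast
    ultimately show "((\<lambda>t. F (?l t)) has_field_derivative 0) (at 0)"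
      using DERIV_unique[OF DERIV_const[of 0]] by auto
  qed
qed

lemma linear_stabilizer_zariski_closure:
  assumes "g \<in> linear_stabilizer S"
  shows "g \<in> linear_stabilizer (zariski_closure S)"
proof -
  obtain g' where g': "g ** g' = mat 1" "g' ** g = mat 1" and gS: "(*v) g ` S = S"
    using assms unfolding linear_stabilizer_def invertible_def by blast
  have "(*v) g' ` S = (*v) g' ` (*v) g ` S" by (simp only: gS)
  also have "\<dots> = S" by (simp add: image_image matrix_vector_mul_assoc g')
  finally have g'S: "(*v) g' ` S = S" .
  have sub: "h *v x \<in> zariski_closure S" if h: "(*v) h ` S = S" and x: "x \<in> zariski_closure S" for h x
  proof (rule zariski_closed_memI[OF zariski_closed_closure])
    fix f assume f: "vec_polynomial f" "\<And>y. y \<in> zariski_closure S \<Longrightarrow> f y = 0"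
    have "vec_polynomial (\<lambda>x. f (h *v x))"
      using f(1) unfolding vec_polynomial_def
      by (rule polynomial_in_subst)
         (auto simp: matrix_vector_mult_def intro!: polynomial_in_sum polynomial_in.mult polynomial_in.const
           intro: polynomial_in.coord[OF rangeI])
    moreover have "f (h *v y) = 0" if "y \<in> S" for y
      using f(2) zariski_closure_subset[of S] h that by blast
    ultimately show "f (h *v x) = 0" using zariski_closure_vanish[OF _ _ x] by blast
  qed
  have "x \<in> (*v) g ` zariski_closure S" if "x \<in> zariski_closure S" for x
    by (rule image_eqI[OF _ sub[OF g'S that]]) (simp add: matrix_vector_mul_assoc g')
  then have "(*v) g ` zariski_closure S = zariski_closure S" using sub[OF gS] by blast
  then show ?thesis using assms unfolding linear_stabilizer_def by blast
qed

lemma linear_stabilizer_sums_of: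
  assumes "g \<in> linear_stabilizer X"
  shows "g \<in> linear_stabilizer (sums_of m X)"
proof -
  have gX: "(*v) g ` X = X" and inv: "invertible g" using assms unfolding linear_stabilizer_def by auto
  have lin: "g *v (\<Sum>k<m. q k) = (\<Sum>k<m. g *v q k)" for q :: "nat \<Rightarrow> complex ^ 'a"
    by (rule vec.linear_sum[OF matrix_vector_mul_linear_gen])
  have "(*v) g ` sums_of m X = sums_of m X"
  proof (intro subset_antisym subsetI)
    fix z assume "z \<in> (*v) g ` sums_of m X"
    then obtain q where q: "q \<in> tuples m X" "z = g *v (\<Sum>k<m. q k)" unfolding sums_of_def by blast
    have "(\<lambda>k. g *v q k) \<in> tuples m X" using q(1) gX unfolding tuples_def by blast
    then show "z \<in> sums_of m X" unfolding q(2) lin sums_of_def by blast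
  next
    fix z assume "z \<in> sums_of m X"
    then obtain q where q: "q \<in> tuples m X" "z = (\<Sum>k<m. q k)" unfolding sums_of_def by blast
    have "\<exists>p. \<forall>k<m. p k \<in> X \<and> q k = g *v p k" using q(1) gX unfolding tuples_def by (intro choice_iff'[THEN iffD1]) blast
    then obtain p where p: "\<And>k. k < m \<Longrightarrow> p k \<in> X \<and> q k = g *v p k" by blast
    have "z = g *v (\<Sum>k<m. p k)" unfolding q(2) lin by (rule sum.cong) (use p in auto)
    moreover have "p \<in> tuples m X" using p unfolding tuples_def by blast
    ultimately show "z \<in> (*v) g ` sums_of m X" unfolding sums_of_def by blast
  qed
  then show ?thesis using inv unfolding linear_stabilizer_def by blast
qed

text \<open>
  The stabilizer of \<open>X\<close> is contained in that of the secant variety, and the Lie algebra is monotone in the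
  group.
\<close>

lemma stabilizer_lie_algebra_subset_secant:
  "stabilizer_lie_algebra X \<subseteq> stabilizer_lie_algebra (secant_variety r X)"
  unfolding stabilizer_lie_algebra_def lie_algebra_of_def secant_variety_eq
  using linear_stabilizer_zariski_closure linear_stabilizer_sums_of by blast

section \<open>Generic tuples\<close>

text \<open>
  Rescaling by \<open>c\<close> maps \<open>X\<close> to itself and \<open>x\<close> to \<open>c x\<close>, so it maps \<open>T\<^sub>x X\<close> onto \<open>T\<^bsub>c x\<^esub> X\<close>; on a linear space
  it acts as the identity on subspaces.
\<close>

lemma tangent_space_rescale:
  assumes X: "invariant_under_rescaling X" and c: "c \<noteq> 0" and w: "w \<in> tangent_space X (c *s x)"
  shows "w \<in> tangent_space X x"
proof -
  have "inverse c *s w \<in> tangent_space X x"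
    unfolding tangent_space_def
  proof (intro CollectI allI impI)
    fix f assume f: "vec_polynomial f" "\<forall>y\<in>X. f y = 0"
    have "vec_polynomial (\<lambda>y. f (inverse c *s y))"
      using f(1) unfolding vec_polynomial_def
      by (rule polynomial_in_subst)
         (auto intro!: polynomial_in.mult polynomial_in.const intro: polynomial_in.coord[OF rangeI])
    moreover have "f (inverse c *s y) = 0" if "y \<in> X" for y
      using X f(2) that unfolding invariant_under_rescaling_def by blast
    ultimately have "((\<lambda>t. f (inverse c *s (c *s x + t *s w))) has_field_derivative 0) (at 0)"
      using w unfolding tangent_space_def by blast
    moreover have "inverse c *s (c *s x + t *s w) = x + t *s (inverse c *s w)" for t
      using c by (simp add: vec_eq_iff field_simps)
    ultimately show "((\<lambda>t. f (x + t *s (inverse c *s w))) has_field_derivative 0) (at 0)" by simp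
  qed
  then have "c *s (inverse c *s w) \<in> tangent_space X x"
    by (rule vec.subspace_scale[OF subspace_tangent_space])
  then show ?thesis using c by (simp add: vec_eq_iff)
qed

text \<open>
  The increasing enumeration of the natural numbers other than \<open>j\<close>.
\<close>

definition skip :: "nat \<Rightarrow> nat \<Rightarrow> nat" where
  "skip j k = (if k < j then k else Suc k)"

lemma sum_skip:
  fixes v :: "nat \<Rightarrow> 'a::comm_monoid_add"
  assumes "j \<le> r"
  shows "(\<Sum>i<Suc r. if i = j then 0 else v (if i < j then i else i - 1)) = (\<Sum>k<r. v k)"
proof -
  have "(\<Sum>i<Suc r. if i = j then 0 else v (if i < j then i else i - 1)) =
      (\<Sum>i\<in>{..<Suc r} - {j}. v (if i < j then i else i - 1))"
    by (rule sum.mono_neutral_cong_right) auto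
  also have "\<dots> = (\<Sum>k<r. v k)"
    by (rule sum.reindex_bij_witness[of _ "skip j" "\<lambda>i. if i < j then i else i - 1"])
       (use assms in \<open>auto simp: skip_def split: if_splits\<close>)
  finally show ?thesis .
qed

text \<open>
  The assumption on Krull dimensions transfers to transcendence degrees because the two are compared in opposite
  directions: the Krull dimension of \<open>X\<close> is bounded from below and that of the secant variety from above.
\<close>

lemma alg_dim_secant_variety:
  assumes X: "irreducible_variety X" and dim: "secant_has_expected_dim m X"
  shows "m * alg_dim X \<le> alg_dim (sums_of m X)"
proof -
  have ne: "sums_of m X \<noteq> {}"
    using irreducible_on_sums_of[OF irreducible_variety_imp_irreducible_on[OF X]] by (auto simp: irreducible_on_def)
  have "enat (m * alg_dim X) = of_nat m * enat (alg_dim X)"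
    by (simp add: of_nat_eq_enat)
  also have "\<dots> \<le> of_nat m * variety_dim X"
    by (intro mult_left_mono alg_dim_le_variety_dim[OF X]) simp
  also have "\<dots> = variety_dim (secant_variety m X)"
    using dim unfolding secant_has_expected_dim_def by simp
  also have "\<dots> \<le> enat (alg_dim (secant_variety m X))" by (rule variety_dim_le_alg_dim)
  finally have "m * alg_dim X \<le> alg_dim (secant_variety m X)" by simp
  also have "\<dots> \<le> alg_dim (sums_of m X)"
  proof -
    have "secant_variety m X \<noteq> {}" using ne zariski_closure_subset unfolding secant_variety_eq by blast
    then obtain S where S: "vec_independent S (secant_variety m X)" "card S = alg_dim (secant_variety m X)"
      using alg_dim_witness by blast
    have "vec_independent S (sums_of m X)"
      unfolding vec_independent_def alg_independent_on_def
    proof (intro allI impI)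
      fix f x assume f: "polynomial_in (coords S) f" "\<forall>v\<in>vec_nth ` sums_of m X. f v = 0"
      have "f (vec_nth y) = 0" if "y \<in> secant_variety m X" for y
        by (rule zariski_closure_vanish[OF coords_as_vec_polynomial[OF f(1)]])
           (use f(2) that in \<open>auto simp: secant_variety_eq\<close>)
      then show "f x = 0" using S(1) f(1) unfolding vec_independent_def alg_independent_on_def by blast
    qed
    then show ?thesis using card_le_alg_dim S(2) by metis
  qed
  finally show ?thesis .
qed

text \<open>
  The sum of the \<open>m\<close> tangent spaces projects onto at least \<open>m \<cdot> dim X\<close> coordinates, while each of them has
  dimension at most \<open>dim X\<close>.
\<close>

lemma generic_tuple_direct_sum:
  assumes X: "irreducible_variety X" and dim: "secant_has_expected_dim m X"
  shows "\<exists>H. polynomial_in (tuple_entries m) H \<and> (\<exists>q\<in>tuples m X. H q \<noteq> 0) \<and>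
    (\<forall>q\<in>tuples m X. H q \<noteq> 0 \<longrightarrow> (\<forall>w. (\<forall>k<m. w k \<in> tangent_space X (q k)) \<longrightarrow>
       (\<Sum>k<m. w k) = 0 \<longrightarrow> (\<forall>k<m. w k = 0)))"
proof -
  have irr: "irreducible_on entries X" by (rule irreducible_variety_imp_irreducible_on[OF X])
  then have ne: "X \<noteq> {}" "sums_of m X \<noteq> {}"
    using irreducible_on_sums_of[OF irr] by (auto simp: irreducible_on_def)
  obtain R where R: "vec_independent R X" "card R = alg_dim X" using alg_dim_witness[OF ne(1)] by blast
  obtain h where h: "vec_polynomial h" "\<exists>x\<in>X. h x \<noteq> 0"
    "\<And>x w. x \<in> X \<Longrightarrow> h x \<noteq> 0 \<Longrightarrow> w \<in> tangent_space X x \<Longrightarrow> \<forall>i\<in>R. w $ i = 0 \<Longrightarrow> w = 0"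
    using vec_generic_section[OF irr R(1) maximal_vec_independent[OF R]] by blast
  obtain S where S: "vec_independent S (sums_of m X)" "card S = alg_dim (sums_of m X)"
    using alg_dim_witness[OF ne(2)] by blast
  obtain K where K: "polynomial_in (tuple_entries m) K" "\<exists>q\<in>tuples m X. K q \<noteq> 0"
    "\<And>q a. q \<in> tuples m X \<Longrightarrow> K q \<noteq> 0 \<Longrightarrow> \<exists>w. (\<forall>k<m. w k \<in> tangent_space X (q k)) \<and>
       (\<forall>i\<in>S. (\<Sum>k<m. w k) $ i = a i)"
    using tangent_sum_prescribed[OF irr S(1)] by blast
  define H where "H = (\<lambda>q. K q * (\<Prod>k<m. h (q k)))"
  have hk: "polynomial_in (tuple_entries m) (\<lambda>q. h (q k))" if "k < m" for k
    using h(1) unfolding vec_polynomial_def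
    by (rule polynomial_in_subst) (use that in \<open>auto intro: tuple_entries_coord\<close>)
  have hp: "polynomial_in (tuple_entries m) (\<lambda>q. \<Prod>k<m. h (q k))" by (intro polynomial_in_prod hk) simp
  obtain x where x: "x \<in> X" "h x \<noteq> 0" using h(2) by blast
  have "\<exists>q\<in>tuples m X. (\<Prod>k<m. h (q k)) \<noteq> 0"
    by (rule bexI[of _ "\<lambda>_. x"]) (use x in \<open>auto simp: tuples_def\<close>)
  from irreducible_on_both_nonzero[OF irreducible_on_tuples[OF irr] K(1) hp K(2) this]
  have nz: "\<exists>q\<in>tuples m X. H q \<noteq> 0" unfolding H_def by (metis mult_eq_0_iff)
  have "w j = 0" if q: "q \<in> tuples m X" "H q \<noteq> 0" and w: "\<forall>k<m. w k \<in> tangent_space X (q k)"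
    "(\<Sum>k<m. w k) = 0" and j: "j < m" for q w j
  proof (rule direct_sum_of_dim[of m "\<lambda>k. tangent_space X (q k)" "alg_dim X" w])
    show "vec.subspace (tangent_space X (q k))" for k by (rule subspace_tangent_space)
    show "vec.dim (tangent_space X (q k)) \<le> alg_dim X" if "k < m" for k
      unfolding R(2)[symmetric]
    proof (rule dim_le_card_of_injective[OF subspace_tangent_space])
      have "h (q k) \<noteq> 0" "q k \<in> X" using q that by (auto simp: H_def tuples_def)
      then show "u = 0" if "u \<in> tangent_space X (q k)" "\<forall>i\<in>R. u $ i = 0" for u using h(3) that by blast
    qed
    have "m * alg_dim X \<le> card S" using alg_dim_secant_variety[OF X dim] S(2) by simp
    also have "\<dots> \<le> vec.dim (sum_of_subspaces {..<m} (\<lambda>k. tangent_space X (q k)))"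
    proof (rule card_le_dim_of_surjective)
      fix a
      have "K q \<noteq> 0" using q by (auto simp: H_def)
      from K(3)[OF q(1) this, of a] obtain w where w: "\<forall>k<m. w k \<in> tangent_space X (q k)"
        "\<forall>i\<in>S. (\<Sum>k<m. w k) $ i = a i" by blast
      show "\<exists>w\<in>sum_of_subspaces {..<m} (\<lambda>k. tangent_space X (q k)). \<forall>i\<in>S. w $ i = a i"
        by (rule bexI[of _ "\<Sum>k<m. w k"]) (use w in \<open>auto simp: sum_of_subspaces_def\<close>)
    qed
    finally show "m * alg_dim X \<le> vec.dim (sum_of_subspaces {..<m} (\<lambda>k. tangent_space X (q k)))" .
  qed (use w j in auto)
  moreover have "polynomial_in (tuple_entries m) H" unfolding H_def by (intro polynomial_in.mult K hp)
  ultimately show ?thesis using nz by blast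
qed

definition double_first :: "(nat \<Rightarrow> complex ^ 'n) \<Rightarrow> nat \<Rightarrow> complex ^ 'n" where
  "double_first q = q(0 := 2 *s q 0)"

lemma double_first_tuples:
  "invariant_under_rescaling X \<Longrightarrow> q \<in> tuples m X \<Longrightarrow> double_first q \<in> tuples m X"
  unfolding double_first_def tuples_def invariant_under_rescaling_def by auto

text \<open>
  Terracini's lemma for \<open>q\<close> and for the tuple with first entry doubled: the tangent spaces involved are the same,
  and the two sums of points differ by \<open>q 0\<close>.
\<close>

lemma terracini_first_image:
  assumes irr: "irreducible_on entries X" and inv: "invariant_under_rescaling X" and r: "r \<ge> 1"
    and A: "A \<in> stabilizer_lie_algebra (secant_variety r X)"
  shows "\<exists>H. polynomial_in (tuple_entries r) H \<and> (\<exists>q\<in>tuples r X. H q \<noteq> 0) \<and>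
    (\<forall>q\<in>tuples r X. H q \<noteq> 0 \<longrightarrow>
       (\<exists>w. (\<forall>k<r. w k \<in> tangent_space X (q k)) \<and> A *v q 0 = (\<Sum>k<r. w k)))"
proof -
  obtain K where K: "polynomial_in (tuple_entries r) K" "\<exists>q\<in>tuples r X. K q \<noteq> 0"
    "\<And>q u. q \<in> tuples r X \<Longrightarrow> K q \<noteq> 0 \<Longrightarrow> u \<in> tangent_space (sums_of r X) (\<Sum>k<r. q k) \<Longrightarrow>
       \<exists>w. (\<forall>k<r. w k \<in> tangent_space X (q k)) \<and> u = (\<Sum>k<r. w k)"
    using terracini[OF irr, of r] by blast
  have image: "\<exists>w. (\<forall>k<r. w k \<in> tangent_space X (q k)) \<and> A *v (\<Sum>k<r. q k) = (\<Sum>k<r. w k)"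
    if q: "q \<in> tuples r X" "K q \<noteq> 0" for q
  proof (rule K(3)[OF q])
    have "(\<Sum>k<r. q k) \<in> secant_variety r X"
      unfolding secant_variety_eq sums_of_def
      by (rule subsetD[OF zariski_closure_subset imageI[OF q(1)]])
    from stabilizer_lie_algebra_tangent[OF A this]
    show "A *v (\<Sum>k<r. q k) \<in> tangent_space (sums_of r X) (\<Sum>k<r. q k)"
      by (simp add: secant_variety_eq tangent_space_zariski_closure)
  qed
  have Kd: "polynomial_in (tuple_entries r) (\<lambda>q. K (double_first q))"
  proof (rule polynomial_in_subst[OF K(1)])
    fix c :: "(nat \<Rightarrow> complex ^ 'a) \<Rightarrow> complex" assume "c \<in> tuple_entries r"
    then obtain k i where ki: "k < r" "c = (\<lambda>q. q k $ i)" unfolding tuple_entries_def by blast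
    then show "polynomial_in (tuple_entries r) (\<lambda>q. c (double_first q))"
      by (cases "k = 0")
         (auto simp: double_first_def intro!: polynomial_in.mult polynomial_in.const tuple_entries_coord)
  qed
  have "\<exists>q\<in>tuples r X. K (double_first q) \<noteq> 0"
  proof -
    obtain q where q: "q \<in> tuples r X" "K q \<noteq> 0" using K(2) by blast
    have "q(0 := (1 / 2) *s q 0) \<in> tuples r X"
      using q(1) inv unfolding tuples_def invariant_under_rescaling_def by auto
    moreover have "double_first (q(0 := (1 / 2) *s q 0)) = q"
      by (auto simp: double_first_def fun_eq_iff vec_eq_iff)
    ultimately show ?thesis using q(2) by metis
  qed
  from irreducible_on_both_nonzero[OF irreducible_on_tuples[OF irr] K(1) Kd K(2) this]
  have nz: "\<exists>q\<in>tuples r X. K q * K (double_first q) \<noteq> 0" by (metis mult_eq_0_iff)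
  have decomp: "\<exists>w. (\<forall>k<r. w k \<in> tangent_space X (q k)) \<and> A *v q 0 = (\<Sum>k<r. w k)"
    if q: "q \<in> tuples r X" "K q * K (double_first q) \<noteq> 0" for q
  proof -
    obtain w where w: "\<forall>k<r. w k \<in> tangent_space X (q k)" "A *v (\<Sum>k<r. q k) = (\<Sum>k<r. w k)"
      using image[of q] q by auto
    obtain u where u: "\<forall>k<r. u k \<in> tangent_space X (double_first q k)"
      "A *v (\<Sum>k<r. double_first q k) = (\<Sum>k<r. u k)"
      using image[of "double_first q"] double_first_tuples[OF inv q(1)] q(2) by auto
    have uq: "u k \<in> tangent_space X (q k)" if "k < r" for k
      using u(1) that tangent_space_rescale[OF inv, of 2 "u k" "q k"]
      by (cases "k = 0") (auto simp: double_first_def)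
    have "(\<Sum>k<r. double_first q k) = (\<Sum>k<r. q k + (if k = 0 then q 0 else 0))"
      by (intro sum.cong refl) (auto simp: double_first_def vec_eq_iff)
    also have "\<dots> = (\<Sum>k<r. q k) + q 0" using r by (simp add: sum.distrib)
    finally have "A *v q 0 = (\<Sum>k<r. u k - w k)"
      using u(2) w(2) by (simp add: matrix_vector_right_distrib sum_subtractf eq_diff_eq add.commute)
    moreover have "u k - w k \<in> tangent_space X (q k)" if "k < r" for k
      using uq w(1) that by (intro vec.subspace_diff subspace_tangent_space) auto
    ultimately show ?thesis by (intro exI[of _ "\<lambda>k. u k - w k"]) simp
  qed
  show ?thesis
  proof (intro exI[of _ "\<lambda>q. K q * K (double_first q)"] conjI)
    show "polynomial_in (tuple_entries r) (\<lambda>q. K q * K (double_first q))"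
      by (rule polynomial_in.mult[OF K(1) Kd])
  qed (use nz decomp in blast)+
qed

text \<open>
  By \<open>terracini_first_image\<close>, for each \<open>j\<close> from \<open>1\<close> to \<open>r\<close> the vector \<open>A q\<^sub>0\<close> lies in the sum of the tangent
  spaces at the points other than \<open>q\<^sub>j\<close>. The sum of all \<open>r + 1\<close> tangent spaces being direct, these
  decompositions coincide, and only the component at \<open>q\<^sub>0\<close> is left.
\<close>

lemma generic_image_tangent:
  assumes X: "irreducible_variety X" and inv: "invariant_under_rescaling X" and r: "r \<ge> 1"
    and dim: "secant_has_expected_dim (r + 1) X"
    and A: "A \<in> stabilizer_lie_algebra (secant_variety r X)"
  shows "\<exists>H. polynomial_in (tuple_entries (r + 1)) H \<and> (\<exists>q\<in>tuples (r + 1) X. H q \<noteq> 0) \<and>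
    (\<forall>q\<in>tuples (r + 1) X. H q \<noteq> 0 \<longrightarrow> A *v q 0 \<in> tangent_space X (q 0))"
proof -
  let ?m = "r + 1"
  have irr: "irreducible_on entries X" by (rule irreducible_variety_imp_irreducible_on[OF X])
  obtain D where D: "polynomial_in (tuple_entries ?m) D" "\<exists>q\<in>tuples ?m X. D q \<noteq> 0"
    "\<And>q w. q \<in> tuples ?m X \<Longrightarrow> D q \<noteq> 0 \<Longrightarrow> \<forall>k<?m. w k \<in> tangent_space X (q k) \<Longrightarrow>
       (\<Sum>k<?m. w k) = 0 \<Longrightarrow> \<forall>k<?m. w k = 0"
    using generic_tuple_direct_sum[OF X dim] by blast
  obtain K where K: "polynomial_in (tuple_entries r) K" "\<exists>q\<in>tuples r X. K q \<noteq> 0"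
    "\<And>q. q \<in> tuples r X \<Longrightarrow> K q \<noteq> 0 \<Longrightarrow>
       \<exists>w. (\<forall>k<r. w k \<in> tangent_space X (q k)) \<and> A *v q 0 = (\<Sum>k<r. w k)"
    using terracini_first_image[OF irr inv r A] by blast
  \<comment> \<open>the genericity conditions: index \<open>0\<close> for the direct sum, \<open>j \<ge> 1\<close> for the tuple without entry \<open>j\<close>\<close>
  define G where "G = (\<lambda>j q. if j = 0 then D q else K (q \<circ> skip j))"
  have skip_tuples: "q \<circ> skip j \<in> tuples r X" if "q \<in> tuples ?m X" for q j
    using that by (auto simp: tuples_def skip_def)
  have Gpoly: "polynomial_in (tuple_entries ?m) (G j)" for j
  proof (cases "j = 0")
    case True
    then show ?thesis using D(1) by (simp add: G_def)
  next
    case False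
    have "polynomial_in (tuple_entries ?m) (\<lambda>q. K (q \<circ> skip j))"
    proof (rule polynomial_in_subst[OF K(1)])
      fix c :: "(nat \<Rightarrow> complex ^ 'a) \<Rightarrow> complex" assume "c \<in> tuple_entries r"
      then obtain k i where ki: "k < r" "c = (\<lambda>q. q k $ i)" unfolding tuple_entries_def by blast
      then show "polynomial_in (tuple_entries ?m) (\<lambda>q. c (q \<circ> skip j))"
        by (auto simp: skip_def intro!: tuple_entries_coord)
    qed
    then show ?thesis using False by (simp add: G_def)
  qed
  have Gnz: "\<exists>q\<in>tuples ?m X. G j q \<noteq> 0" for j
  proof (cases "j = 0")
    case True
    then show ?thesis using D(2) by (simp add: G_def)
  next
    case False
    obtain p where p: "p \<in> tuples r X" "K p \<noteq> 0" using K(2) by blast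
    obtain x where x: "x \<in> X" using irr by (auto simp: irreducible_on_def)
    let ?q = "\<lambda>i. if i < j then (if i < r then p i else x) else if i = j then x else p (i - 1)"
    have "?q \<in> tuples ?m X" using p(1) x by (auto simp: tuples_def)
    moreover have "K (?q \<circ> skip j) = K p"
      by (rule polynomial_in_cong[OF K(1)]) (auto simp: tuple_entries_def skip_def)
    ultimately show ?thesis using p(2) False by (auto simp: G_def intro!: bexI[of _ ?q])
  qed
  have main: "A *v q 0 \<in> tangent_space X (q 0)"
    if q: "q \<in> tuples ?m X" "\<And>j. j \<le> r \<Longrightarrow> G j q \<noteq> 0" for q
  proof -
    have Dq: "D q \<noteq> 0" using q(2)[of 0] by (simp add: G_def)
    have omit: "\<exists>w. (\<forall>k<?m. w k \<in> tangent_space X (q k)) \<and> w j = 0 \<and> A *v q 0 = (\<Sum>k<?m. w k)"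
      if j: "1 \<le> j" "j \<le> r" for j
    proof -
      have "K (q \<circ> skip j) \<noteq> 0" using q(2)[OF j(2)] j(1) by (simp add: G_def)
      from K(3)[OF skip_tuples[OF q(1)] this] obtain v where
        v: "\<And>k. k < r \<Longrightarrow> v k \<in> tangent_space X (q (skip j k))" "A *v q 0 = (\<Sum>k<r. v k)"
        using j(1) by (auto simp: skip_def)
      let ?w = "\<lambda>i. if i = j then 0 else v (if i < j then i else i - 1)"
      have "?w k \<in> tangent_space X (q k)" if k: "k < ?m" for k
      proof -
        consider "k = j" | "k < j" | "k > j" by linarith
        then show ?thesis
        proof cases
          case 1
          then show ?thesis using vec.subspace_0[OF subspace_tangent_space] by simp
        next
          case 2
          then show ?thesis using v(1)[of k] j by (simp add: skip_def)
        next
          case 3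
          then have "skip j (k - 1) = k" "k - 1 < r" using k by (auto simp: skip_def)
          then show ?thesis using v(1)[of "k - 1"] 3 by simp
        qed
      qed
      then show ?thesis using v(2) sum_skip[OF j(2), of v]
        by (intro exI[of _ ?w] conjI) auto
    qed
    obtain w where w: "\<And>k. k < ?m \<Longrightarrow> w k \<in> tangent_space X (q k)" "A *v q 0 = (\<Sum>k<?m. w k)"
      using omit[of 1] r by blast
    have "w j = 0" if j: "1 \<le> j" "j \<le> r" for j
    proof -
      obtain u where u: "\<forall>k<?m. u k \<in> tangent_space X (q k)" "u j = 0" "A *v q 0 = (\<Sum>k<?m. u k)"
        using omit[OF j] by blast
      have "\<forall>k<?m. w k - u k = 0"
      proof (rule D(3)[OF q(1) Dq])
        show "\<forall>k<?m. w k - u k \<in> tangent_space X (q k)"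
          using w(1) u(1) vec.subspace_diff[OF subspace_tangent_space] by blast
        show "(\<Sum>k<?m. w k - u k) = 0" using w(2) u(3) by (simp add: sum_subtractf)
      qed
      then show ?thesis using u(2) j by auto
    qed
    then have "(\<Sum>k<?m. w k) = w 0"
      by (subst sum.remove[of _ 0]) (auto intro!: sum.neutral)
    then show ?thesis using w(1)[of 0] w(2) by simp
  qed
  have "\<exists>q\<in>tuples ?m X. \<forall>j\<in>{..r}. G j q \<noteq> 0"
    by (rule irreducible_on_all_nonzero[OF irreducible_on_tuples[OF irr] finite_atMost Gpoly Gnz])
  then have "\<exists>q\<in>tuples ?m X. (\<Prod>j\<le>r. G j q) \<noteq> 0" by auto
  moreover have "polynomial_in (tuple_entries ?m) (\<lambda>q. \<Prod>j\<le>r. G j q)" by (intro polynomial_in_prod Gpoly)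
  moreover have "\<forall>q\<in>tuples ?m X. (\<Prod>j\<le>r. G j q) \<noteq> 0 \<longrightarrow> A *v q 0 \<in> tangent_space X (q 0)"
    using main by auto
  ultimately show ?thesis by blast
qed

text \<open>
  The derivative of \<open>f\<close> at \<open>x\<close> along \<open>A x\<close> is a polynomial in \<open>x\<close>, and a polynomial that vanishes generically
  on an irreducible set vanishes on it.
\<close>

lemma image_tangent_everywhere:
  assumes irr: "irreducible_on entries X" and m: "m > 0"
    and H: "polynomial_in (tuple_entries m) H" "\<exists>q\<in>tuples m X. H q \<noteq> 0"
    "\<And>q. q \<in> tuples m X \<Longrightarrow> H q \<noteq> 0 \<Longrightarrow> A *v q 0 \<in> tangent_space X (q 0)"
    and x: "x \<in> X"
  shows "A *v x \<in> tangent_space X x"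
  unfolding tangent_space_def
proof (intro CollectI allI impI)
  fix f assume f: "vec_polynomial f" "\<forall>y\<in>X. f y = 0"
  obtain g where g: "vec_polynomial g" "\<And>x. ((\<lambda>t. f (x + t *s (A *v x))) has_field_derivative g x) (at 0)"
    using derivative_along_linear_field[OF f(1)] by blast
  have g0: "polynomial_in (tuple_entries m) (\<lambda>q. g (q 0))"
    using g(1) unfolding vec_polynomial_def
    by (rule polynomial_in_subst) (use m in \<open>auto intro: tuple_entries_coord\<close>)
  have vanish: "g (q 0) = 0" if "q \<in> tuples m X" "H q \<noteq> 0" for q
    using H(3)[OF that] f g(2)[of "q 0"] DERIV_unique unfolding tangent_space_def by blast
  obtain p where p: "p \<in> tuples m X" "H p \<noteq> 0" using H(2) by blast
  have "g x = 0"
    using irreducible_onD[OF irreducible_on_tuples[OF irr] H(1) g0, of p "\<lambda>_. x"] vanish p x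
    by (auto simp: tuples_def)
  then show "((\<lambda>t. f (x + t *s (A *v x))) has_field_derivative 0) (at 0)" using g(2)[of x] by simp
qed

theorem theorem8p1:
  fixes X :: "(complex ^ 'n) set" and r :: nat
  assumes "irreducible_variety X"
    and "invariant_under_rescaling X"
    and "r \<ge> 1"
    and "secant_has_expected_dim (r + 1) X"
  shows "stabilizer_lie_algebra (secant_variety r X) = stabilizer_lie_algebra X"
proof (intro subset_antisym subsetI)
  fix A assume "A \<in> stabilizer_lie_algebra (secant_variety r X)"
  from generic_image_tangent[OF assms this] obtain H where
    H: "polynomial_in (tuple_entries (r + 1)) H" "\<exists>q\<in>tuples (r + 1) X. H q \<noteq> 0"
    "\<And>q. q \<in> tuples (r + 1) X \<Longrightarrow> H q \<noteq> 0 \<Longrightarrow> A *v q 0 \<in> tangent_space X (q 0)" by blast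
  show "A \<in> stabilizer_lie_algebra X"
  proof (rule stabilizer_lie_algebraI)
    show "zariski_closed X" using assms(1) unfolding irreducible_variety_def by blast
    show "A *v x \<in> tangent_space X x" if "x \<in> X" for x
      by (rule image_tangent_everywhere[of X "r + 1" H])
         (use irreducible_variety_imp_irreducible_on[OF assms(1)] H that in auto)
  qed
next
  fix A assume "A \<in> stabilizer_lie_algebra X"
  then show "A \<in> stabilizer_lie_algebra (secant_variety r X)"
    using stabilizer_lie_algebra_subset_secant by blast
qed

end
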